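(* Fix $\varepsilon>0$. Let $L_1,L_2$ be positive integers, $K_{-L_1},\dots,K_{L_2}\subseteq[N]$ pairwise disjoint with union $[N]$, $x_0=\sum_{i=-L_1}^{L_2}i\,\mathbb{1}_{K_i}$, $K=\bigcup_{i\ne0}K_i$, $\hat K=K\setminus(K_{-L_1}\cup K_{L_2})$, $k_i=|K_i|$ for $i\in\{-L_1,0,L_2\}$, $\hat k=|\hat K|$. Let $A\in\mathbb{R}^{m\times N}$ be a Gaussian matrix and $b=Ax_0$. If $$m\ge\inf_{\tau\ge0}\Big\{\hat k(1+\tau^2)+k_{-L_1}\int_{-\tau}^{\infty}(u+\tau)^2\phi(u)\,du+k_{L_2}\int_{-\infty}^\tau(u-\tau)^2\phi(u)\,du+2k_0\int_\tau^\infty(u-\tau)^2\phi(u)\,du\Big\}+\sqrt{8\log(4/\varepsilon)N},$$ with $\phi(u)=(2\pi)^{-1/2}e^{-u^2/2}$, then with probability larger than $1-\varepsilon$, $x_0$ is the unique solution of $\min\|x\|_1$ subject to $Ax=b$ and $x\in[-L_1,L_2]^N$.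
   Context: $\mathbb{1}_S$ has entries $1$ on $S$, $0$ elsewhere. A Gaussian matrix is $A=m^{-1/2}[a_{ij}]$ with $a_{ij}$ i.i.d. standard normal. $\log$ is the natural logarithm. *)

theory Defs
  imports "HOL-Probability.Probability"
begin

definition phi :: "real \<Rightarrow> real" where
  "phi u = std_normal_density u"

definition gaussian_entries :: "nat \<Rightarrow> nat \<Rightarrow> ((nat \<times> nat) \<Rightarrow> real) measure" where
  "gaussian_entries m N =
     PiM ({1..m} \<times> {1..N}) (\<lambda>_. density lborel std_normal_density)"

definition gauss_matrix :: "nat \<Rightarrow> ((nat \<times> nat) \<Rightarrow> real) \<Rightarrow> nat \<Rightarrow> nat \<Rightarrow> real" where
  "gauss_matrix m a i j = a (i, j) / sqrt (real m)"

definition l1norm :: "nat \<Rightarrow> (nat \<Rightarrow> real) \<Rightarrow> real" where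
  "l1norm N x = (\<Sum>j\<in>{1..N}. \<bar>x j\<bar>)"

definition feasible ::
  "nat \<Rightarrow> nat \<Rightarrow> (nat \<Rightarrow> nat \<Rightarrow> real) \<Rightarrow> (nat \<Rightarrow> real) \<Rightarrow> real \<Rightarrow> real \<Rightarrow> (nat \<Rightarrow> real) \<Rightarrow> bool" where
  "feasible m N A b lo hi x \<longleftrightarrow>
     (\<forall>j\<in>{1..N}. lo \<le> x j \<and> x j \<le> hi) \<and>
     (\<forall>i\<in>{1..m}. (\<Sum>j\<in>{1..N}. A i j * x j) = b i)"

definition unique_box_l1_solution ::
  "nat \<Rightarrow> nat \<Rightarrow> (nat \<Rightarrow> nat \<Rightarrow> real) \<Rightarrow> (nat \<Rightarrow> real) \<Rightarrow> real \<Rightarrow> real \<Rightarrow> (nat \<Rightarrow> real) \<Rightarrow> bool" where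
  "unique_box_l1_solution m N A b lo hi x0 \<longleftrightarrow>
     feasible m N A b lo hi x0 \<and>
     (\<forall>x. feasible m N A b lo hi x \<and> (\<exists>j\<in>{1..N}. x j \<noteq> x0 j) \<longrightarrow> l1norm N x0 < l1norm N x)"

end

(*
  A vector x0 fails to be the unique solution iff the kernel of A meets the compact set U of unit
  vectors h of the descent cone (h >= 0 where x0 = -L1, h <= 0 where x0 = L2, and the l1 norm does
  not increase along h).  For every tau >= 0 the support function of U is bounded by
  <g, h> <= sqrt (sum_j zeta_j (g_j)), where zeta_j is a squared distance to an interval and the sum of
  the expectations of the zeta_j is the quantity minimised over tau in the statement.

  Gordon's Gaussian comparison, applied to exp (-l min_h (|Gh| + gamma)), gives
    exp (l^2/2) P(fail) <= E exp (-l |g|) * E exp (l sqrt (sum_j zeta_j (g'_j)))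
  for l > 0.  Here E exp (-l |g|) <= exp (-l sqrt (m-1) + l^2/4) by Stein's identity, and the second
  factor is at most exp (l sqrt M + l^2/2) with M = sum_j E zeta_j, by a one-dimensional exponential
  moment bound for truncated squares.  Hence P(fail) <= exp (-l (sqrt (m-1) - sqrt M) + l^2/4), and
  optimising l settles the case m < N.  For m >= N the kernel is trivial almost surely.
*)
theory Submission
  imports Defs "Jordan_Normal_Form.Determinant"
begin

section \<open>Stein's identity and Gaussian interpolation\<close>

text \<open>Comparison and concentration are obtained from one exponential inequality. The scalar
  \<open>gamma\<close> makes the covariances of the two Gaussian fields agree at coinciding unit
  vectors, so second derivatives at a single point never need a sign; its factor
  \<open>exp (l^2/2)\<close> then cancels the \<open>l^2/2\<close> paid for the decoupled supremum,
  and only the \<open>l^2/4\<close> of the norm remains.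

  Gordon's argument needs finitely many points and smooth functions, whereas \<open>U\<close> is
  infinite and the norm has a kink at the origin. A soft minimum with parameter \<alpha> over a net
  \<open>T\<close> costs only the factor \<open>card T powr (l / \<alpha>)\<close>, which tends to 1
  for a fixed net, so no covering number enters the bound.

  With \<open>t = sqrt (m-1) - sqrt M\<close>, the choice \<open>l = 2 * t\<close> gives
  \<open>exp (- t^2)\<close>. Multiplying \<open>t\<close> by the sum of the two roots leaves
  \<open>m - 1 - M\<close>, and each root is at most \<open>sqrt N\<close> if \<open>m < N\<close>.
  If \<open>T\<close> is the square root in the hypothesis,
  \<open>T^2 / (4 * N) = 2 * ln (4/\<epsilon>)\<close>, which explains the constant 8. The slack in
  \<open>4/\<epsilon>\<close> pays for \<open>m - 1\<close> in place of \<open>m\<close> and for an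
  infimum that need not be attained.\<close>

definition std_gauss :: "real measure" where
  "std_gauss = density lborel std_normal_density"

lemma space_std_gauss [simp]: "space std_gauss = UNIV"
  and sets_std_gauss [simp, measurable_cong]: "sets std_gauss = sets borel"
  by (auto simp: std_gauss_def)

lemma prob_space_std_gauss: "prob_space std_gauss"
  unfolding std_gauss_def by (rule prob_space_normal_density) simp

interpretation std_gauss: prob_space std_gauss by (rule prob_space_std_gauss)

lemma measure_std_gauss_UNIV [simp]: "measure std_gauss UNIV = 1"
  using std_gauss.prob_space by simp

lemma measurable_std_gauss [simp]: "borel_measurable std_gauss = borel_measurable borel"
  by (rule measurable_cong_sets) auto

lemma integrable_std_gauss_iff:
  fixes f :: "real \<Rightarrow> real"
  assumes "f \<in> borel_measurable borel"
  shows "integrable std_gauss f \<longleftrightarrow> integrable lborel (\<lambda>x. std_normal_density x * f x)"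
  unfolding std_gauss_def using assms by (subst integrable_density) auto

lemma integral_std_gauss:
  fixes f :: "real \<Rightarrow> real"
  assumes "f \<in> borel_measurable borel"
  shows "integral\<^sup>L std_gauss f = (LINT x|lborel. std_normal_density x * f x)"
  unfolding std_gauss_def using assms by (subst integral_density) auto

text \<open>Against the standard density the integrand is a multiple of another centred normal
  density, of variance \<open>1 / (1 - 2 * s)\<close>.\<close>

lemma integrable_std_gauss_exp_square:
  fixes s :: real
  assumes "s < 1/2"
  shows "integrable std_gauss (\<lambda>x. exp (s * x\<^sup>2))"
proof -
  define d where "d = 1 / sqrt (1 - 2 * s)"
  have d: "d > 0" "d\<^sup>2 = 1 / (1 - 2 * s)"
    using assms by (auto simp: d_def power_divide)
  have "std_normal_density x * exp (s * x\<^sup>2) = d * normal_density 0 d x" for x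
  proof -
    have e: "s * x\<^sup>2 - x\<^sup>2 / 2 = - x\<^sup>2 / (2 * d\<^sup>2)"
      unfolding d(2) using assms by (simp add: algebra_simps add_divide_distrib diff_divide_distrib)
    have "std_normal_density x * exp (s * x\<^sup>2) = 1 / sqrt (2 * pi) * exp (- x\<^sup>2 / (2 * d\<^sup>2))"
      by (simp add: std_normal_density_def mult_exp_exp e del: minus_divide_left)
    also have "\<dots> = d * normal_density 0 d x"
    proof -
      have "sqrt (2 * pi * d\<^sup>2) = sqrt (2 * pi) * d" using d(1) by (simp add: real_sqrt_mult)
      then show ?thesis using d(1) by (simp add: normal_density_def)
    qed
    finally show ?thesis .
  qed
  then show ?thesis
    using d by (subst integrable_std_gauss_iff) auto
qed

text \<open>A linear factor is absorbed by an arbitrarily small increase of the Gaussian exponent,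
  so growth of order \<open>exp (s * x\<^sup>2)\<close> with some \<open>s < 1/2\<close> is
  preserved under multiplication by \<open>x\<close>.\<close>

lemma abs_le_exp_square:
  fixes x e :: real
  assumes "e > 0"
  shows "\<bar>x\<bar> \<le> (1 + 1 / e) * exp (e * x\<^sup>2)"
proof -
  have "0 \<le> (1 - \<bar>x\<bar>)\<^sup>2" by simp
  then have "2 * \<bar>x\<bar> \<le> 1 + x\<^sup>2" by (simp add: power2_eq_square algebra_simps)
  then have "\<bar>x\<bar> \<le> 1 + x\<^sup>2" by linarith
  also have "\<dots> = 1 + (e * x\<^sup>2) / e" using assms by simp
  also have "\<dots> \<le> exp (e * x\<^sup>2) + exp (e * x\<^sup>2) / e"
  proof -
    have "e * x\<^sup>2 \<ge> 0" using assms by simp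
    then have "e * x\<^sup>2 \<le> exp (e * x\<^sup>2)" "1 \<le> exp (e * x\<^sup>2)"
      using exp_ge_add_one_self[of "e * x\<^sup>2"] by linarith+
    then show ?thesis using assms by (intro add_mono divide_right_mono) auto
  qed
  finally show ?thesis by (simp add: algebra_simps)
qed

lemma integrable_std_gauss_bound:
  fixes f :: "real \<Rightarrow> real"
  assumes "f \<in> borel_measurable borel" "\<And>x. \<bar>f x\<bar> \<le> C * exp (s * x\<^sup>2)" "s < 1/2"
  shows "integrable std_gauss f"
proof (rule Bochner_Integration.integrable_bound)
  show "integrable std_gauss (\<lambda>x. C * exp (s * x\<^sup>2))"
    using integrable_std_gauss_exp_square[OF assms(3)] by simp
  show "AE x in std_gauss. norm (f x) \<le> norm (C * exp (s * x\<^sup>2))"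
    using assms(2) by (intro AE_I2) (metis abs_ge_self order_trans real_norm_def)
qed (use assms in simp)

lemma integrable_std_gauss_times:
  fixes f :: "real \<Rightarrow> real"
  assumes "f \<in> borel_measurable borel" "\<And>x. \<bar>f x\<bar> \<le> C * exp (s * x\<^sup>2)" "s < 1/2"
  shows "integrable std_gauss (\<lambda>x. x * f x)"
proof -
  define e where "e = (1/2 - s) / 2"
  have e: "e > 0" "s + e < 1/2" using assms(3) by (auto simp: e_def field_simps)
  show ?thesis
  proof (rule integrable_std_gauss_bound)
    fix x
    have "\<bar>x * f x\<bar> \<le> ((1 + 1 / e) * exp (e * x\<^sup>2)) * (C * exp (s * x\<^sup>2))"
      unfolding abs_mult by (intro mult_mono abs_le_exp_square assms) (use e in auto)
    also have "\<dots> = ((1 + 1 / e) * C) * exp ((s + e) * x\<^sup>2)"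
      by (simp add: algebra_simps exp_add)
    finally show "\<bar>x * f x\<bar> \<le> ((1 + 1 / e) * C) * exp ((s + e) * x\<^sup>2)" .
  qed (use assms e in auto)
qed

lemma DERIV_std_normal_density:
  "(std_normal_density has_real_derivative - x * std_normal_density x) (at x)"
  unfolding std_normal_density_def
  by (rule derivative_eq_intros refl | simp)+

text \<open>Integration by parts: the density has derivative
  \<open>- x * std_normal_density x\<close>, and \<open>s < 1/2\<close> makes the boundary terms
  vanish. The quadratic-exponential growth is allowed because the identity is later applied to
  \<open>exp (q * (excess t u)\<^sup>2)\<close> with any \<open>q < 1/2\<close>.\<close>

theorem stein_identity:
  fixes F f :: "real \<Rightarrow> real"
  assumes F: "\<And>x. (F has_real_derivative f x) (at x)"
    and cont: "\<And>x. isCont f x"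
    and F_bound: "\<And>x. \<bar>F x\<bar> \<le> C * exp (s * x\<^sup>2)"
    and f_bound: "\<And>x. \<bar>f x\<bar> \<le> C * exp (s * x\<^sup>2)"
    and s: "s < 1/2"
  shows "(\<integral>x. x * F x \<partial>std_gauss) = (\<integral>x. f x \<partial>std_gauss)"
proof -
  have contF: "isCont F x" for x using F DERIV_isCont by blast
  have [measurable]: "F \<in> borel_measurable borel" "f \<in> borel_measurable borel"
    using contF cont by (auto intro!: borel_measurable_continuous_onI continuous_at_imp_continuous_on)
  have i1: "integrable std_gauss (\<lambda>x. x * F x)"
    by (rule integrable_std_gauss_times[OF _ F_bound s]) measurable
  have i2: "integrable std_gauss f"
    by (rule integrable_std_gauss_bound[OF _ f_bound s]) measurable
  let ?p = std_normal_density
  define g where "g x = ?p x * f x - ?p x * (x * F x)" for x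
  have j: "integrable lborel (\<lambda>x. ?p x * f x)" "integrable lborel (\<lambda>x. ?p x * (x * F x))"
    using i1 i2 by (auto simp: integrable_std_gauss_iff)
  have g: "integrable lborel g" unfolding g_def using j by (rule Bochner_Integration.integrable_diff)
  have der: "((\<lambda>x. ?p x * F x) has_real_derivative g x) (at x)" for x
    unfolding g_def by (rule derivative_eq_intros DERIV_std_normal_density F refl)+ (simp add: algebra_simps)
  have small: "((\<lambda>x. ?p x * F x) \<longlongrightarrow> 0) at_infinity"
  proof (rule Lim_null_comparison)
    have "norm (?p x * F x) \<le> C * exp ((s - 1/2) * x\<^sup>2)" for x
    proof -
      have C: "C \<ge> 0" using F_bound[of 0] by simp
      have "norm (?p x * F x) \<le> ?p x * (C * exp (s * x\<^sup>2))"
        using F_bound[of x] by (simp add: abs_mult mult_left_mono)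
      also have "\<dots> = (1 / sqrt (2 * pi)) * (C * (exp (- x\<^sup>2 / 2) * exp (s * x\<^sup>2)))"
        by (simp add: std_normal_density_def)
      also have "exp (- x\<^sup>2 / 2) * exp (s * x\<^sup>2) = exp ((s - 1/2) * x\<^sup>2)"
        by (simp add: mult_exp_exp algebra_simps)
      also have "(1 / sqrt (2 * pi)) * (C * exp ((s - 1/2) * x\<^sup>2)) \<le> 1 * (C * exp ((s - 1/2) * x\<^sup>2))"
      proof (rule mult_right_mono)
        have "1 \<le> sqrt (2 * pi)" using pi_gt3 by simp
        then show "1 / sqrt (2 * pi) \<le> 1" by simp
      qed (use C in auto)
      finally show ?thesis by simp
    qed
    then show "eventually (\<lambda>x. norm (?p x * F x) \<le> C * exp ((s - 1/2) * x\<^sup>2)) at_infinity" by simp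
    have "filterlim (\<lambda>x::real. norm x ^ 2) at_top at_infinity"
      by (rule filterlim_pow_at_top[OF _ filterlim_norm_at_top]) simp
    then have "filterlim (\<lambda>x. x\<^sup>2) at_top (at_infinity :: real filter)" by simp
    then have "filterlim (\<lambda>x. (s - 1/2) * x\<^sup>2) at_bot (at_infinity :: real filter)"
      using s by (subst filterlim_tendsto_neg_mult_at_bot_iff[of _ "s - 1/2"]) auto
    then have "((\<lambda>x. exp ((s - 1/2) * x\<^sup>2)) \<longlongrightarrow> 0) (at_infinity :: real filter)"
      by (rule filterlim_compose[OF exp_at_bot])
    then show "((\<lambda>x. C * exp ((s - 1/2) * x\<^sup>2)) \<longlongrightarrow> 0) (at_infinity :: real filter)"
      by (rule tendsto_mult_right_zero)
  qed
  have lim: "((\<lambda>x. ?p x * F x) \<longlongrightarrow> 0) at_top" "((\<lambda>x. ?p x * F x) \<longlongrightarrow> 0) at_bot"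
    using small by (auto intro: tendsto_mono[OF at_top_le_at_infinity] tendsto_mono[OF at_bot_le_at_infinity])
  have "(LBINT x=-\<infinity>..\<infinity>. g x) = 0 - 0"
  proof (rule interval_integral_FTC_integrable[where F = "\<lambda>x. ?p x * F x"])
    show "((\<lambda>x. ?p x * F x) has_vector_derivative g x) (at x)" for x
      using der by (simp add: has_real_derivative_iff_has_vector_derivative)
    show "isCont g x" for x
      unfolding g_def by (intro continuous_intros cont contF DERIV_isCont[OF DERIV_std_normal_density])
    show "set_integrable lborel (einterval (-\<infinity>) \<infinity>) g"
      using g by (simp add: set_integrable_def)
    show "(((\<lambda>x. ?p x * F x) \<circ> real_of_ereal) \<longlongrightarrow> 0) (at_right (- \<infinity>))"
      using lim by (simp add: ereal_tendsto_simps)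
    show "(((\<lambda>x. ?p x * F x) \<circ> real_of_ereal) \<longlongrightarrow> 0) (at_left \<infinity>)"
      using lim by (simp add: ereal_tendsto_simps)
  qed simp
  then have "integral\<^sup>L lborel g = 0"
    by (simp add: interval_lebesgue_integral_def set_lebesgue_integral_def)
  then have "(LINT x|lborel. ?p x * f x) = (LINT x|lborel. ?p x * (x * F x))"
    unfolding g_def using j by simp
  then show ?thesis by (simp add: integral_std_gauss)
qed

text \<open>Dominated convergence for the difference quotients along sequences tending to 0; the
  mean value inequality on the ball turns the bound \<open>w\<close> on the derivative into a bound
  on the quotients.\<close>

lemma has_real_derivative_integral:
  fixes f f' :: "real \<Rightarrow> 'a \<Rightarrow> real"
  assumes meas: "\<And>t. t \<in> ball t0 r \<Longrightarrow> integrable M (f t)"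
    and meas': "f' t0 \<in> borel_measurable M"
    and der: "\<And>t x. t \<in> ball t0 r \<Longrightarrow> x \<in> space M \<Longrightarrow> ((\<lambda>t. f t x) has_real_derivative f' t x) (at t)"
    and bound: "\<And>t x. t \<in> ball t0 r \<Longrightarrow> x \<in> space M \<Longrightarrow> \<bar>f' t x\<bar> \<le> w x"
    and w: "integrable M w" and r: "r > 0"
  shows "((\<lambda>t. \<integral>x. f t x \<partial>M) has_real_derivative (\<integral>x. f' t0 x \<partial>M)) (at t0)"
proof -
  have "((\<lambda>h. ((\<integral>x. f (t0 + h) x \<partial>M) - (\<integral>x. f t0 x \<partial>M)) / h) \<longlongrightarrow> (\<integral>x. f' t0 x \<partial>M)) (at 0)"
    unfolding tendsto_at_iff_sequentially
  proof (intro allI impI)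
    fix X :: "nat \<Rightarrow> real" assume X0: "\<forall>i. X i \<in> UNIV - {0}" and X: "X \<longlonglongrightarrow> 0"
    have "eventually (\<lambda>i. dist (X i) 0 < r) sequentially" using X r by (rule tendstoD)
    then obtain n0 where n0: "\<And>i. i \<ge> n0 \<Longrightarrow> \<bar>X i\<bar> < r" by (auto simp: eventually_sequentially)
    \<comment> \<open>Only a tail of \<open>X\<close> keeps \<open>t0 + X i\<close> inside the ball
      where the bound holds; the shift is undone by \<open>LIMSEQ_offset\<close>.\<close>
    define Y where "Y i = X (i + n0)" for i
    have Y: "\<And>i. Y i \<noteq> 0" "\<And>i. \<bar>Y i\<bar> < r" "Y \<longlonglongrightarrow> 0"
      using X0 n0 X unfolding Y_def by (auto intro: LIMSEQ_ignore_initial_segment)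
    have ball: "t0 + Y i \<in> ball t0 r" for i using Y(2)[of i] by (simp add: dist_real_def)
    have t0: "t0 \<in> ball t0 r" using r by simp
    have "(\<lambda>i. \<integral>x. (f (t0 + Y i) x - f t0 x) / Y i \<partial>M) \<longlonglongrightarrow> (\<integral>x. f' t0 x \<partial>M)"
    proof (rule integral_dominated_convergence)
      show "f' t0 \<in> borel_measurable M" by fact
      show "(\<lambda>x. (f (t0 + Y i) x - f t0 x) / Y i) \<in> borel_measurable M" for i
        using meas[OF ball, of i] meas[OF t0] by measurable
      show "integrable M w" by fact
      show "AE x in M. (\<lambda>i. (f (t0 + Y i) x - f t0 x) / Y i) \<longlonglongrightarrow> f' t0 x"
      proof (rule AE_I2)
        fix x assume "x \<in> space M"
        then have "((\<lambda>h. (f (t0 + h) x - f t0 x) / h) \<longlongrightarrow> f' t0 x) (at 0)"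
          using der[OF t0] by (simp add: DERIV_def)
        then show "(\<lambda>i. (f (t0 + Y i) x - f t0 x) / Y i) \<longlonglongrightarrow> f' t0 x"
          unfolding tendsto_at_iff_sequentially using Y by (auto simp: o_def)
      qed
      show "AE x in M. norm ((f (t0 + Y i) x - f t0 x) / Y i) \<le> w x" for i
      proof (rule AE_I2)
        fix x assume x: "x \<in> space M"
        have "norm (f (t0 + Y i) x - f t0 x) \<le> w x * norm ((t0 + Y i) - t0)"
        proof (rule field_differentiable_bound)
          show "convex (ball t0 r)" by simp
          show "((\<lambda>t. f t x) has_field_derivative f' t x) (at t within ball t0 r)" if "t \<in> ball t0 r" for t
            using der[OF that x] by (rule has_field_derivative_at_within)
          show "norm (f' t x) \<le> w x" if "t \<in> ball t0 r" for t using bound[OF that x] by simp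
        qed (use ball t0 in auto)
        then show "norm ((f (t0 + Y i) x - f t0 x) / Y i) \<le> w x"
          using Y(1)[of i] by (simp add: divide_le_eq)
      qed
    qed
    also have "(\<lambda>i. \<integral>x. (f (t0 + Y i) x - f t0 x) / Y i \<partial>M)
        = (\<lambda>i. ((\<integral>x. f (t0 + Y i) x \<partial>M) - (\<integral>x. f t0 x \<partial>M)) / Y i)"
      using meas[OF ball] meas[OF t0] by simp
    finally have "(\<lambda>i. ((\<integral>x. f (t0 + X (i + n0)) x \<partial>M) - (\<integral>x. f t0 x \<partial>M)) / X (i + n0)) \<longlonglongrightarrow> (\<integral>x. f' t0 x \<partial>M)"
      unfolding Y_def .
    then show "((\<lambda>h. ((\<integral>x. f (t0 + h) x \<partial>M) - (\<integral>x. f t0 x \<partial>M)) / h) \<circ> X) \<longlonglongrightarrow> (\<integral>x. f' t0 x \<partial>M)"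
      unfolding o_def by (rule LIMSEQ_offset[where k = n0])
  qed
  then show ?thesis unfolding DERIV_def .
qed

section \<open>Finite products of standard Gaussian measures\<close>

interpretation std_gauss_prod: product_prob_space "\<lambda>_. std_gauss" UNIV
  by unfold_locales

abbreviation gauss :: "'i set \<Rightarrow> ('i \<Rightarrow> real) measure" where
  "gauss I \<equiv> PiM I (\<lambda>_. std_gauss)"

lemma prob_space_gauss: "prob_space (gauss I)"
  by (rule prob_space_PiM) (rule prob_space_std_gauss)

lemma exp_abs_le_exp_square: "exp (c * \<bar>x\<bar>) \<le> exp (c\<^sup>2) * exp (1/4 * x\<^sup>2)" for x c :: real
proof -
  have "0 \<le> (c - \<bar>x\<bar> / 2)\<^sup>2" by simp
  then have "c * \<bar>x\<bar> \<le> c\<^sup>2 + 1/4 * x\<^sup>2" by (simp add: power2_eq_square algebra_simps)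
  then show ?thesis by (simp add: mult_exp_exp)
qed

lemma integrable_std_gauss_exp_abs: "integrable std_gauss (\<lambda>x. exp (c * \<bar>x\<bar>))"
  by (rule integrable_std_gauss_bound[where C = "exp (c\<^sup>2)" and s = "1/4"]) (use exp_abs_le_exp_square in auto)

text \<open>Growth is measured in the l1 norm of the array because
  \<open>exp (c * (\<Sum>i\<in>I. \<bar>a i\<bar>))\<close> factorises over the independent
  coordinates.\<close>

lemma integrable_gauss_bound:
  fixes f :: "('i \<Rightarrow> real) \<Rightarrow> real"
  assumes "finite I" "f \<in> borel_measurable (gauss I)"
    and "\<And>a. \<bar>f a\<bar> \<le> C * exp (c * (\<Sum>i\<in>I. \<bar>a i\<bar>))"
  shows "integrable (gauss I) f"
proof (rule Bochner_Integration.integrable_bound)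
  have "integrable (gauss I) (\<lambda>a. \<Prod>i\<in>I. exp (c * \<bar>a i\<bar>))"
    by (rule std_gauss_prod.product_integrable_prod) (use assms integrable_std_gauss_exp_abs in auto)
  then show "integrable (gauss I) (\<lambda>a. C * exp (c * (\<Sum>i\<in>I. \<bar>a i\<bar>)))"
    using assms(1) by (simp add: exp_sum sum_distrib_left)
  show "AE a in gauss I. norm (f a) \<le> norm (C * exp (c * (\<Sum>i\<in>I. \<bar>a i\<bar>)))"
    using assms(3) by (intro AE_I2) (metis abs_ge_self order_trans real_norm_def)
qed fact

text \<open>A factor that is at most linear in the array only raises the growth rate from
  \<open>c\<close> to \<open>c + 1\<close>.\<close>

lemma abs_mult_exp_le:
  fixes y :: real
  assumes "\<bar>y\<bar> \<le> C * exp (c * A)" "\<bar>x\<bar> \<le> A"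
  shows "\<bar>x * y\<bar> \<le> C * exp ((c + 1) * A)"
proof -
  have "\<bar>x\<bar> \<le> exp A" using assms(2) exp_ge_add_one_self[of A] by linarith
  then have "\<bar>x * y\<bar> \<le> exp A * (C * exp (c * A))"
    unfolding abs_mult using assms(1) by (intro mult_mono) auto
  then show ?thesis by (simp add: algebra_simps exp_add)
qed

text \<open>Fubini singles out the coordinate \<open>e\<close>; for fixed values of the others the
  one-dimensional identity applies.\<close>

lemma gauss_stein_identity:
  fixes F f :: "('i \<Rightarrow> real) \<Rightarrow> real"
  assumes I: "finite I" "e \<in> I"
    and [measurable]: "F \<in> borel_measurable (gauss I)" "f \<in> borel_measurable (gauss I)"
    and der: "\<And>a x. ((\<lambda>x. F (a(e := x))) has_real_derivative f (a(e := x))) (at x)"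
    and cont: "\<And>a x. isCont (\<lambda>x. f (a(e := x))) x"
    and F_bound: "\<And>a. \<bar>F a\<bar> \<le> C * exp (c * (\<Sum>i\<in>I. \<bar>a i\<bar>))"
    and f_bound: "\<And>a. \<bar>f a\<bar> \<le> C * exp (c * (\<Sum>i\<in>I. \<bar>a i\<bar>))"
  shows "(\<integral>a. a e * F a \<partial>gauss I) = (\<integral>a. f a \<partial>gauss I)"
proof -
  let ?J = "I - {e}"
  have J: "finite ?J" "e \<notin> ?J" and IJ: "insert e ?J = I" using I by auto
  have int1: "integrable (gauss I) (\<lambda>a. a e * F a)"
  proof (rule integrable_gauss_bound[OF I(1)])
    show "\<bar>a e * F a\<bar> \<le> C * exp ((c + 1) * (\<Sum>i\<in>I. \<bar>a i\<bar>))" for a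
      by (rule abs_mult_exp_le[OF F_bound]) (use I in \<open>auto intro: member_le_sum\<close>)
  qed (use I in measurable)
  have int2: "integrable (gauss I) f"
    by (rule integrable_gauss_bound[OF I(1) _ f_bound]) measurable
  have slice: "(\<integral>y. y * F (a(e := y)) \<partial>std_gauss) = (\<integral>y. f (a(e := y)) \<partial>std_gauss)" for a
  proof -
    let ?S = "\<Sum>i\<in>?J. \<bar>a i\<bar>"
    have C: "C \<ge> 0" using F_bound[of "\<lambda>_. 0"] by simp
    \<comment> \<open>On a slice, \<open>c * \<bar>y\<bar> \<le> c\<^sup>2 + y\<^sup>2 / 4\<close>
      converts exponential growth in \<open>\<bar>y\<bar>\<close> into the quadratic growth required
      by \<open>stein_identity\<close>, with exponent \<open>1/4 < 1/2\<close>.\<close>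
    have "C * exp (c * (\<Sum>i\<in>I. \<bar>(a(e := y)) i\<bar>)) \<le> (C * exp (c * ?S + c\<^sup>2)) * exp (1/4 * y\<^sup>2)" for y
    proof -
      have "(\<Sum>i\<in>I. \<bar>(a(e := y)) i\<bar>) = \<bar>y\<bar> + ?S"
        using I by (simp add: sum.remove[OF I])
      then have "C * exp (c * (\<Sum>i\<in>I. \<bar>(a(e := y)) i\<bar>)) = C * (exp (c * ?S) * exp (c * \<bar>y\<bar>))"
        by (simp add: algebra_simps exp_add)
      also have "\<dots> \<le> C * (exp (c * ?S) * (exp (c\<^sup>2) * exp (1/4 * y\<^sup>2)))"
        by (intro mult_left_mono exp_abs_le_exp_square C) auto
      finally show ?thesis by (simp add: exp_add mult.assoc)
    qed
    note b = order_trans[OF _ this]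
    show ?thesis
      by (rule stein_identity[OF der cont b[OF F_bound] b[OF f_bound]]) simp
  qed
  have "(\<integral>a. a e * F a \<partial>gauss I) = (\<integral>a. (\<integral>y. (a(e := y)) e * F (a(e := y)) \<partial>std_gauss) \<partial>gauss ?J)"
    using std_gauss_prod.product_integral_insert[OF J, of "\<lambda>a. a e * F a"] int1 unfolding IJ by blast
  also have "\<dots> = (\<integral>a. (\<integral>y. f (a(e := y)) \<partial>std_gauss) \<partial>gauss ?J)"
    using slice by simp
  also have "\<dots> = (\<integral>a. f a \<partial>gauss I)"
    using std_gauss_prod.product_integral_insert[OF J, of f] int2 unfolding IJ by simp
  finally show ?thesis .
qed

text \<open>Differentiating in the parameter and applying Stein's identity to every coordinate turns the
  derivative of the expectation into the expectation of the left-hand side of assumption \<open>sign\<close>.\<close>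

theorem gaussian_interpolation:
  fixes B B' :: "real \<Rightarrow> 'k \<Rightarrow> 'i \<Rightarrow> real" and F :: "('k \<Rightarrow> real) \<Rightarrow> real"
  assumes I: "finite I" and K: "finite K" and b: "0 \<le> b" and beta: "0 \<le> \<beta>" and c: "0 \<le> c"
    and B: "\<And>t k e. ((\<lambda>t. B t k e) has_real_derivative B' t k e) (at t)"
    and B_bound: "\<And>t k e. k \<in> K \<Longrightarrow> e \<in> I \<Longrightarrow> \<bar>B t k e\<bar> \<le> \<beta>" "\<And>t k e. k \<in> K \<Longrightarrow> e \<in> I \<Longrightarrow> \<bar>B' t k e\<bar> \<le> \<beta>"
    and F: "\<And>z z' t. (\<And>k. k \<in> K \<Longrightarrow> ((\<lambda>t. z t k) has_real_derivative z' k) (at t)) \<Longrightarrow>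
      ((\<lambda>t. F (z t)) has_real_derivative (\<Sum>k\<in>K. F1 k (z t) * z' k)) (at t)"
    and F1: "\<And>z z' t l. l \<in> K \<Longrightarrow> (\<And>k. k \<in> K \<Longrightarrow> ((\<lambda>t. z t k) has_real_derivative z' k) (at t)) \<Longrightarrow>
      ((\<lambda>t. F1 l (z t)) has_real_derivative (\<Sum>k\<in>K. F2 l k (z t) * z' k)) (at t)"
    and F2: "\<And>z t k l. k \<in> K \<Longrightarrow> l \<in> K \<Longrightarrow> (\<And>k. k \<in> K \<Longrightarrow> isCont (\<lambda>t::real. z t k) t) \<Longrightarrow>
      isCont (\<lambda>t. F2 k l (z t)) t"
    and meas: "\<And>z. (\<And>k. k \<in> K \<Longrightarrow> (\<lambda>a. z a k) \<in> borel_measurable (gauss I)) \<Longrightarrow> (\<lambda>a. F (z a)) \<in> borel_measurable (gauss I)"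
      "\<And>z l. l \<in> K \<Longrightarrow> (\<And>k. k \<in> K \<Longrightarrow> (\<lambda>a. z a k) \<in> borel_measurable (gauss I)) \<Longrightarrow> (\<lambda>a. F1 l (z a)) \<in> borel_measurable (gauss I)"
      "\<And>z l k. l \<in> K \<Longrightarrow> k \<in> K \<Longrightarrow> (\<And>k. k \<in> K \<Longrightarrow> (\<lambda>a. z a k) \<in> borel_measurable (gauss I)) \<Longrightarrow> (\<lambda>a. F2 l k (z a)) \<in> borel_measurable (gauss I)"
    and bound: "\<And>z. \<bar>F z\<bar> \<le> C * exp (c * (\<Sum>k\<in>K. \<bar>z k\<bar>))"
      "\<And>z k. k \<in> K \<Longrightarrow> \<bar>F1 k z\<bar> \<le> C * exp (c * (\<Sum>k\<in>K. \<bar>z k\<bar>))"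
      "\<And>z k l. k \<in> K \<Longrightarrow> l \<in> K \<Longrightarrow> \<bar>F2 k l z\<bar> \<le> C * exp (c * (\<Sum>k\<in>K. \<bar>z k\<bar>))"
    and sign: "\<And>t z. 0 \<le> t \<Longrightarrow> t \<le> b \<Longrightarrow> (\<Sum>k\<in>K. \<Sum>l\<in>K. (\<Sum>e\<in>I. B' t k e * B t l e) * F2 k l z) \<le> 0"
  shows "(\<integral>a. F (\<lambda>k. \<Sum>e\<in>I. B b k e * a e) \<partial>gauss I) \<le> (\<integral>a. F (\<lambda>k. \<Sum>e\<in>I. B 0 k e * a e) \<partial>gauss I)"
proof -
  define Z where "Z t a k = (\<Sum>e\<in>I. B t k e * a e)" for t a k
  define Z' where "Z' t a k = (\<Sum>e\<in>I. B' t k e * a e)" for t a k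
  define A where "A a = (\<Sum>e\<in>I. \<bar>a e\<bar>)" for a :: "'i \<Rightarrow> real"
  \<comment> \<open>Growth rate in the array of a function with rate \<open>c\<close> in the field:
    each of the \<open>card K\<close> coordinates of the field is at most
    \<open>\<beta> * A a\<close>.\<close>
  define c1 where "c1 = c * (real (card K) * \<beta>)"
  have C: "C \<ge> 0" using bound(1)[of "\<lambda>_. 0"] by simp
  have A0: "A a \<ge> 0" for a by (simp add: A_def sum_nonneg)
  have A_comp: "\<bar>a e\<bar> \<le> A a" if "e \<in> I" for a e
    using that I unfolding A_def by (intro member_le_sum) auto
  have Z_bound: "\<bar>Z t a k\<bar> \<le> \<beta> * A a" "\<bar>Z' t a k\<bar> \<le> \<beta> * A a" if "k \<in> K" for t a k
    unfolding Z_def Z'_def A_def sum_distrib_left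
    by (auto intro!: order_trans[OF sum_abs] sum_mono mult_right_mono B_bound that simp: abs_mult)
  have grow: "C * exp (c * (\<Sum>k\<in>K. \<bar>Z t a k\<bar>)) \<le> C * exp (c1 * A a)" for t a
  proof -
    have "(\<Sum>k\<in>K. \<bar>Z t a k\<bar>) \<le> real (card K) * (\<beta> * A a)"
      by (rule sum_bounded_above) (rule Z_bound)
    then have "c * (\<Sum>k\<in>K. \<bar>Z t a k\<bar>) \<le> c1 * A a"
      unfolding c1_def using c by (simp add: mult_left_mono mult.assoc)
    then show ?thesis using C by (simp add: mult_left_mono)
  qed
  have Z_meas [measurable]: "(\<lambda>a. Z t a k) \<in> borel_measurable (gauss I)"
    "(\<lambda>a. Z' t a k) \<in> borel_measurable (gauss I)" for t k
    unfolding Z_def Z'_def by (auto intro!: borel_measurable_sum)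
  note Fm [measurable] = meas(1)[of "\<lambda>a. Z t a" for t, OF Z_meas(1)]
  have F1m [measurable]: "(\<lambda>a. F1 l (Z t a)) \<in> borel_measurable (gauss I)" if "l \<in> K" for l t
    using meas(2)[OF that, of "\<lambda>a. Z t a"] by simp
  have F2m [measurable]: "(\<lambda>a. F2 l k (Z t a)) \<in> borel_measurable (gauss I)" if "l \<in> K" "k \<in> K" for l k t
    using meas(3)[OF that, of "\<lambda>a. Z t a"] by simp
  have F_int: "integrable (gauss I) (\<lambda>a. F (Z t a))" for t
    by (rule integrable_gauss_bound[OF I Fm, where C = C and c = c1])
       (use order_trans[OF bound(1) grow] in \<open>auto simp: A_def\<close>)
  have F1_int: "integrable (gauss I) (\<lambda>a. a e * F1 k (Z t a))" if "e \<in> I" "k \<in> K" for e k t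
  proof (rule integrable_gauss_bound[OF I, where C = C and c = "c1 + 1"])
    show "\<bar>a e * F1 k (Z t a)\<bar> \<le> C * exp ((c1 + 1) * (\<Sum>i\<in>I. \<bar>a i\<bar>))" for a
      using abs_mult_exp_le[OF order_trans[OF bound(2) grow] A_comp, OF that(2,1)]
      by (simp add: A_def)
  qed (use F1m[OF that(2)] that in measurable)
  have F2_int: "integrable (gauss I) (\<lambda>a. F2 k l (Z t a))" if "l \<in> K" "k \<in> K" for l k t
    by (rule integrable_gauss_bound[OF I F2m, where C = C and c = c1])
       (use order_trans[OF bound(3) grow] that in \<open>auto simp: A_def\<close>)
  have stein: "(\<integral>a. a e * F1 k (Z t a) \<partial>gauss I) = (\<integral>a. (\<Sum>l\<in>K. F2 k l (Z t a) * B t l e) \<partial>gauss I)"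
    if "e \<in> I" "k \<in> K" for e k t
  \<comment> \<open>One constant has to serve a function and its derivative: the summand
    \<open>1\<close> covers \<open>F1 k\<close>, the summand \<open>card K * \<beta>\<close> covers
    the sum of the \<open>F2 k l\<close> against the coefficients \<open>B t l e\<close>.\<close>
  proof (rule gauss_stein_identity[where c = c1 and C = "C * (1 + real (card K) * \<beta>)", OF I that(1)])
    have Zder: "((\<lambda>x. Z t (a(e := x)) l) has_real_derivative B t l e) (at x)" for a x l
      unfolding Z_def by (subst sum.remove[OF I that(1)]) (auto intro!: derivative_eq_intros)
    show "((\<lambda>x. F1 k (Z t (a(e := x)))) has_real_derivative (\<Sum>l\<in>K. F2 k l (Z t (a(e := x))) * B t l e)) (at x)" for a x
      by (rule F1[OF that(2)]) (rule Zder)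
    show "isCont (\<lambda>x. \<Sum>l\<in>K. F2 k l (Z t (a(e := x))) * B t l e) x" for a x
      by (intro continuous_intros F2 that DERIV_isCont[OF Zder])
    show "\<bar>F1 k (Z t a)\<bar> \<le> C * (1 + real (card K) * \<beta>) * exp (c1 * (\<Sum>i\<in>I. \<bar>a i\<bar>))" for a
    proof -
      have "\<bar>F1 k (Z t a)\<bar> \<le> C * exp (c1 * A a)" using order_trans[OF bound(2) grow] that by blast
      also have "\<dots> \<le> C * (1 + real (card K) * \<beta>) * exp (c1 * A a)"
        using C beta by (intro mult_right_mono) (auto simp: algebra_simps)
      finally show ?thesis by (simp add: A_def)
    qed
    show "\<bar>\<Sum>l\<in>K. F2 k l (Z t a) * B t l e\<bar> \<le> C * (1 + real (card K) * \<beta>) * exp (c1 * (\<Sum>i\<in>I. \<bar>a i\<bar>))" for a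
    proof -
      have "\<bar>\<Sum>l\<in>K. F2 k l (Z t a) * B t l e\<bar> \<le> (\<Sum>l\<in>K. \<bar>F2 k l (Z t a) * B t l e\<bar>)" by (rule sum_abs)
      also have "\<dots> \<le> real (card K) * (C * exp (c1 * A a) * \<beta>)"
        unfolding abs_mult using that C
        by (intro sum_bounded_above mult_mono order_trans[OF bound(3) grow] B_bound) auto
      also have "\<dots> \<le> C * (1 + real (card K) * \<beta>) * exp (c1 * A a)"
        using C by (simp add: algebra_simps)
      finally show ?thesis by (simp add: A_def)
    qed
    show "(\<lambda>a. \<Sum>l\<in>K. F2 k l (Z t a) * B t l e) \<in> borel_measurable (gauss I)"
      using F2m that by (intro borel_measurable_sum borel_measurable_times) auto
  qed (use F1m that in auto)
  define \<phi> where "\<phi> t = (\<integral>a. F (Z t a) \<partial>gauss I)" for t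
  have der: "(\<phi> has_real_derivative (\<integral>a. (\<Sum>k\<in>K. F1 k (Z t a) * Z' t a k) \<partial>gauss I)) (at t)" for t
    unfolding \<phi>_def
  proof (rule has_real_derivative_integral[where r = 1 and w = "\<lambda>a. real (card K) * \<beta> * (C * exp ((c1 + 1) * A a))"])
    fix s a
    have "((\<lambda>t. Z t a k) has_real_derivative Z' s a k) (at s)" for k
      unfolding Z_def Z'_def by (auto intro!: derivative_eq_intros B)
    then show "((\<lambda>t. F (Z t a)) has_real_derivative (\<Sum>k\<in>K. F1 k (Z s a) * Z' s a k)) (at s)"
      by (rule F)
    have "\<bar>F1 k (Z s a) * Z' s a k\<bar> \<le> \<beta> * (C * exp ((c1 + 1) * A a))" if "k \<in> K" for k
    proof -
      have "\<bar>F1 k (Z s a) * Z' s a k\<bar> \<le> \<bar>F1 k (Z s a)\<bar> * (\<beta> * A a)"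
        unfolding abs_mult by (intro mult_left_mono Z_bound that) auto
      also have "\<dots> = \<beta> * \<bar>A a * F1 k (Z s a)\<bar>" using A0 by (simp add: abs_mult)
      also have "\<dots> \<le> \<beta> * (C * exp ((c1 + 1) * A a))"
        by (intro mult_left_mono beta abs_mult_exp_le order_trans[OF bound(2) grow] that) (simp add: A0)
      finally show ?thesis .
    qed
    then have "(\<Sum>k\<in>K. \<bar>F1 k (Z s a) * Z' s a k\<bar>) \<le> real (card K) * (\<beta> * (C * exp ((c1 + 1) * A a)))"
      by (rule sum_bounded_above)
    then show "\<bar>\<Sum>k\<in>K. F1 k (Z s a) * Z' s a k\<bar> \<le> real (card K) * \<beta> * (C * exp ((c1 + 1) * A a))"
      unfolding mult.assoc by (rule order_trans[OF sum_abs])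
  next
    show "integrable (gauss I) (\<lambda>a. real (card K) * \<beta> * (C * exp ((c1 + 1) * A a)))"
      by (intro integrable_mult_right integrable_gauss_bound[OF I, where C = 1 and c = "c1 + 1"])
         (auto simp: A_def)
  qed (use F_int F1m in auto)
  have nonpos: "(\<integral>a. (\<Sum>k\<in>K. F1 k (Z t a) * Z' t a k) \<partial>gauss I) \<le> 0" if "0 \<le> t" "t \<le> b" for t
  proof -
    have "(\<integral>a. (\<Sum>k\<in>K. F1 k (Z t a) * Z' t a k) \<partial>gauss I)
        = (\<integral>a. (\<Sum>k\<in>K. \<Sum>e\<in>I. B' t k e * (a e * F1 k (Z t a))) \<partial>gauss I)"
      by (simp add: Z'_def sum_distrib_left mult_ac)
    also have "\<dots> = (\<Sum>k\<in>K. \<Sum>e\<in>I. B' t k e * (\<integral>a. a e * F1 k (Z t a) \<partial>gauss I))"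
      using F1_int by (subst Bochner_Integration.integral_sum; simp)+
    also have "\<dots> = (\<Sum>k\<in>K. \<Sum>e\<in>I. B' t k e * (\<integral>a. (\<Sum>l\<in>K. F2 k l (Z t a) * B t l e) \<partial>gauss I))"
      by (simp add: stein)
    also have "\<dots> = (\<integral>a. (\<Sum>k\<in>K. \<Sum>e\<in>I. B' t k e * (\<Sum>l\<in>K. F2 k l (Z t a) * B t l e)) \<partial>gauss I)"
      using F2_int by (subst Bochner_Integration.integral_sum; simp)+
    also have "\<dots> \<le> 0"
    proof -
      have "(\<Sum>k\<in>K. \<Sum>e\<in>I. B' t k e * (\<Sum>l\<in>K. F2 k l (Z t a) * B t l e)) \<le> 0" for a
      proof -
      \<comment> \<open>After the exchange of sums the coefficient of \<open>F2 k l\<close> is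
        \<open>\<Sum>e\<in>I. B' t k e * B t l e\<close>; symmetrised in \<open>k\<close> and
        \<open>l\<close>, this is half the derivative of the covariance of two coordinates of the
        field.\<close>
      have "(\<Sum>k\<in>K. \<Sum>e\<in>I. B' t k e * (\<Sum>l\<in>K. F2 k l (Z t a) * B t l e))
          = (\<Sum>k\<in>K. \<Sum>l\<in>K. (\<Sum>e\<in>I. B' t k e * B t l e) * F2 k l (Z t a))"
        unfolding sum_distrib_left sum_distrib_right
        by (rule sum.cong[OF refl], subst sum.swap) (simp add: mult_ac)
      then show ?thesis using sign[OF that] by simp
      qed
      then have "0 \<le> (\<integral>a. - (\<Sum>k\<in>K. \<Sum>e\<in>I. B' t k e * (\<Sum>l\<in>K. F2 k l (Z t a) * B t l e)) \<partial>gauss I)"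
        by (intro Bochner_Integration.integral_nonneg) simp
      then show ?thesis by simp
    qed
    finally show ?thesis .
  qed
  have "\<phi> b \<le> \<phi> 0"
    by (rule DERIV_nonpos_imp_nonincreasing[OF b]) (use der nonpos in blast)
  then show ?thesis unfolding \<phi>_def Z_def[abs_def] .
qed

section \<open>Gordon's comparison inequality\<close>

lemma unit_vector_coord:
  fixes h :: "nat \<Rightarrow> real"
  assumes "(\<Sum>j=1..N. (h j)\<^sup>2) = 1" "j \<in> {1..N}"
  shows "\<bar>h j\<bar> \<le> 1"
proof -
  have "(h j)\<^sup>2 \<le> (\<Sum>j=1..N. (h j)\<^sup>2)" using assms(2) by (intro member_le_sum) auto
  then show ?thesis using assms(1) by (simp add: abs_square_le_1)
qed

text \<open>The coordinates of the fields below are indexed by pairs \<open>(i, h)\<close>: the entries with \<open>i \<ge> 1\<close>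
  form a vector attached to \<open>h\<close>, the entry with \<open>i = 0\<close> is a scalar.  With \<open>q h\<close> the smoothed norm of the
  vector minus the scalar, \<open>F\<close> is a smooth version of \<open>exp (- \<kappa> * Min q)\<close>, \<open>n\<close> is the gradient of \<open>q\<close>, and
  \<open>nn\<close> is the Hessian of the smoothed norm.\<close>

locale soft_min =
  fixes m N :: nat and T :: "(nat \<Rightarrow> real) set" and \<alpha> \<kappa> d :: real
  assumes finT: "finite T" and T_ne: "T \<noteq> {}" and lam: "0 < \<kappa>" and alpha: "\<kappa> \<le> \<alpha>" and d: "0 < d"
    and unit: "\<And>h. h \<in> T \<Longrightarrow> (\<Sum>j=1..N. (h j)\<^sup>2) = 1"
begin

definition R :: "(nat \<times> (nat \<Rightarrow> real) \<Rightarrow> real) \<Rightarrow> (nat \<Rightarrow> real) \<Rightarrow> real" where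
  "R z h = sqrt (d\<^sup>2 + (\<Sum>i=1..m. (z (i, h))\<^sup>2))"

definition E where "E z h = exp (- \<alpha> * (R z h - z (0, h)))"
definition S where "S z = (\<Sum>h\<in>T. E z h)"
definition n where "n z k = (if fst k = 0 then -1 else z k / R z (snd k))"
definition nn where "nn z i j h = (if i = 0 \<or> j = 0 then 0
   else (if i = j then 1 / R z h else 0) - z (i, h) * z (j, h) / (R z h)^3)"

definition F where "F z = S z powr (\<kappa> / \<alpha>)"
definition F1 where "F1 k z = - \<kappa> * (E z (snd k) * S z powr (\<kappa> / \<alpha> - 1)) * n z k"
text \<open>The three contributions come from differentiating, in this order, the factor
  \<open>E z (snd k)\<close>, the power of \<open>S z\<close>, and the gradient
  \<open>n z k\<close>. Only the middle one couples different points \<open>h\<close> of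
  \<open>T\<close>.\<close>

definition F2 where "F2 k l z =
   - \<kappa> * ((if snd l = snd k then - \<alpha> * n z l * (E z (snd k) * S z powr (\<kappa> / \<alpha> - 1)) else 0)
     + (\<alpha> - \<kappa>) * (E z (snd k) * E z (snd l) * S z powr (\<kappa> / \<alpha> - 2)) * n z l) * n z k
   - \<kappa> * (E z (snd k) * S z powr (\<kappa> / \<alpha> - 1)) * (if snd l = snd k then nn z (fst k) (fst l) (snd k) else 0)"

abbreviation "K \<equiv> {0..m} \<times> T"

lemma finK: "finite K" using finT by simp
lemma alpha_pos: "0 < \<alpha>" using lam alpha by simp

lemma R_ge: "d \<le> R z h"
proof -
  have "sqrt (d\<^sup>2) \<le> R z h" unfolding R_def by (intro real_sqrt_le_mono) (simp add: sum_nonneg)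
  then show ?thesis using d by simp
qed
lemma R_pos: "0 < R z h" using R_ge[of z h] d by linarith
lemma R_sq: "(R z h)\<^sup>2 = d\<^sup>2 + (\<Sum>i=1..m. (z (i, h))\<^sup>2)"
  unfolding R_def by (rule real_sqrt_pow2) (simp add: sum_nonneg add_nonneg_nonneg)
lemma z_le_R: "i \<in> {1..m} \<Longrightarrow> \<bar>z (i, h)\<bar> \<le> R z h"
proof -
  assume i: "i \<in> {1..m}"
  have "(z (i, h))\<^sup>2 \<le> (\<Sum>i=1..m. (z (i, h))\<^sup>2)"
    using i by (intro member_le_sum) auto
  then have "(z (i, h))\<^sup>2 \<le> (R z h)\<^sup>2" by (simp add: R_sq add_increasing)
  then show ?thesis using R_pos[of z h] by (metis abs_le_square_iff abs_of_pos)
qed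

lemma E_pos: "0 < E z h" by (simp add: E_def)
lemma S_pos: "0 < S z" unfolding S_def using finT T_ne by (intro sum_pos E_pos) auto
lemma E_le_S: "h \<in> T \<Longrightarrow> E z h \<le> S z"
  unfolding S_def using finT by (intro member_le_sum) (auto intro: less_imp_le E_pos)

section \<open>Derivatives of the soft minimum up to second order\<close>

lemma R_deriv:
  assumes "\<And>k. k \<in> K \<Longrightarrow> ((\<lambda>t. z t k) has_real_derivative z' k) (at t)" "h \<in> T"
  shows "((\<lambda>t. R (z t) h) has_real_derivative (\<Sum>i=1..m. z t (i, h) / R (z t) h * z' (i, h))) (at t)"
proof -
  have "0 < d\<^sup>2 + (\<Sum>i=1..m. (z t (i, h))\<^sup>2)"
    using d by (intro add_pos_nonneg sum_nonneg) auto
  moreover have "((\<lambda>t. d\<^sup>2 + (\<Sum>i=1..m. (z t (i, h))\<^sup>2)) has_real_derivative (\<Sum>i=1..m. 2 * z t (i, h) * z' (i, h))) (at t)"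
    by (auto intro!: derivative_eq_intros assms sum.cong simp: mult_ac)
  ultimately have "((\<lambda>t. sqrt (d\<^sup>2 + (\<Sum>i=1..m. (z t (i, h))\<^sup>2))) has_real_derivative
     inverse (sqrt (d\<^sup>2 + (\<Sum>i=1..m. (z t (i, h))\<^sup>2))) / 2 * (\<Sum>i=1..m. 2 * z t (i, h) * z' (i, h))) (at t)"
    by (rule DERIV_chain2[OF DERIV_real_sqrt])
  then show ?thesis unfolding R_def
  proof (rule DERIV_cong)
    show "inverse (sqrt (d\<^sup>2 + (\<Sum>i=1..m. (z t (i, h))\<^sup>2))) / 2 * (\<Sum>i=1..m. 2 * z t (i, h) * z' (i, h))
      = (\<Sum>i=1..m. z t (i, h) / sqrt (d\<^sup>2 + (\<Sum>i=1..m. (z t (i, h))\<^sup>2)) * z' (i, h))"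
      unfolding sum_distrib_left by (rule sum.cong[OF refl]) (simp only: divide_inverse, simp)
  qed
qed

lemma sum_split0: "(\<Sum>i=0..m. f i) = f 0 + (\<Sum>i=1..m. f i)" for f :: "nat \<Rightarrow> real"
  by (simp add: sum.atLeast_Suc_atMost)

lemma sum_n: "(\<Sum>i=0..m. n z (i, h) * w i) = (\<Sum>i=1..m. z (i, h) / R z h * w i) - w 0"
  by (simp add: sum_split0 n_def)

lemma E_deriv:
  assumes "\<And>k. k \<in> K \<Longrightarrow> ((\<lambda>t. z t k) has_real_derivative z' k) (at t)" "h \<in> T"
  shows "((\<lambda>t. E (z t) h) has_real_derivative (\<Sum>i=0..m. - \<alpha> * E (z t) h * n (z t) (i, h) * z' (i, h))) (at t)"
proof -
  have "((\<lambda>t. E (z t) h) has_real_derivative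
    E (z t) h * (- \<alpha> * ((\<Sum>i=1..m. z t (i, h) / R (z t) h * z' (i, h)) - z' (0, h)))) (at t)"
    unfolding E_def using assms(2) by (auto intro!: derivative_eq_intros R_deriv assms)
  then show ?thesis
  proof (rule DERIV_cong)
    have "(\<Sum>i=0..m. - \<alpha> * E (z t) h * n (z t) (i, h) * z' (i, h))
      = - \<alpha> * E (z t) h * (\<Sum>i=0..m. n (z t) (i, h) * z' (i, h))"
      by (simp only: sum_distrib_left mult.assoc)
    also have "\<dots> = - \<alpha> * E (z t) h * ((\<Sum>i=1..m. z t (i, h) / R (z t) h * z' (i, h)) - z' (0, h))"
      by (simp only: sum_n)
    also have "\<dots> = E (z t) h * (- \<alpha> * ((\<Sum>i=1..m. z t (i, h) / R (z t) h * z' (i, h)) - z' (0, h)))"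
      by (simp only: mult.assoc mult.left_commute[of "E (z t) h"])
    finally show "E (z t) h * (- \<alpha> * ((\<Sum>i=1..m. z t (i, h) / R (z t) h * z' (i, h)) - z' (0, h)))
      = (\<Sum>i=0..m. - \<alpha> * E (z t) h * n (z t) (i, h) * z' (i, h))" by (rule sym)
  qed
qed

lemma sum_K: "(\<Sum>k\<in>K. f k) = (\<Sum>h\<in>T. \<Sum>i=0..m. f (i, h))"
  by (subst sum.swap) (simp add: sum.cartesian_product)

lemma S_deriv:
  assumes "\<And>k. k \<in> K \<Longrightarrow> ((\<lambda>t. z t k) has_real_derivative z' k) (at t)"
  shows "((\<lambda>t. S (z t)) has_real_derivative (\<Sum>k\<in>K. - \<alpha> * E (z t) (snd k) * n (z t) k * z' k)) (at t)"
  unfolding S_def sum_K by (auto intro!: derivative_eq_intros E_deriv assms)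

lemma powr_deriv:
  assumes "\<And>k. k \<in> K \<Longrightarrow> ((\<lambda>t. z t k) has_real_derivative z' k) (at t)"
  shows "((\<lambda>t. S (z t) powr p) has_real_derivative
    (\<Sum>k\<in>K. - (\<alpha> * p) * (E (z t) (snd k) * S (z t) powr (p - 1)) * n (z t) k * z' k)) (at t)"
proof -
  have "((\<lambda>t. S (z t) powr p) has_real_derivative
    p * S (z t) powr (p - 1) * (\<Sum>k\<in>K. - \<alpha> * E (z t) (snd k) * n (z t) k * z' k)) (at t)"
    by (rule DERIV_chain2[OF has_real_derivative_powr[OF S_pos] S_deriv[OF assms]])
  then show ?thesis by (rule DERIV_cong) (simp add: sum_distrib_left mult_ac)
qed

lemma F_deriv:
  assumes "\<And>k. k \<in> K \<Longrightarrow> ((\<lambda>t. z t k) has_real_derivative z' k) (at t)"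
  shows "((\<lambda>t. F (z t)) has_real_derivative (\<Sum>k\<in>K. F1 k (z t) * z' k)) (at t)"
  unfolding F_def F1_def using powr_deriv[OF assms, where p = "\<kappa> / \<alpha>"] alpha_pos by simp

lemma sum_if_row:
  assumes "h \<in> T"
  shows "(\<Sum>l\<in>K. if snd l = h then f l else 0) = (\<Sum>i=0..m. f (i, h))"
proof -
  have "(\<Sum>l\<in>K. if snd l = h then f l else 0) = (\<Sum>(i, h')\<in>K. if h' = h then f (i, h') else 0)"
    by (rule sum.cong) auto
  also have "\<dots> = (\<Sum>i=0..m. \<Sum>h'\<in>T. if h' = h then f (i, h') else 0)"
    by (rule sum.cartesian_product[symmetric])
  finally have "(\<Sum>l\<in>K. if snd l = h then f l else 0) = (\<Sum>i=0..m. \<Sum>h'\<in>T. if h' = h then f (i, h') else 0)" .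
  then show ?thesis using finT assms by simp
qed

lemma n_deriv:
  assumes "\<And>k. k \<in> K \<Longrightarrow> ((\<lambda>t. z t k) has_real_derivative z' k) (at t)" "k \<in> K"
  shows "((\<lambda>t. n (z t) k) has_real_derivative
    (\<Sum>l\<in>K. (if snd l = snd k then nn (z t) (fst k) (fst l) (snd k) else 0) * z' l)) (at t)"
proof -
  obtain i h where k: "k = (i, h)" and ih: "i \<le> m" "h \<in> T" using assms(2) by auto
  have "(\<Sum>l\<in>K. (if snd l = snd k then nn (z t) (fst k) (fst l) (snd k) else 0) * z' l)
      = (\<Sum>l\<in>K. if snd l = h then nn (z t) i (fst l) h * z' l else 0)"
    by (rule sum.cong) (auto simp: k)
  also have "\<dots> = (\<Sum>j=0..m. nn (z t) i j h * z' (j, h))" by (simp add: sum_if_row ih)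
  also have "((\<lambda>t. n (z t) k) has_real_derivative \<dots>) (at t)"
  proof (cases "i = 0")
    case True
    then show ?thesis by (simp add: n_def k nn_def)
  next
    case False
    have Rn: "R (z t) h \<noteq> 0" using R_pos[of "z t" h] by simp
    have "((\<lambda>t. z t (i, h) / R (z t) h) has_real_derivative
       (z' (i, h) * R (z t) h - z t (i, h) * (\<Sum>j=1..m. z t (j, h) / R (z t) h * z' (j, h))) / (R (z t) h * R (z t) h)) (at t)"
      by (rule DERIV_divide[OF assms(1) R_deriv[OF assms(1)] Rn]) (use ih in auto)
    moreover have "(z' (i, h) * R (z t) h - z t (i, h) * (\<Sum>j=1..m. z t (j, h) / R (z t) h * z' (j, h))) / (R (z t) h * R (z t) h)
       = (\<Sum>j=0..m. nn (z t) i j h * z' (j, h))"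
    proof -
      have "(\<Sum>j=0..m. nn (z t) i j h * z' (j, h)) = (\<Sum>j=1..m. nn (z t) i j h * z' (j, h))"
        by (simp add: sum_split0 nn_def)
      also have "\<dots> = (\<Sum>j=1..m. (if i = j then z' (j, h) / R (z t) h else 0) - z t (i, h) * z t (j, h) / R (z t) h ^ 3 * z' (j, h))"
        using False by (intro sum.cong) (auto simp: nn_def algebra_simps)
      also have "\<dots> = z' (i, h) / R (z t) h - (\<Sum>j=1..m. z t (i, h) * z t (j, h) / R (z t) h ^ 3 * z' (j, h))"
        using False ih by (simp add: sum_subtractf)
      also have "(\<Sum>j=1..m. z t (i, h) * z t (j, h) / R (z t) h ^ 3 * z' (j, h))
          = z t (i, h) * (\<Sum>j=1..m. z t (j, h) / R (z t) h * z' (j, h)) / (R (z t) h * R (z t) h)"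
        unfolding sum_distrib_left sum_divide_distrib by (intro sum.cong) (auto simp: power3_eq_cube)
      finally show ?thesis using Rn by (simp add: diff_divide_distrib)
    qed
    ultimately show ?thesis using False by (simp add: n_def k)
  qed
  finally show ?thesis .
qed

lemma F1_deriv:
  assumes k: "k \<in> K" and z: "\<And>k. k \<in> K \<Longrightarrow> ((\<lambda>t. z t k) has_real_derivative z' k) (at t)"
  shows "((\<lambda>t. F1 k (z t)) has_real_derivative (\<Sum>l\<in>K. F2 k l (z t) * z' l)) (at t)"
proof -
  let ?h = "snd k" and ?p = "\<kappa> / \<alpha> - 1"
  have h: "?h \<in> T" using k by auto
  have "(\<Sum>i=0..m. - \<alpha> * E (z t) ?h * n (z t) (i, ?h) * z' (i, ?h))
      = (\<Sum>l\<in>K. if snd l = ?h then - \<alpha> * E (z t) ?h * n (z t) l * z' l else 0)"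
    using h by (subst sum_if_row) auto
  then have dE: "((\<lambda>t. E (z t) ?h) has_real_derivative
      (\<Sum>l\<in>K. if snd l = ?h then - \<alpha> * E (z t) ?h * n (z t) l * z' l else 0)) (at t)"
    using E_deriv[where z = z and z' = z', OF z h] by simp
  note dP = powr_deriv[where z = z and z' = z' and p = ?p, OF z]
  note dN = n_deriv[where z = z and z' = z', OF z k]
  from DERIV_cmult[OF DERIV_mult[OF DERIV_mult[OF dE dP] dN], of "- \<kappa>"]
  have "((\<lambda>t. - \<kappa> * (E (z t) ?h * S (z t) powr ?p * n (z t) k)) has_real_derivative
    - \<kappa> * (((\<Sum>l\<in>K. if snd l = ?h then - \<alpha> * E (z t) ?h * n (z t) l * z' l else 0) * S (z t) powr ?p
         + (\<Sum>l\<in>K. - (\<alpha> * ?p) * (E (z t) (snd l) * S (z t) powr (?p - 1)) * n (z t) l * z' l) * E (z t) ?h) * n (z t) k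
      + (\<Sum>l\<in>K. (if snd l = snd k then nn (z t) (fst k) (fst l) (snd k) else 0) * z' l) * (E (z t) ?h * S (z t) powr ?p))) (at t)"
    .
  moreover have "F1 k = (\<lambda>z. - \<kappa> * (E z ?h * S z powr ?p * n z k))"
    by (rule ext) (simp add: F1_def)
  ultimately have "((\<lambda>t. F1 k (z t)) has_real_derivative
    - \<kappa> * (((\<Sum>l\<in>K. if snd l = ?h then - \<alpha> * E (z t) ?h * n (z t) l * z' l else 0) * S (z t) powr ?p
         + (\<Sum>l\<in>K. - (\<alpha> * ?p) * (E (z t) (snd l) * S (z t) powr (?p - 1)) * n (z t) l * z' l) * E (z t) ?h) * n (z t) k
      + (\<Sum>l\<in>K. (if snd l = snd k then nn (z t) (fst k) (fst l) (snd k) else 0) * z' l) * (E (z t) ?h * S (z t) powr ?p))) (at t)"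
    by (simp only:)
  then show ?thesis
  proof (rule DERIV_cong)
    have p: "\<alpha> * ?p = \<kappa> - \<alpha>" "?p - 1 = \<kappa> / \<alpha> - 2" using alpha_pos by (auto simp: field_simps)
    show "- \<kappa> * (((\<Sum>l\<in>K. if snd l = ?h then - \<alpha> * E (z t) ?h * n (z t) l * z' l else 0) * S (z t) powr ?p
         + (\<Sum>l\<in>K. - (\<alpha> * ?p) * (E (z t) (snd l) * S (z t) powr (?p - 1)) * n (z t) l * z' l) * E (z t) ?h) * n (z t) k
      + (\<Sum>l\<in>K. (if snd l = snd k then nn (z t) (fst k) (fst l) (snd k) else 0) * z' l) * (E (z t) ?h * S (z t) powr ?p))
      = (\<Sum>l\<in>K. F2 k l (z t) * z' l)"
      unfolding p sum_distrib_left sum_distrib_right sum.distrib[symmetric] F2_def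
    proof (rule sum.cong[OF refl], goal_cases)
      case (1 l)
      show ?case by (cases "snd l = snd k") (simp_all add: algebra_simps)
    qed
  qed
qed

section \<open>Continuity and measurability of these derivatives\<close>

lemma R_cont:
  assumes "\<And>k. k \<in> K \<Longrightarrow> isCont (\<lambda>t::real. z t k) t" "h \<in> T"
  shows "isCont (\<lambda>t. R (z t) h) t"
  unfolding R_def using assms by (intro continuous_intros) auto

lemma E_cont:
  assumes "\<And>k. k \<in> K \<Longrightarrow> isCont (\<lambda>t::real. z t k) t" "h \<in> T"
  shows "isCont (\<lambda>t. E (z t) h) t"
  unfolding E_def using assms by (intro continuous_intros R_cont) auto

lemma S_powr_cont:
  assumes "\<And>k. k \<in> K \<Longrightarrow> isCont (\<lambda>t::real. z t k) t"
  shows "isCont (\<lambda>t. S (z t) powr p) t"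
proof -
  have "S (z t) \<noteq> 0" using S_pos[of "z t"] by simp
  moreover have "isCont (\<lambda>t. S (z t)) t"
    unfolding S_def using assms by (intro continuous_intros E_cont) auto
  ultimately show ?thesis by (intro continuous_intros) auto
qed

lemma n_cont:
  assumes "\<And>k. k \<in> K \<Longrightarrow> isCont (\<lambda>t::real. z t k) t" "k \<in> K"
  shows "isCont (\<lambda>t. n (z t) k) t"
proof (cases "fst k = 0")
  case False
  have "R (z t) (snd k) \<noteq> 0" using R_pos[of "z t" "snd k"] by simp
  then have "isCont (\<lambda>t. z t k / R (z t) (snd k)) t"
    using assms by (intro continuous_intros R_cont) auto
  with False show ?thesis by (simp add: n_def)
qed (simp add: n_def)

lemma nn_cont:
  assumes "\<And>k. k \<in> K \<Longrightarrow> isCont (\<lambda>t::real. z t k) t" "i \<le> m" "j \<le> m" "h \<in> T"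
  shows "isCont (\<lambda>t. nn (z t) i j h) t"
proof (cases "i = 0 \<or> j = 0")
  case False
  have "R (z t) h \<noteq> 0" using R_pos[of "z t" h] by simp
  then have "isCont (\<lambda>t. (if i = j then 1 / R (z t) h else 0) - z t (i, h) * z t (j, h) / R (z t) h ^ 3) t"
    using assms by (cases "i = j") (auto intro!: continuous_intros R_cont)
  with False show ?thesis by (simp add: nn_def)
qed (simp add: nn_def)

lemma F2_cont:
  assumes "k \<in> K" "l \<in> K" "\<And>k. k \<in> K \<Longrightarrow> isCont (\<lambda>t::real. z t k) t"
  shows "isCont (\<lambda>t. F2 k l (z t)) t"
proof -
  have h: "snd k \<in> T" "snd l \<in> T" "fst k \<le> m" "fst l \<le> m" using assms by auto
  note c = E_cont[OF assms(3) h(1)] E_cont[OF assms(3) h(2)] S_powr_cont[OF assms(3)]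
    n_cont[OF assms(3,1)] n_cont[OF assms(3,2)] nn_cont[OF assms(3) h(3,4,1)]
  show ?thesis
  proof (cases "snd l = snd k")
    case True
    show ?thesis unfolding F2_def if_P[OF True]
      by (intro continuous_add continuous_diff continuous_mult continuous_const c)
  next
    case False
    show ?thesis unfolding F2_def if_not_P[OF False]
      by (intro continuous_add continuous_diff continuous_mult continuous_const c)
  qed
qed

lemma R_meas:
  assumes "\<And>k. k \<in> K \<Longrightarrow> (\<lambda>a. z a k) \<in> borel_measurable M" "h \<in> T"
  shows "(\<lambda>a. R (z a) h) \<in> borel_measurable M"
proof -
  have "(\<lambda>a. z a (i, h)) \<in> borel_measurable M" if "i \<in> {1..m}" for i
    using assms that by auto
  then show ?thesis unfolding R_def by measurable
qed

lemma E_meas: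
  assumes "\<And>k. k \<in> K \<Longrightarrow> (\<lambda>a. z a k) \<in> borel_measurable M" "h \<in> T"
  shows "(\<lambda>a. E (z a) h) \<in> borel_measurable M"
proof -
  have [measurable]: "(\<lambda>a. R (z a) h) \<in> borel_measurable M" "(\<lambda>a. z a (0, h)) \<in> borel_measurable M"
    using assms by (auto intro: R_meas)
  show ?thesis unfolding E_def by measurable
qed

lemma S_meas:
  assumes "\<And>k. k \<in> K \<Longrightarrow> (\<lambda>a. z a k) \<in> borel_measurable M"
  shows "(\<lambda>a. S (z a)) \<in> borel_measurable M"
  unfolding S_def using assms by (intro borel_measurable_sum E_meas) auto

lemma n_meas:
  assumes "\<And>k. k \<in> K \<Longrightarrow> (\<lambda>a. z a k) \<in> borel_measurable M" "k \<in> K"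
  shows "(\<lambda>a. n (z a) k) \<in> borel_measurable M"
proof -
  have [measurable]: "(\<lambda>a. R (z a) (snd k)) \<in> borel_measurable M" "(\<lambda>a. z a k) \<in> borel_measurable M"
    using assms by (auto intro: R_meas)
  show ?thesis unfolding n_def by measurable
qed

lemma nn_meas:
  assumes "\<And>k. k \<in> K \<Longrightarrow> (\<lambda>a. z a k) \<in> borel_measurable M" "i \<le> m" "j \<le> m" "h \<in> T"
  shows "(\<lambda>a. nn (z a) i j h) \<in> borel_measurable M"
proof -
  have [measurable]: "(\<lambda>a. R (z a) h) \<in> borel_measurable M"
    "(\<lambda>a. z a (i, h)) \<in> borel_measurable M" "(\<lambda>a. z a (j, h)) \<in> borel_measurable M"
    using assms by (auto intro: R_meas)
  show ?thesis unfolding nn_def by measurable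
qed

lemma F_meas:
  assumes "\<And>k. k \<in> K \<Longrightarrow> (\<lambda>a. z a k) \<in> borel_measurable M"
  shows "(\<lambda>a. F (z a)) \<in> borel_measurable M"
  using S_meas[of z, OF assms] unfolding F_def by measurable

lemma F1_meas:
  assumes "k \<in> K" "\<And>k. k \<in> K \<Longrightarrow> (\<lambda>a. z a k) \<in> borel_measurable M"
  shows "(\<lambda>a. F1 k (z a)) \<in> borel_measurable M"
proof -
  have [measurable]: "(\<lambda>a. E (z a) (snd k)) \<in> borel_measurable M"
    "(\<lambda>a. S (z a)) \<in> borel_measurable M" "(\<lambda>a. n (z a) k) \<in> borel_measurable M"
    using assms by (auto intro: E_meas S_meas n_meas)
  show ?thesis unfolding F1_def by measurable
qed

lemma F2_meas:
  assumes "k \<in> K" "l \<in> K" "\<And>k. k \<in> K \<Longrightarrow> (\<lambda>a. z a k) \<in> borel_measurable M"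
  shows "(\<lambda>a. F2 k l (z a)) \<in> borel_measurable M"
proof -
  have [measurable]: "(\<lambda>a. E (z a) (snd k)) \<in> borel_measurable M" "(\<lambda>a. E (z a) (snd l)) \<in> borel_measurable M"
    "(\<lambda>a. S (z a)) \<in> borel_measurable M" "(\<lambda>a. n (z a) k) \<in> borel_measurable M" "(\<lambda>a. n (z a) l) \<in> borel_measurable M"
    "(\<lambda>a. nn (z a) (fst k) (fst l) (snd k)) \<in> borel_measurable M"
    using assms by (auto intro: E_meas S_meas n_meas nn_meas)
  show ?thesis unfolding F2_def by measurable
qed

section \<open>Exponential growth bounds\<close>

lemma F_pos: "0 < F z" using S_pos[of z] by (simp add: F_def)

text \<open>The outer power \<open>\<kappa> / \<alpha>\<close> undoes the factor \<alpha> in the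
  exponents, so the growth rate is \<kappa> for every \<alpha>; the parameter \<alpha> enters only
  through the constant.\<close>

lemma F_bound: "F z \<le> real (card T) powr (\<kappa> / \<alpha>) * exp (\<kappa> * (\<Sum>k\<in>K. \<bar>z k\<bar>))"
proof -
  let ?A = "\<Sum>k\<in>K. \<bar>z k\<bar>"
  have "E z h \<le> exp (\<alpha> * ?A)" if "h \<in> T" for h
  proof -
    have "\<bar>z (0, h)\<bar> \<le> ?A" using that finT by (intro member_le_sum) auto
    then have "z (0, h) - R z h \<le> ?A" using R_pos[of z h] by linarith
    then have "\<alpha> * (z (0, h) - R z h) \<le> \<alpha> * ?A" using alpha_pos by (intro mult_left_mono) auto
    moreover have "- \<alpha> * (R z h - z (0, h)) = \<alpha> * (z (0, h) - R z h)" by (simp add: algebra_simps)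
    ultimately show ?thesis unfolding E_def by simp
  qed
  then have "S z \<le> real (card T) * exp (\<alpha> * ?A)"
    unfolding S_def by (rule sum_bounded_above)
  then have "F z \<le> (real (card T) * exp (\<alpha> * ?A)) powr (\<kappa> / \<alpha>)"
    unfolding F_def using S_pos[of z] lam alpha_pos by (intro powr_mono2) auto
  also have "\<dots> = real (card T) powr (\<kappa> / \<alpha>) * exp (\<kappa> * ?A)"
  proof -
    have "exp (\<alpha> * ?A) powr (\<kappa> / \<alpha>) = exp (\<kappa> * ?A)" using alpha_pos by (simp add: powr_def)
    then show ?thesis by (simp only: powr_mult)
  qed
  finally show ?thesis .
qed

text \<open>Each differentiation lowers the power of \<open>S z\<close> by one but brings in a
  factor \<open>E z h \<le> S z\<close>; the derivatives are therefore controlled by multiples of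
  \<open>F z\<close> itself.\<close>

lemma ES_le_F:
  assumes "h \<in> T"
  shows "E z h * S z powr (\<kappa> / \<alpha> - 1) \<le> F z"
proof -
  have "E z h * S z powr (\<kappa> / \<alpha> - 1) \<le> S z * S z powr (\<kappa> / \<alpha> - 1)"
    by (intro mult_right_mono E_le_S assms) auto
  also have "\<dots> = S z powr (1 + (\<kappa> / \<alpha> - 1))"
    using S_pos[of z] by (simp only: powr_add) simp
  finally show ?thesis by (simp add: F_def)
qed

lemma EES_le_F:
  assumes "h \<in> T" "g \<in> T"
  shows "E z h * E z g * S z powr (\<kappa> / \<alpha> - 2) \<le> F z"
proof -
  have "E z h * E z g * S z powr (\<kappa> / \<alpha> - 2) \<le> S z * S z * S z powr (\<kappa> / \<alpha> - 2)"
    by (intro mult_right_mono mult_mono E_le_S assms) (auto intro: less_imp_le E_pos S_pos)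
  also have "\<dots> = S z powr (1 + 1 + (\<kappa> / \<alpha> - 2))"
    using S_pos[of z] by (simp only: powr_add) simp
  finally show ?thesis by (simp add: F_def)
qed

lemma n_bound: "k \<in> K \<Longrightarrow> \<bar>n z k\<bar> \<le> 1"
proof -
  assume "k \<in> K"
  then obtain i h where k: "k = (i, h)" "i \<le> m" by auto
  show ?thesis
  proof (cases "i = 0")
    case False
    then have "\<bar>z k\<bar> \<le> R z h" using z_le_R[of i z h] k by auto
    then show ?thesis using False R_pos[of z h] k by (simp add: n_def abs_divide)
  qed (simp add: n_def k)
qed

lemma nn_bound:
  assumes "i \<le> m" "j \<le> m"
  shows "\<bar>nn z i j h\<bar> \<le> 2 / d"
proof (cases "i = 0 \<or> j = 0")
  case False
  have R: "R z h > 0" by (rule R_pos)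
  have "1 / R z h \<le> 1 / d" using R_ge[of z h] d by (simp add: frac_le)
  moreover have "\<bar>z (i, h) * z (j, h) / R z h ^ 3\<bar> \<le> 1 / R z h"
  proof -
    have "\<bar>z (i, h) * z (j, h)\<bar> \<le> R z h * R z h"
      unfolding abs_mult using assms False R by (intro mult_mono z_le_R) auto
    then have "\<bar>z (i, h) * z (j, h)\<bar> / R z h ^ 3 \<le> R z h * R z h / R z h ^ 3"
      using R by (intro divide_right_mono) auto
    then show ?thesis using R by (simp add: power3_eq_cube abs_divide)
  qed
  moreover have "\<bar>if i = j then 1 / R z h else 0\<bar> \<le> 1 / R z h" using R by simp
  ultimately show ?thesis using False unfolding nn_def by (simp only: if_False)
qed (use d in \<open>auto simp: nn_def\<close>)

text \<open>A common constant for \<open>F\<close>, \<open>F1\<close> and \<open>F2\<close>, as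
  \<open>gaussian_interpolation\<close> asks for a single one; \<open>2 / d\<close> is the bound for
  the entries of the Hessian \<open>nn\<close>.\<close>

definition "bnd = real (card T) powr (\<kappa> / \<alpha>) * (1 + \<kappa> * (1 + \<alpha> + (\<alpha> - \<kappa>) + 2 / d))"

lemma bnd_ge:
  assumes "0 \<le> x" "x \<le> 1 + \<kappa> * (1 + \<alpha> + (\<alpha> - \<kappa>) + 2 / d)" "y \<le> x * F z"
  shows "y \<le> bnd * exp (\<kappa> * (\<Sum>k\<in>K. \<bar>z k\<bar>))"
proof -
  have "y \<le> (1 + \<kappa> * (1 + \<alpha> + (\<alpha> - \<kappa>) + 2 / d)) * (real (card T) powr (\<kappa> / \<alpha>) * exp (\<kappa> * (\<Sum>k\<in>K. \<bar>z k\<bar>)))"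
    by (rule order_trans[OF assms(3)], rule mult_mono[OF assms(2) F_bound])
       (use assms(1,2) F_pos[of z] in auto)
  then show ?thesis by (simp add: bnd_def mult_ac)
qed

lemma F_le: "\<bar>F z\<bar> \<le> bnd * exp (\<kappa> * (\<Sum>k\<in>K. \<bar>z k\<bar>))"
  using F_pos[of z] lam alpha d by (intro bnd_ge[of 1]) auto

lemma F1_le:
  assumes "k \<in> K"
  shows "\<bar>F1 k z\<bar> \<le> bnd * exp (\<kappa> * (\<Sum>k\<in>K. \<bar>z k\<bar>))"
proof (rule bnd_ge[of \<kappa>])
  have "0 \<le> E z (snd k) * S z powr (\<kappa> / \<alpha> - 1)" using E_pos[of z "snd k"] by simp
  moreover have "E z (snd k) * S z powr (\<kappa> / \<alpha> - 1) \<le> F z" using assms by (intro ES_le_F) auto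
  ultimately have "\<bar>E z (snd k) * S z powr (\<kappa> / \<alpha> - 1)\<bar> * \<bar>n z k\<bar> \<le> F z * 1"
    using n_bound[OF assms] F_pos[of z] by (intro mult_mono) auto
  then show "\<bar>F1 k z\<bar> \<le> \<kappa> * F z" using lam by (simp add: F1_def abs_mult mult.assoc)
  have "0 \<le> 2 / d" using d by simp
  then have "1 \<le> 1 + \<alpha> + (\<alpha> - \<kappa>) + 2 / d" using alpha alpha_pos by linarith
  then have "\<kappa> * 1 \<le> \<kappa> * (1 + \<alpha> + (\<alpha> - \<kappa>) + 2 / d)"
    using lam by (intro mult_left_mono) auto
  then show "\<kappa> \<le> 1 + \<kappa> * (1 + \<alpha> + (\<alpha> - \<kappa>) + 2 / d)" by linarith
qed (use lam in simp)

lemma F2_le: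
  assumes "k \<in> K" "l \<in> K"
  shows "\<bar>F2 k l z\<bar> \<le> bnd * exp (\<kappa> * (\<Sum>k\<in>K. \<bar>z k\<bar>))"
proof (rule bnd_ge[of "\<kappa> * (\<alpha> + (\<alpha> - \<kappa>) + 2 / d)"])
  let ?X = "E z (snd k) * S z powr (\<kappa> / \<alpha> - 1)" and ?Y = "E z (snd k) * E z (snd l) * S z powr (\<kappa> / \<alpha> - 2)"
  have X: "0 \<le> ?X" "?X \<le> F z" and Y: "0 \<le> ?Y" "?Y \<le> F z"
    using assms E_pos[of z "snd k"] E_pos[of z "snd l"] ES_le_F[of "snd k" z] EES_le_F[of "snd k" "snd l" z] by auto
  have nk: "\<bar>n z k\<bar> \<le> 1" and nl: "\<bar>n z l\<bar> \<le> 1" using n_bound assms by auto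
  have nnb: "\<bar>nn z (fst k) (fst l) (snd k)\<bar> \<le> 2 / d" using assms by (intro nn_bound) auto
  have Fz: "0 \<le> F z" using F_pos[of z] by simp
  have a: "\<bar>if snd l = snd k then - \<alpha> * n z l * ?X else 0\<bar> \<le> \<alpha> * F z"
  proof -
    have "\<alpha> * (\<bar>n z l\<bar> * \<bar>?X\<bar>) \<le> \<alpha> * (1 * F z)"
      using X nl alpha_pos by (intro mult_left_mono mult_mono) auto
    then show ?thesis using alpha_pos Fz by (simp add: abs_mult mult.assoc)
  qed
  have b: "\<bar>(\<alpha> - \<kappa>) * ?Y * n z l\<bar> \<le> (\<alpha> - \<kappa>) * F z"
  proof -
    have "(\<alpha> - \<kappa>) * (\<bar>?Y\<bar> * \<bar>n z l\<bar>) \<le> (\<alpha> - \<kappa>) * (F z * 1)"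
      using Y nl alpha Fz by (intro mult_left_mono mult_mono) auto
    then show ?thesis using alpha by (simp add: abs_mult mult.assoc)
  qed
  have c: "\<bar>?X * (if snd l = snd k then nn z (fst k) (fst l) (snd k) else 0)\<bar> \<le> F z * (2 / d)"
    unfolding abs_mult using X nnb d Fz by (intro mult_mono) auto
  let ?U = "(if snd l = snd k then - \<alpha> * n z l * ?X else 0) + (\<alpha> - \<kappa>) * ?Y * n z l"
  have U: "\<bar>?U\<bar> \<le> \<alpha> * F z + (\<alpha> - \<kappa>) * F z" using a b by linarith
  have "\<bar>?U * n z k\<bar> \<le> (\<alpha> * F z + (\<alpha> - \<kappa>) * F z) * 1"
    unfolding abs_mult by (rule mult_mono[OF U nk]) (use alpha alpha_pos Fz in auto)
  then have "\<bar>?U * n z k + ?X * (if snd l = snd k then nn z (fst k) (fst l) (snd k) else 0)\<bar> \<le> (\<alpha> + (\<alpha> - \<kappa>) + 2 / d) * F z"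
    using c by (simp only: ring_distribs mult_1_right mult.commute[of "F z" "2 / d"])
  moreover have "F2 k l z = - \<kappa> * (?U * n z k + ?X * (if snd l = snd k then nn z (fst k) (fst l) (snd k) else 0))"
    unfolding F2_def by (simp only: ring_distribs mult.assoc minus_mult_left diff_conv_add_uminus)
  ultimately show "\<bar>F2 k l z\<bar> \<le> \<kappa> * (\<alpha> + (\<alpha> - \<kappa>) + 2 / d) * F z"
    using lam by (simp add: abs_mult mult.assoc)
  have "\<kappa> * (\<alpha> + (\<alpha> - \<kappa>) + 2 / d) \<le> \<kappa> * (1 + \<alpha> + (\<alpha> - \<kappa>) + 2 / d)"
    using lam by (intro mult_left_mono) auto
  then show "\<kappa> * (\<alpha> + (\<alpha> - \<kappa>) + 2 / d) \<le> 1 + \<kappa> * (1 + \<alpha> + (\<alpha> - \<kappa>) + 2 / d)" by linarith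
  show "0 \<le> \<kappa> * (\<alpha> + (\<alpha> - \<kappa>) + 2 / d)" using lam alpha alpha_pos d by simp
qed

text \<open>A single Gaussian array with index set \<open>{0..m} \<times> {0..N}\<close> drives both fields: the entries \<open>(i, j)\<close>
  with \<open>i, j \<ge> 1\<close> are the matrix, \<open>(0, 0)\<close> is the scalar compensating the variance of the matrix field, the
  column \<open>(i, 0)\<close> and the row \<open>(0, j)\<close> are the two vectors of the decoupled field.  The parameter runs
  from \<open>0\<close> (decoupled field) to \<open>pi / 2\<close> (matrix field).\<close>

definition B :: "real \<Rightarrow> nat \<times> (nat \<Rightarrow> real) \<Rightarrow> nat \<times> nat \<Rightarrow> real" where
  "B t k e = (if fst e \<noteq> fst k then 0
     else if (fst k = 0) = (snd e = 0) then sin t * (if snd e = 0 then 1 else snd k (snd e))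
     else cos t * (if snd e = 0 then 1 else snd k (snd e)))"

definition B' :: "real \<Rightarrow> nat \<times> (nat \<Rightarrow> real) \<Rightarrow> nat \<times> nat \<Rightarrow> real" where
  "B' t k e = (if fst e \<noteq> fst k then 0
     else if (fst k = 0) = (snd e = 0) then cos t * (if snd e = 0 then 1 else snd k (snd e))
     else - sin t * (if snd e = 0 then 1 else snd k (snd e)))"

lemma B_deriv: "((\<lambda>t. B t k e) has_real_derivative B' t k e) (at t)"
  unfolding B_def B'_def by (auto intro!: derivative_eq_intros)

lemma B_bound:
  assumes "k \<in> K" "e \<in> {0..m} \<times> {0..N}"
  shows "\<bar>B t k e\<bar> \<le> 1" "\<bar>B' t k e\<bar> \<le> 1"
proof -
  have h: "\<bar>if snd e = 0 then 1 else snd k (snd e)\<bar> \<le> 1"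
    using unit_vector_coord[OF unit[of "snd k"], of "snd e"] assms by auto
  have "\<bar>sin t * (if snd e = 0 then 1 else snd k (snd e))\<bar> \<le> 1 * 1"
    "\<bar>cos t * (if snd e = 0 then 1 else snd k (snd e))\<bar> \<le> 1 * 1"
    unfolding abs_mult by (rule mult_mono; use h in simp)+
  then show "\<bar>B t k e\<bar> \<le> 1" "\<bar>B' t k e\<bar> \<le> 1"
    unfolding B_def B'_def by auto
qed

section \<open>Covariances of the interpolating field and the sign of the derivative\<close>

definition ip where "ip h g = (\<Sum>j=1..N. h j * g j)"

lemma ip_self: "h \<in> T \<Longrightarrow> ip h h = 1"
  using unit[of h] by (simp add: ip_def power2_eq_square)

lemma ip_le_1: "h \<in> T \<Longrightarrow> g \<in> T \<Longrightarrow> ip h g \<le> 1"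
proof -
  assume "h \<in> T" "g \<in> T"
  have "0 \<le> (\<Sum>j=1..N. (h j - g j)\<^sup>2)" by (intro sum_nonneg) auto
  also have "\<dots> = (\<Sum>j=1..N. (h j)\<^sup>2) + (\<Sum>j=1..N. (g j)\<^sup>2) - 2 * ip h g"
    by (simp add: ip_def sum_distrib_left power2_diff sum.distrib sum_subtractf mult.assoc)
  finally show ?thesis using unit[of h] unit[of g] \<open>h \<in> T\<close> \<open>g \<in> T\<close> by simp
qed

lemma sum_over_row:
  assumes "i \<le> m" and "\<And>p j. p \<noteq> i \<Longrightarrow> f (p, j) = 0"
  shows "(\<Sum>e\<in>{0..m} \<times> {0..N}. f e) = f (i, 0) + (\<Sum>j=1..N. f (i, j) :: real)"
proof -
  have "(\<Sum>e\<in>{0..m} \<times> {0..N}. f e) = (\<Sum>p=0..m. \<Sum>j=0..N. f (p, j))"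
    by (simp add: sum.cartesian_product)
  also have "\<dots> = (\<Sum>p=0..m. if p = i then (\<Sum>j=0..N. f (i, j)) else 0)"
    by (rule sum.cong) (auto simp: assms(2))
  also have "\<dots> = (\<Sum>j=0..N. f (i, j))" using assms(1) by simp
  also have "\<dots> = f (i, 0) + (\<Sum>j=1..N. f (i, j))" by (simp add: sum.atLeast_Suc_atMost)
  finally show ?thesis .
qed

text \<open>Different rows of the array are independent, which removes \<open>i \<noteq> j\<close>.
  In row 0 the sine multiplies the scalar and the cosine the linear form in \<open>h\<close>; in the
  other rows the roles are exchanged, hence the opposite sign. The factor \<open>1 - ip h g\<close>
  is the difference of the covariances of the two endpoint fields.\<close>

lemma B_covariance:
  assumes "i \<le> m" "j \<le> m"
  shows "(\<Sum>e\<in>{0..m} \<times> {0..N}. B' t (i, h) e * B t (j, g) e)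
    = (if i \<noteq> j then 0 else if i = 0 then sin t * cos t * (1 - ip h g) else - (sin t * cos t * (1 - ip h g)))"
proof (cases "i = j")
  case True
  then show ?thesis
    by (subst sum_over_row[OF assms(1)])
       (auto simp: B_def B'_def ip_def sum_distrib_left algebra_simps sum_negf intro!: sum.cong)
next
  case False
  then show ?thesis by (subst sum_over_row[OF assms(1)]) (auto simp: B_def B'_def)
qed

text \<open>Gradients of the smoothed norm have length at most 1, so their inner products are at
  most 1; Cauchy-Schwarz is used in the form of the expanded square of a difference.\<close>

lemma normal_ip_le_1: "(\<Sum>i=1..m. n z (i, h) * n z (i, g)) \<le> 1"
proof -
  have unit: "(\<Sum>i=1..m. (n z (i, h))\<^sup>2) \<le> 1" for h
  proof -
    have "(\<Sum>i=1..m. (n z (i, h))\<^sup>2) = (\<Sum>i=1..m. (z (i, h))\<^sup>2) / (R z h)\<^sup>2"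
      by (simp add: n_def sum_divide_distrib power_divide)
    also have "\<dots> \<le> 1"
    proof -
      have "(\<Sum>i=1..m. (z (i, h))\<^sup>2) \<le> (R z h)\<^sup>2" by (simp add: R_sq)
      moreover have "0 < (R z h)\<^sup>2" using R_pos[of z h] by simp
      ultimately show ?thesis by (simp only: divide_le_eq_1 simp_thms)
    qed
    finally show ?thesis .
  qed
  have "0 \<le> (\<Sum>i=1..m. (n z (i, h) - n z (i, g))\<^sup>2)" by (intro sum_nonneg) auto
  also have "\<dots> = (\<Sum>i=1..m. (n z (i, h))\<^sup>2) + (\<Sum>i=1..m. (n z (i, g))\<^sup>2) - 2 * (\<Sum>i=1..m. n z (i, h) * n z (i, g))"
    by (simp add: sum_distrib_left power2_diff sum.distrib sum_subtractf mult.assoc)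
  finally show ?thesis using unit[of h] unit[of g] by simp
qed

text \<open>For different points only the term from the power of \<open>S z\<close> survives. Its
  coefficient \<open>- P\<close> is nonpositive by \<open>\<kappa> \<le> \<alpha>\<close>, and it
  multiplies \<open>1\<close> (the product of the two scalar gradients, both \<open>-1\<close>)
  minus the inner product of two gradients of length at most 1.\<close>

lemma F2_trace:
  assumes "h \<in> T" "g \<in> T" "h \<noteq> g"
  shows "F2 (0, h) (0, g) z - (\<Sum>i=1..m. F2 (i, h) (i, g) z) \<le> 0"
proof -
  define P where "P = \<kappa> * ((\<alpha> - \<kappa>) * (E z h * E z g * S z powr (\<kappa> / \<alpha> - 2)))"
  have P: "0 \<le> P" unfolding P_def using lam alpha E_pos[of z h] E_pos[of z g] by simp
  have F2: "F2 (i, h) (i, g) z = - P * (n z (i, h) * n z (i, g))" for i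
    using assms(3) by (auto simp: F2_def P_def)
  have "F2 (0, h) (0, g) z - (\<Sum>i=1..m. F2 (i, h) (i, g) z) = - P * (1 - (\<Sum>i=1..m. n z (i, h) * n z (i, g)))"
    unfolding F2 by (simp add: sum_distrib_left[symmetric] n_def[of _ "(0, _)"] algebra_simps sum_negf)
  also have "\<dots> \<le> 0" using P normal_ip_le_1[where z = z and h = h and g = g]
    by (simp add: mult_nonneg_nonneg)
  finally show ?thesis .
qed

text \<open>For \<open>h = g\<close> the coefficient \<open>1 - ip h g\<close> vanishes, since
  \<open>T\<close> consists of unit vectors; this is what disposes of the Hessian \<open>nn\<close>,
  which occurs only there. For \<open>h \<noteq> g\<close> it is nonnegative and
  \<open>F2_trace\<close> gives the sign.\<close>

lemma interpolation_sign:
  assumes "0 \<le> t" "t \<le> pi / 2"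
  shows "(\<Sum>k\<in>K. \<Sum>l\<in>K. (\<Sum>e\<in>{0..m} \<times> {0..N}. B' t k e * B t l e) * F2 k l z) \<le> 0"
proof -
  have sc: "0 \<le> sin t * cos t" using assms by (intro mult_nonneg_nonneg sin_ge_zero cos_ge_zero) auto
  define C where "C k l = (\<Sum>e\<in>{0..m} \<times> {0..N}. B' t k e * B t l e)" for k l
  have "(\<Sum>k\<in>K. \<Sum>l\<in>K. C k l * F2 k l z)
      = (\<Sum>h\<in>T. \<Sum>i=0..m. \<Sum>g\<in>T. \<Sum>j=0..m. C (i, h) (j, g) * F2 (i, h) (j, g) z)"
    unfolding sum_K ..
  also have "\<dots> = (\<Sum>h\<in>T. \<Sum>g\<in>T. \<Sum>i=0..m. \<Sum>j=0..m. C (i, h) (j, g) * F2 (i, h) (j, g) z)"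
    by (intro sum.cong refl sum.swap)
  also have "\<dots> = (\<Sum>h\<in>T. \<Sum>g\<in>T. sin t * cos t * (1 - ip h g) * (F2 (0, h) (0, g) z - (\<Sum>i=1..m. F2 (i, h) (i, g) z)))"
  proof (intro sum.cong refl)
    fix h g
    let ?q = "sin t * cos t * (1 - ip h g)"
    have "(\<Sum>i=0..m. \<Sum>j=0..m. C (i, h) (j, g) * F2 (i, h) (j, g) z)
        = (\<Sum>i=0..m. (if i = 0 then ?q else - ?q) * F2 (i, h) (i, g) z)"
    proof (rule sum.cong[OF refl])
      fix i assume i: "i \<in> {0..m}"
      have "(\<Sum>j=0..m. C (i, h) (j, g) * F2 (i, h) (j, g) z)
          = (\<Sum>j=0..m. if j = i then (if i = 0 then ?q else - ?q) * F2 (i, h) (i, g) z else 0)"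
        unfolding C_def using i by (intro sum.cong refl) (subst B_covariance, auto)
      then show "(\<Sum>j=0..m. C (i, h) (j, g) * F2 (i, h) (j, g) z) = (if i = 0 then ?q else - ?q) * F2 (i, h) (i, g) z"
        using i by simp
    qed
    also have "\<dots> = ?q * F2 (0, h) (0, g) z + (\<Sum>i=1..m. - ?q * F2 (i, h) (i, g) z)"
      unfolding sum_split0 by simp
    also have "\<dots> = ?q * (F2 (0, h) (0, g) z - (\<Sum>i=1..m. F2 (i, h) (i, g) z))"
      by (simp only: sum_distrib_left[symmetric]) (simp add: algebra_simps)
    finally show "(\<Sum>i=0..m. \<Sum>j=0..m. C (i, h) (j, g) * F2 (i, h) (j, g) z)
        = ?q * (F2 (0, h) (0, g) z - (\<Sum>i=1..m. F2 (i, h) (i, g) z))" .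
  qed
  also have "\<dots> \<le> 0"
  proof (intro sum_nonpos)
    fix h g assume hg: "h \<in> T" "g \<in> T"
    show "sin t * cos t * (1 - ip h g) * (F2 (0, h) (0, g) z - (\<Sum>i=1..m. F2 (i, h) (i, g) z)) \<le> 0"
    proof (cases "h = g")
      case True
      then show ?thesis using ip_self hg by simp
    next
      case False
      have "0 \<le> sin t * cos t * (1 - ip h g)" by (rule mult_nonneg_nonneg[OF sc]) (use ip_le_1[OF hg] in simp)
      then show ?thesis using F2_trace[OF hg False] by (rule mult_nonneg_nonpos)
    qed
  qed
  finally show ?thesis unfolding C_def .
qed

text \<open>As \<alpha> tends to infinity, the integrands tend to
  \<open>exp (- \<kappa> * min)\<close> with the minimum over \<open>T\<close>. The inequality is
  kept at finite \<alpha>, and the limit is taken only after both sides have been estimated.\<close>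

theorem gordon_comparison:
  "(\<integral>a. (\<Sum>h\<in>T. exp (- \<alpha> * (sqrt (d\<^sup>2 + (\<Sum>i=1..m. (\<Sum>j=1..N. h j * a (i, j))\<^sup>2)) - a (0, 0)))) powr (\<kappa> / \<alpha>) \<partial>gauss ({0..m} \<times> {0..N}))
   \<le> (\<integral>a. (\<Sum>h\<in>T. exp (- \<alpha> * (sqrt (d\<^sup>2 + (\<Sum>i=1..m. (a (i, 0))\<^sup>2)) - (\<Sum>j=1..N. h j * a (0, j))))) powr (\<kappa> / \<alpha>) \<partial>gauss ({0..m} \<times> {0..N}))"
proof -
  let ?I = "{0..m} \<times> {0..N}"
  have "(\<integral>a. F (\<lambda>k. \<Sum>e\<in>?I. B (pi / 2) k e * a e) \<partial>gauss ?I) \<le> (\<integral>a. F (\<lambda>k. \<Sum>e\<in>?I. B 0 k e * a e) \<partial>gauss ?I)"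
    by (rule gaussian_interpolation[where B' = B' and ?F1.0 = F1 and ?F2.0 = F2 and \<beta> = 1 and c = \<kappa> and C = bnd, OF _ finK])
       (use lam pi_ge_zero in \<open>simp_all only: F_le F1_le F2_le F_deriv F1_deriv F2_cont F_meas F1_meas F2_meas interpolation_sign
          B_deriv B_bound less_imp_le zero_le_one, auto\<close>)
  moreover have "F (\<lambda>k. \<Sum>e\<in>?I. B (pi / 2) k e * a e)
     = (\<Sum>h\<in>T. exp (- \<alpha> * (sqrt (d\<^sup>2 + (\<Sum>i=1..m. (\<Sum>j=1..N. h j * a (i, j))\<^sup>2)) - a (0, 0)))) powr (\<kappa> / \<alpha>)" for a
  proof -
    have "(\<Sum>e\<in>?I. B (pi / 2) (i, h) e * a e) = (\<Sum>j=1..N. h j * a (i, j))" if "i \<in> {1..m}" for i h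
      using that by (subst sum_over_row[of i]) (auto simp: B_def)
    moreover have "(\<Sum>e\<in>?I. B (pi / 2) (0, h) e * a e) = a (0, 0)" for h
      by (subst sum_over_row[of 0]) (auto simp: B_def)
    ultimately show ?thesis by (simp add: F_def S_def E_def R_def)
  qed
  moreover have "F (\<lambda>k. \<Sum>e\<in>?I. B 0 k e * a e)
     = (\<Sum>h\<in>T. exp (- \<alpha> * (sqrt (d\<^sup>2 + (\<Sum>i=1..m. (a (i, 0))\<^sup>2)) - (\<Sum>j=1..N. h j * a (0, j))))) powr (\<kappa> / \<alpha>)" for a
  proof -
    have "(\<Sum>e\<in>?I. B 0 (i, h) e * a e) = a (i, 0)" if "i \<in> {1..m}" for i h
      using that by (subst sum_over_row[of i]) (auto simp: B_def)
    moreover have "(\<Sum>e\<in>?I. B 0 (0, h) e * a e) = (\<Sum>j=1..N. h j * a (0, j))" for h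
      by (subst sum_over_row[of 0]) (auto simp: B_def)
    ultimately show ?thesis by (simp add: F_def S_def E_def R_def)
  qed
  ultimately show ?thesis by simp
qed

end

section \<open>Laplace transform of the norm of a Gaussian vector\<close>

text \<open>The shift by \<open>d\<close> makes the norm differentiable at the origin and its
  reciprocal bounded; the final estimate for the Laplace transform is free of
  \<open>d\<close>.\<close>

locale smooth_chi =
  fixes I :: "'i set" and d :: real
  assumes finI: "finite I" and d: "0 < d" and card: "1 \<le> card I"
begin

definition N :: "('i \<Rightarrow> real) \<Rightarrow> real" where
  "N a = sqrt (d\<^sup>2 + (\<Sum>i\<in>I. (a i)\<^sup>2))"

lemma N_sq: "(N a)\<^sup>2 = d\<^sup>2 + (\<Sum>i\<in>I. (a i)\<^sup>2)"
  unfolding N_def by (rule real_sqrt_pow2) (simp add: sum_nonneg add_nonneg_nonneg)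

lemma N_ge: "d \<le> N a"
proof -
  have "sqrt (d\<^sup>2) \<le> N a" unfolding N_def by (intro real_sqrt_le_mono) (simp add: sum_nonneg)
  then show ?thesis using d by simp
qed

lemma N_pos: "0 < N a" using N_ge[of a] d by linarith

lemma N_le: "N a \<le> d + (\<Sum>i\<in>I. \<bar>a i\<bar>)"
proof -
  have "N a \<le> sqrt (d\<^sup>2) + sqrt (\<Sum>i\<in>I. (a i)\<^sup>2)"
    unfolding N_def by (rule sqrt_add_le_add_sqrt) (auto intro: sum_nonneg)
  also have "sqrt (\<Sum>i\<in>I. (a i)\<^sup>2) \<le> (\<Sum>i\<in>I. \<bar>a i\<bar>)"
    using L2_set_le_sum_abs[of a I] by (simp add: L2_set_def)
  finally show ?thesis using d by simp
qed

lemma comp_le_N: "i \<in> I \<Longrightarrow> \<bar>a i\<bar> \<le> N a"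
proof -
  assume "i \<in> I"
  then have "(a i)\<^sup>2 \<le> (\<Sum>i\<in>I. (a i)\<^sup>2)" using finI by (intro member_le_sum) auto
  then have "(a i)\<^sup>2 \<le> (N a)\<^sup>2" by (simp add: N_sq add_increasing)
  then show ?thesis using N_pos[of a] by (metis abs_le_square_iff abs_of_pos)
qed

lemma N_meas [measurable]: "N \<in> borel_measurable (gauss I)"
  unfolding N_def by measurable

lemma N_deriv:
  assumes "i \<in> I"
  shows "((\<lambda>x. N (a(i := x))) has_real_derivative x / N (a(i := x))) (at x)"
proof -
  have eq: "N (a(i := x)) = sqrt (d\<^sup>2 + x\<^sup>2 + (\<Sum>j\<in>I - {i}. (a j)\<^sup>2))" for x
    unfolding N_def by (subst sum.remove[OF finI assms]) (simp add: add.assoc)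
  have "0 < d\<^sup>2 + x\<^sup>2 + (\<Sum>j\<in>I - {i}. (a j)\<^sup>2)"
    using d by (intro add_pos_nonneg sum_nonneg) auto
  moreover have "((\<lambda>x. d\<^sup>2 + x\<^sup>2 + (\<Sum>j\<in>I - {i}. (a j)\<^sup>2)) has_real_derivative 2 * x) (at x)"
    by (auto intro!: derivative_eq_intros)
  ultimately have "((\<lambda>x. sqrt (d\<^sup>2 + x\<^sup>2 + (\<Sum>j\<in>I - {i}. (a j)\<^sup>2))) has_real_derivative
     inverse (sqrt (d\<^sup>2 + x\<^sup>2 + (\<Sum>j\<in>I - {i}. (a j)\<^sup>2))) / 2 * (2 * x)) (at x)"
    by (rule DERIV_chain2[OF DERIV_real_sqrt])
  then show ?thesis unfolding eq
  proof (rule DERIV_cong)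
    have "inverse s / 2 * (2 * x) = x / s" for s :: real by (simp add: inverse_eq_divide)
    then show "inverse (sqrt (d\<^sup>2 + x\<^sup>2 + (\<Sum>j\<in>I - {i}. (a j)\<^sup>2))) / 2 * (2 * x)
      = x / sqrt (d\<^sup>2 + x\<^sup>2 + (\<Sum>j\<in>I - {i}. (a j)\<^sup>2))" .
  qed
qed

definition e :: "real \<Rightarrow> ('i \<Rightarrow> real) \<Rightarrow> real" where "e l a = exp (- l * N a)"

lemma e_pos: "0 < e l a" by (simp add: e_def)
lemma e_meas [measurable]: "e l \<in> borel_measurable (gauss I)" unfolding e_def by measurable

lemma e_le_1: "0 \<le> l \<Longrightarrow> e l a \<le> 1"
  using N_pos[of a] by (simp add: e_def)

text \<open>The range reaches down to \<open>- 1\<close> because the two-sided derivative of the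
  Laplace transform at \<open>0\<close> requires domination on a ball around
  \<open>0\<close>.\<close>

lemma Ne_bound:
  assumes "- 1 \<le> l"
  shows "N a * e l a \<le> exp (2 * d) * exp (2 * (\<Sum>i\<in>I. \<bar>a i\<bar>))" "e l a \<le> exp (2 * d) * exp (2 * (\<Sum>i\<in>I. \<bar>a i\<bar>))"
proof -
  have "- l * N a \<le> 1 * N a" using assms N_pos[of a] by (intro mult_right_mono) auto
  then have e: "e l a \<le> exp (N a)" by (simp add: e_def)
  have "N a \<le> exp (N a)" using exp_ge_add_one_self[of "N a"] by linarith
  then have "N a * e l a \<le> exp (N a) * exp (N a)" using e e_pos[of l a] by (intro mult_mono) auto
  also have "\<dots> = exp (2 * N a)" by (simp add: mult_exp_exp)
  also have "\<dots> \<le> exp (2 * d) * exp (2 * (\<Sum>i\<in>I. \<bar>a i\<bar>))"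
    using N_le[of a] by (simp add: mult_exp_exp)
  finally show "N a * e l a \<le> exp (2 * d) * exp (2 * (\<Sum>i\<in>I. \<bar>a i\<bar>))" .
  have "exp (N a) \<le> exp (2 * N a)" using N_pos[of a] by simp
  also have "\<dots> \<le> exp (2 * d) * exp (2 * (\<Sum>i\<in>I. \<bar>a i\<bar>))"
    using N_le[of a] by (simp add: mult_exp_exp)
  finally show "e l a \<le> exp (2 * d) * exp (2 * (\<Sum>i\<in>I. \<bar>a i\<bar>))" using e by simp
qed

lemma e_int: "- 1 \<le> l \<Longrightarrow> integrable (gauss I) (e l)"
  by (rule integrable_gauss_bound[OF finI e_meas, where C = "exp (2 * d)" and c = 2])
     (use Ne_bound(2) e_pos in \<open>simp add: less_imp_le abs_of_pos\<close>)

lemma Ne_int: "- 1 \<le> l \<Longrightarrow> integrable (gauss I) (\<lambda>a. N a * e l a)"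
  by (rule integrable_gauss_bound[OF finI, where C = "exp (2 * d)" and c = 2])
     (use Ne_bound(1) e_pos N_pos in \<open>auto simp: abs_mult abs_of_pos\<close>)

lemma eN_le: "0 \<le> l \<Longrightarrow> e l a / N a \<le> 1 / d"
  using N_ge[of a] e_le_1[of l a] e_pos[of l a] d by (intro frac_le) auto

lemma eN_int: "0 \<le> l \<Longrightarrow> integrable (gauss I) (\<lambda>a. e l a / N a)"
  by (rule integrable_gauss_bound[OF finI, where C = "1 / d" and c = 0])
     (use eN_le e_pos N_pos in \<open>auto simp: abs_divide abs_of_pos\<close>)

text \<open>Stein's identity for one component of a vector field of the form \<open>a / N a\<close>
  times the exponential weight. The field and its derivative are bounded, hence the growth rate 0 in
  both estimates.\<close>

lemma stein_chi:
  assumes l: "0 \<le> l" and i: "i \<in> I"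
  shows "(\<integral>a. a i * (a i * e l a / N a) \<partial>gauss I)
    = (\<integral>a. e l a / N a - (a i)\<^sup>2 * e l a * (l / (N a)\<^sup>2 + 1 / (N a)^3) \<partial>gauss I)"
    and "integrable (gauss I) (\<lambda>a. e l a / N a - (a i)\<^sup>2 * e l a * (l / (N a)\<^sup>2 + 1 / (N a)^3))"
proof -
  let ?f = "\<lambda>a. e l a / N a - (a i)\<^sup>2 * e l a * (l / (N a)\<^sup>2 + 1 / (N a)^3)"
  have C1: "\<bar>a i * e l a / N a\<bar> \<le> (1 + 2 / d + l) * exp (0 * (\<Sum>i\<in>I. \<bar>a i\<bar>))" for a
  proof -
    have "\<bar>a i\<bar> * e l a \<le> N a * 1" using comp_le_N[OF i] e_le_1[OF l] e_pos[of l a] N_pos[of a]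
      by (intro mult_mono) auto
    then have "\<bar>a i * e l a / N a\<bar> \<le> 1" using N_pos[of a] e_pos[of l a] by (simp add: abs_mult abs_divide divide_le_eq)
    moreover have "0 \<le> 2 / d" using d by simp
    ultimately show ?thesis using l by (simp only: mult_zero_left exp_zero mult_1_right)
  qed
  have C2: "\<bar>?f a\<bar> \<le> (1 + 2 / d + l) * exp (0 * (\<Sum>i\<in>I. \<bar>a i\<bar>))" for a
  proof -
    have N: "0 < N a" by (rule N_pos)
    have i2: "(a i)\<^sup>2 \<le> (N a)\<^sup>2" using comp_le_N[OF i, of a] N by (metis abs_le_square_iff abs_of_pos)
    have "(a i)\<^sup>2 * e l a * (l / (N a)\<^sup>2 + 1 / (N a)^3) \<le> (N a)\<^sup>2 * 1 * (l / (N a)\<^sup>2 + 1 / (N a)^3)"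
      using i2 e_le_1[OF l] e_pos[of l a] l N by (intro mult_mono) auto
    also have "\<dots> = l + 1 / N a" using N by (simp add: field_simps power2_eq_square power3_eq_cube)
    also have "\<dots> \<le> l + 1 / d" using N_ge[of a] d by (simp add: frac_le)
    finally have "(a i)\<^sup>2 * e l a * (l / (N a)\<^sup>2 + 1 / (N a)^3) \<le> l + 1 / d" .
    moreover have "0 \<le> (a i)\<^sup>2 * e l a * (l / (N a)\<^sup>2 + 1 / (N a)^3)" using l N e_pos[of l a] by simp
    moreover have "0 \<le> e l a / N a" using e_pos[of l a] N by simp
    moreover have "2 / d = 1 / d + 1 / d" by simp
    moreover have "0 \<le> 1 / d" using d by simp
    ultimately show ?thesis using eN_le[OF l, of a] l
      by (simp only: mult_zero_left exp_zero mult_1_right)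
  qed
  show "integrable (gauss I) ?f"
    by (rule integrable_gauss_bound[OF finI _ C2]) (use i in measurable)
  show "(\<integral>a. a i * (a i * e l a / N a) \<partial>gauss I) = (\<integral>a. ?f a \<partial>gauss I)"
  proof (rule gauss_stein_identity[OF finI i _ _ _ _ C1 C2])
    show "((\<lambda>x. (a(i := x)) i * e l (a(i := x)) / N (a(i := x))) has_real_derivative ?f (a(i := x))) (at x)" for a x
    proof -
      have N: "N (a(i := x)) \<noteq> 0" using N_pos[of "a(i := x)"] by simp
      have "((\<lambda>x. e l (a(i := x))) has_real_derivative e l (a(i := x)) * (- l * (x / N (a(i := x))))) (at x)"
        unfolding e_def by (intro DERIV_fun_exp DERIV_cmult N_deriv[OF i])
      from DERIV_divide[OF DERIV_mult[OF DERIV_ident this] N_deriv[OF i] N]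
      have "((\<lambda>x. x * e l (a(i := x)) / N (a(i := x))) has_real_derivative ?f (a(i := x))) (at x)"
      proof (rule DERIV_cong)
        have alg: "((1 * E + E * (- l * (x / n)) * x) * n - x * E * (x / n)) / (n * n)
            = E / n - x\<^sup>2 * E * (l / n\<^sup>2 + 1 / n^3)" if "n \<noteq> 0" for E n :: real
          using that by (simp add: divide_simps, Groebner_Basis.algebra)
        show "((1 * e l (a(i := x)) + e l (a(i := x)) * (- l * (x / N (a(i := x)))) * x) * N (a(i := x))
          - x * e l (a(i := x)) * (x / N (a(i := x)))) / (N (a(i := x)) * N (a(i := x))) = ?f (a(i := x))"
          unfolding fun_upd_same by (rule alg[OF N])
      qed
      then show ?thesis by (simp only: fun_upd_same)
    qed
    show "isCont (\<lambda>x. ?f (a(i := x))) x" for a x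
    proof -
      have N: "N (a(i := x)) \<noteq> 0" using N_pos[of "a(i := x)"] by simp
      have c: "isCont (\<lambda>x. N (a(i := x))) x" by (rule DERIV_isCont[OF N_deriv[OF i]])
      show ?thesis unfolding e_def fun_upd_same using N by (intro continuous_intros c) auto
    qed
  qed (use i in measurable)
qed

text \<open>Stein's identity for the field \<open>a / N a * exp (- l * N a)\<close> and the Cauchy-Schwarz inequality give
  \<open>R * (R + l) \<ge> card I - 1\<close> for the logarithmic derivative \<open>R\<close> of the Laplace transform.\<close>

lemma ratio_bound:
  assumes l: "0 \<le> l"
  shows "(sqrt (real (card I) - 1) - l / 2) * (\<integral>a. e l a \<partial>gauss I) \<le> (\<integral>a. N a * e l a \<partial>gauss I)"
proof -
  define f0 where "f0 = (\<integral>a. e l a \<partial>gauss I)"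
  define b where "b = (\<integral>a. N a * e l a \<partial>gauss I)"
  define w where "w = (\<integral>a. e l a / N a \<partial>gauss I)"
  have ints: "integrable (gauss I) (e l)" "integrable (gauss I) (\<lambda>a. N a * e l a)" "integrable (gauss I) (\<lambda>a. e l a / N a)"
    using l by (auto intro: e_int Ne_int eN_int)
  interpret prob_space "gauss I" by (rule prob_space_gauss)
  have f0_pos: "0 < f0"
    unfolding f0_def using ints(1) e_pos by (simp add: integral_less_AE_space[of "\<lambda>_. 0", simplified] emeasure_space_1)
  have "d * f0 \<le> b"
    unfolding f0_def b_def by (subst integral_mult_right_zero[symmetric], rule integral_mono)
      (use ints N_ge e_pos in \<open>auto intro!: mult_right_mono less_imp_le\<close>)
  then have b_pos: "0 < b" using mult_pos_pos[OF d f0_pos] by linarith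
  \<comment> \<open>Stein's identity summed over the coordinates. The inequality
    \<open>(\<Sum>i\<in>I. (a i)\<^sup>2) \<le> (N a)\<^sup>2\<close> enters twice: it bounds the
    sum of the left-hand sides by \<open>b\<close> from above, and the expected divergence by
    \<open>real (card I) * w - (l * f0 + w)\<close> from below.\<close>
  have "real (card I) * w - (l * f0 + w) \<le> b"
  proof -
    have "(\<Sum>i\<in>I. \<integral>a. a i * (a i * e l a / N a) \<partial>gauss I) \<le> b"
    proof -
      have int: "integrable (gauss I) (\<lambda>a. a i * (a i * e l a / N a))" if "i \<in> I" for i
      proof (rule Bochner_Integration.integrable_bound[OF ints(2)])
        show "AE a in gauss I. norm (a i * (a i * e l a / N a)) \<le> norm (N a * e l a)"
        proof (rule AE_I2)
          fix a
          have N: "0 < N a" by (rule N_pos)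
          have "(a i)\<^sup>2 \<le> (N a)\<^sup>2" using comp_le_N[OF that, of a] N by (metis abs_le_square_iff abs_of_pos)
          then have "(a i)\<^sup>2 / N a * e l a \<le> N a * e l a"
            using N e_pos[of l a] by (intro mult_right_mono) (auto simp: divide_le_eq power2_eq_square)
          moreover have "norm (a i * (a i * e l a / N a)) = (a i)\<^sup>2 / N a * e l a"
            using N e_pos[of l a] by (simp add: abs_mult abs_divide power2_eq_square[of "a i"])
          ultimately show "norm (a i * (a i * e l a / N a)) \<le> norm (N a * e l a)"
            using N e_pos[of l a] by simp
        qed
      qed (use that in measurable)
      have "(\<Sum>i\<in>I. \<integral>a. a i * (a i * e l a / N a) \<partial>gauss I) = (\<integral>a. (\<Sum>i\<in>I. a i * (a i * e l a / N a)) \<partial>gauss I)"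
        using int by simp
      also have "\<dots> \<le> b" unfolding b_def
      proof (rule integral_mono)
        fix a
        have N: "0 < N a" by (rule N_pos)
        have "(\<Sum>i\<in>I. a i * (a i * e l a / N a)) = (\<Sum>i\<in>I. (a i)\<^sup>2) * (e l a / N a)"
          by (simp only: sum_divide_distrib sum_distrib_right power2_eq_square mult.assoc times_divide_eq_right)
        also have "\<dots> \<le> (N a)\<^sup>2 * (e l a / N a)"
          using N e_pos[of l a] by (intro mult_right_mono) (auto simp: N_sq)
        finally show "(\<Sum>i\<in>I. a i * (a i * e l a / N a)) \<le> N a * e l a" using N by (simp add: power2_eq_square)
      qed (use int ints in auto)
      finally show ?thesis .
    qed
    moreover have "real (card I) * w - (l * f0 + w) \<le> (\<Sum>i\<in>I. \<integral>a. a i * (a i * e l a / N a) \<partial>gauss I)"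
    proof -
      have "real (card I) * w - (l * f0 + w) = (\<integral>a. real (card I) * (e l a / N a) - (l * e l a + e l a / N a) \<partial>gauss I)"
        unfolding w_def f0_def using ints by (simp del: times_divide_eq_right)
      also have "\<dots> \<le> (\<integral>a. (\<Sum>i\<in>I. e l a / N a - (a i)\<^sup>2 * e l a * (l / (N a)\<^sup>2 + 1 / (N a)^3)) \<partial>gauss I)"
      proof (rule integral_mono)
        fix a
        have N: "0 < N a" by (rule N_pos)
        have S: "(\<Sum>i\<in>I. (a i)\<^sup>2) \<le> (N a)\<^sup>2" by (simp add: N_sq)
        have "(\<Sum>i\<in>I. (a i)\<^sup>2) * (e l a * (l / (N a)\<^sup>2 + 1 / (N a)^3)) \<le> (N a)\<^sup>2 * (e l a * (l / (N a)\<^sup>2 + 1 / (N a)^3))"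
          using N e_pos[of l a] l by (intro mult_right_mono S mult_nonneg_nonneg add_nonneg_nonneg) auto
        also have "\<dots> = l * e l a + e l a / N a" using N by (simp add: divide_simps, Groebner_Basis.algebra)
        finally show "real (card I) * (e l a / N a) - (l * e l a + e l a / N a)
          \<le> (\<Sum>i\<in>I. e l a / N a - (a i)\<^sup>2 * e l a * (l / (N a)\<^sup>2 + 1 / (N a)^3))"
          by (simp add: sum_subtractf sum_distrib_right mult.assoc)
      qed (use ints stein_chi(2)[OF l] in \<open>auto simp del: times_divide_eq_right\<close>)
      also have "\<dots> = (\<Sum>i\<in>I. \<integral>a. e l a / N a - (a i)\<^sup>2 * e l a * (l / (N a)\<^sup>2 + 1 / (N a)^3) \<partial>gauss I)"
        by (rule Bochner_Integration.integral_sum) (rule stein_chi(2)[OF l])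
      also have "\<dots> = (\<Sum>i\<in>I. \<integral>a. a i * (a i * e l a / N a) \<partial>gauss I)"
        by (intro sum.cong refl stein_chi(1)[OF l, symmetric])
      finally show ?thesis .
    qed
    ultimately show ?thesis by linarith
  qed
  then have 1: "(real (card I) - 1) * w \<le> b + l * f0" by (simp add: algebra_simps)
  \<comment> \<open>Cauchy-Schwarz \<open>f0\<^sup>2 \<le> b * w\<close> by expanding
    \<open>(1 - k * N a)\<^sup>2 \<ge> 0\<close> with weight \<open>e l a / N a\<close>; this
    \<open>k\<close> maximises \<open>2 * k * f0 - k\<^sup>2 * b\<close>.\<close>
  define k where "k = f0 / b"
  have "2 * k * f0 - k\<^sup>2 * b \<le> w"
  proof -
    have "2 * k * f0 - k\<^sup>2 * b = (\<integral>a. 2 * k * e l a - k\<^sup>2 * (N a * e l a) \<partial>gauss I)"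
      unfolding f0_def b_def using ints by simp
    also have "\<dots> \<le> w" unfolding w_def
    proof (rule integral_mono)
      fix a
      have N: "0 < N a" by (rule N_pos)
      have "0 \<le> (1 - k * N a)\<^sup>2 * (e l a / N a)" using N e_pos[of l a] by simp
      also have "\<dots> = e l a / N a - (2 * k * e l a - k\<^sup>2 * (N a * e l a))"
        using N by (simp add: divide_simps, Groebner_Basis.algebra)
      finally show "2 * k * e l a - k\<^sup>2 * (N a * e l a) \<le> e l a / N a" by simp
    qed (use ints in auto)
    finally show ?thesis .
  qed
  moreover have "2 * k * f0 - k\<^sup>2 * b = f0\<^sup>2 / b" using b_pos unfolding k_def by (simp add: divide_simps, Groebner_Basis.algebra)
  ultimately have "f0\<^sup>2 / b \<le> w" by simp
  moreover have "0 \<le> real (card I) - 1" using card by simp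
  ultimately have "(real (card I) - 1) * (f0\<^sup>2 / b) \<le> (real (card I) - 1) * w" by (rule mult_left_mono)
  also note 1
  finally have "(real (card I) - 1) * (f0\<^sup>2 / b) \<le> b + l * f0" .
  then have 2: "(real (card I) - 1) * f0\<^sup>2 \<le> b * (b + l * f0)" using b_pos
    by (simp add: pos_divide_le_eq mult.commute)
  \<comment> \<open>Completing the square in \<open>b * (b + l * f0)\<close> permits taking roots;
    this is the origin of the shift \<open>l / 2\<close> here and of \<open>l\<^sup>2 / 4\<close>
    after integration.\<close>
  have "(sqrt (real (card I) - 1) * f0)\<^sup>2 \<le> (b + l / 2 * f0)\<^sup>2"
  proof -
    have "(sqrt (real (card I) - 1) * f0)\<^sup>2 = (real (card I) - 1) * f0\<^sup>2" using card by (simp add: power_mult_distrib)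
    also note 2
    also have "b * (b + l * f0) \<le> (b + l / 2 * f0)\<^sup>2"
    proof -
      have "(b + l / 2 * f0)\<^sup>2 = b * (b + l * f0) + (l / 2 * f0)\<^sup>2" by (simp add: power2_eq_square algebra_simps)
      then show ?thesis by simp
    qed
    finally show ?thesis .
  qed
  then have "sqrt (real (card I) - 1) * f0 \<le> b + l / 2 * f0"
    by (rule power2_le_imp_le) (use b_pos f0_pos l in auto)
  then show ?thesis unfolding f0_def b_def by (simp add: algebra_simps)
qed

text \<open>By \<open>ratio_bound\<close> the logarithmic derivative of the Laplace transform at
  \<open>t\<close> is at most \<open>- (q - t / 2)\<close>, with \<open>q\<close> the root of
  \<open>card I - 1\<close>. Thus the product with \<open>exp (t * q - t\<^sup>2 / 4)\<close> is
  nonincreasing, and it equals 1 at \<open>t = 0\<close>.\<close>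

theorem chi_laplace:
  assumes l: "0 \<le> l"
  shows "(\<integral>a. exp (- l * N a) \<partial>gauss I) \<le> exp (- l * sqrt (real (card I) - 1) + l\<^sup>2 / 4)"
proof -
  define \<phi> where "\<phi> t = (\<integral>a. e t a \<partial>gauss I)" for t
  define q where "q = sqrt (real (card I) - 1)"
  have der: "(\<phi> has_real_derivative - (\<integral>a. N a * e t a \<partial>gauss I)) (at t)" if "0 \<le> t" for t
  proof -
    have "(\<phi> has_real_derivative (\<integral>a. - (N a * e t a) \<partial>gauss I)) (at t)"
      unfolding \<phi>_def
    proof (rule has_real_derivative_integral[where r = 1 and w = "\<lambda>a. exp (2 * d) * exp (2 * (\<Sum>i\<in>I. \<bar>a i\<bar>))" and f' = "\<lambda>t a. - (N a * e t a)"])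
      fix s a assume "s \<in> ball t 1"
      then have s: "-1 \<le> s" using that by (auto simp: dist_real_def)
      show "integrable (gauss I) (e s)" by (rule e_int[OF s])
      show "((\<lambda>t. e t a) has_real_derivative - (N a * e s a)) (at s)"
        unfolding e_def by (auto intro!: derivative_eq_intros)
      show "\<bar>- (N a * e s a)\<bar> \<le> exp (2 * d) * exp (2 * (\<Sum>i\<in>I. \<bar>a i\<bar>))"
        using Ne_bound(1)[OF s] e_pos N_pos by (simp add: abs_mult abs_of_pos)
    next
      show "integrable (gauss I) (\<lambda>a. exp (2 * d) * exp (2 * (\<Sum>i\<in>I. \<bar>a i\<bar>)))"
        by (rule integrable_gauss_bound[OF finI, where C = "exp (2 * d)" and c = 2]) auto
    qed (use that in auto)
    then show ?thesis by simp
  qed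
  define g where "g t = \<phi> t * exp (t * q - t\<^sup>2 / 4)" for t
  have "g l \<le> g 0"
  proof (rule DERIV_nonpos_imp_nonincreasing[OF l])
    fix t assume t: "0 \<le> t" "t \<le> l"
    have "(g has_real_derivative (- (\<integral>a. N a * e t a \<partial>gauss I) + (q - t / 2) * \<phi> t) * exp (t * q - t\<^sup>2 / 4)) (at t)"
    proof -
      have "((\<lambda>t. exp (t * q - t\<^sup>2 / 4)) has_real_derivative exp (t * q - t\<^sup>2 / 4) * (q - t / 2)) (at t)"
        by (auto intro!: derivative_eq_intros)
      from DERIV_mult[OF der[OF t(1)] this] show ?thesis
        unfolding g_def by (rule DERIV_cong) (simp add: algebra_simps)
    qed
    moreover have "- (\<integral>a. N a * e t a \<partial>gauss I) + (q - t / 2) * \<phi> t \<le> 0"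
      using ratio_bound[OF t(1)] by (simp add: \<phi>_def q_def)
    ultimately show "\<exists>y. (g has_real_derivative y) (at t) \<and> y \<le> 0"
      by (meson exp_ge_zero mult_nonpos_nonneg)
  qed
  also have "g 0 = 1"
  proof -
    interpret prob_space "gauss I" by (rule prob_space_gauss)
    show ?thesis by (simp add: g_def \<phi>_def e_def prob_space)
  qed
  finally have "\<phi> l * exp (l * q - l\<^sup>2 / 4) \<le> 1" by (simp add: g_def)
  then have "\<phi> l \<le> exp (- (l * q - l\<^sup>2 / 4))"
    unfolding exp_minus inverse_eq_divide by (simp only: pos_le_divide_eq[OF exp_gt_zero])
  also have "- (l * q - l\<^sup>2 / 4) = - l * q + l\<^sup>2 / 4" by simp
  finally show ?thesis unfolding \<phi>_def e_def q_def .
qed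

end

section \<open>Exponential moments of squared distances to intervals\<close>

definition excess :: "real \<Rightarrow> real \<Rightarrow> real" where "excess t u = max 0 (u - t)"

lemma excess_nonneg: "0 \<le> excess t u" by (simp add: excess_def)
lemma excess_meas [measurable]: "excess t \<in> borel_measurable borel" unfolding excess_def by measurable

text \<open>Squaring removes the kink of the positive part: the difference quotient at the origin is
  at most \<open>\<bar>h\<bar>\<close>.\<close>

lemma max0_sq_deriv: "((\<lambda>x::real. (max 0 x)\<^sup>2) has_real_derivative 2 * max 0 x) (at x)"
proof -
  consider "x < 0" | "x = 0" | "x > 0" by linarith
  then show ?thesis
  proof cases
    case 1
    have "((\<lambda>x. 0) has_real_derivative 0) (at x)" by simp
    then have "((\<lambda>x::real. (max 0 x)\<^sup>2) has_real_derivative 0) (at x)"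
      by (rule has_field_derivative_transform_within_open[where S = "{..<0}"]) (use 1 in auto)
    then show ?thesis using 1 by simp
  next
    case 2
    have "((\<lambda>h::real. (max 0 h)\<^sup>2 / h) \<longlongrightarrow> 0) (at 0)"
    proof (rule Lim_null_comparison)
      show "\<forall>\<^sub>F h::real in at 0. norm ((max 0 h)\<^sup>2 / h) \<le> \<bar>h\<bar>"
        by (rule always_eventually) (auto simp: max_def power2_eq_square)
      show "((\<lambda>h::real. \<bar>h\<bar>) \<longlongrightarrow> 0) (at 0)" by (rule tendsto_rabs_zero) (rule tendsto_ident_at)
    qed
    then show ?thesis using 2 by (simp add: DERIV_def)
  next
    case 3
    have "((\<lambda>x. x\<^sup>2) has_real_derivative 2 * x) (at x)" by (auto intro!: derivative_eq_intros)
    then have "((\<lambda>x::real. (max 0 x)\<^sup>2) has_real_derivative 2 * x) (at x)"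
      by (rule has_field_derivative_transform_within_open[where S = "{0<..}"]) (use 3 in auto)
    then show ?thesis using 3 by simp
  qed
qed

lemma excess_sq_deriv_u: "((\<lambda>u. (excess t u)\<^sup>2) has_real_derivative 2 * excess t u) (at u)"
proof -
  have "((\<lambda>u. u - t) has_real_derivative 1) (at u)" by (auto intro!: derivative_eq_intros)
  from DERIV_chain2[OF max0_sq_deriv this] show ?thesis by (simp add: excess_def)
qed

lemma excess_sq_deriv_t: "((\<lambda>t. (excess t u)\<^sup>2) has_real_derivative - 2 * excess t u) (at t)"
proof -
  have "((\<lambda>t. u - t) has_real_derivative -1) (at t)" by (auto intro!: derivative_eq_intros)
  from DERIV_chain2[OF max0_sq_deriv this] show ?thesis by (simp add: excess_def)
qed

text \<open>The bound is uniform for \<open>t\<close> in a bounded range because differentiation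
  with respect to \<open>t\<close> under the integral needs a common dominating function. The cross
  term in \<open>(\<bar>u\<bar> + b)\<^sup>2\<close> is absorbed into the gap between
  \<open>q\<close> and \<open>s\<close>.\<close>

lemma exp_excess_growth:
  assumes "0 \<le> q" "q < 1/2"
  obtains C s where "0 \<le> C" "s < 1/2" "\<And>t u. \<bar>t\<bar> \<le> b \<Longrightarrow> exp (q * (excess t u)\<^sup>2) \<le> C * exp (s * u\<^sup>2)"
proof -
  define s where "s = (q + 1/2) / 2"
  have s: "q < s" "s < 1/2" using assms by (auto simp: s_def)
  define e where "e = s - q"
  have e: "0 < e" using s by (simp add: e_def)
  define C where "C = exp (q * b\<^sup>2 + q\<^sup>2 * b\<^sup>2 / e)"
  have "exp (q * (excess t u)\<^sup>2) \<le> C * exp (s * u\<^sup>2)" if t: "\<bar>t\<bar> \<le> b" for t u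
  proof -
    have "excess t u \<le> \<bar>u\<bar> + b" using t by (auto simp: excess_def)
    then have "(excess t u)\<^sup>2 \<le> (\<bar>u\<bar> + b)\<^sup>2" by (intro power_mono excess_nonneg)
    then have "q * (excess t u)\<^sup>2 \<le> q * (\<bar>u\<bar> + b)\<^sup>2" using assms by (intro mult_left_mono)
    also have "\<dots> = q * u\<^sup>2 + 2 * q * b * \<bar>u\<bar> + q * b\<^sup>2" by (simp add: power2_sum algebra_simps)
    also have "2 * q * b * \<bar>u\<bar> \<le> e * u\<^sup>2 + q\<^sup>2 * b\<^sup>2 / e"
    proof -
      have "0 \<le> (e * \<bar>u\<bar> - q * b)\<^sup>2 / e" using e by simp
      also have "\<dots> = e * u\<^sup>2 - 2 * q * b * \<bar>u\<bar> + q\<^sup>2 * b\<^sup>2 / e"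
        proof -
          have "(e * v - q * b)\<^sup>2 / e = e * v\<^sup>2 - 2 * q * b * v + q\<^sup>2 * b\<^sup>2 / e" for v
            using e by (simp add: divide_simps, Groebner_Basis.algebra)
          then show ?thesis by (simp only: power2_abs)
        qed
      finally show ?thesis by simp
    qed
    finally have "q * (excess t u)\<^sup>2 \<le> (q * b\<^sup>2 + q\<^sup>2 * b\<^sup>2 / e) + s * u\<^sup>2"
      by (simp add: e_def algebra_simps)
    then show ?thesis unfolding C_def mult_exp_exp by simp
  qed
  with s show ?thesis by (intro that[of C s]) (auto simp: C_def)
qed

lemma excess_exp_growth:
  assumes "0 \<le> q" "q < 1/2"
  obtains C s where "0 \<le> C" "s < 1/2" "\<And>t u. \<bar>t\<bar> \<le> b \<Longrightarrow> exp (q * (excess t u)\<^sup>2) \<le> C * exp (s * u\<^sup>2)"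
    "\<And>t u. \<bar>t\<bar> \<le> b \<Longrightarrow> excess t u * exp (q * (excess t u)\<^sup>2) \<le> C * exp (s * u\<^sup>2)"
proof -
  define e where "e = (1/2 - q) / 2"
  have e: "0 < e" "q + e < 1/2" using assms by (auto simp: e_def field_simps)
  obtain C s where Cs: "0 \<le> C" "s < 1/2" "\<And>t u. \<bar>t\<bar> \<le> b \<Longrightarrow> exp ((q + e) * (excess t u)\<^sup>2) \<le> C * exp (s * u\<^sup>2)"
    using exp_excess_growth[of "q + e" b] assms e by (auto simp: less_imp_le)
  have "1 \<le> 1 + 1 / e" using e by simp
  show ?thesis
  proof (rule that[of "(1 + 1 / e) * C" s])
    fix t u assume t: "\<bar>t\<bar> \<le> b"
    have "exp (q * (excess t u)\<^sup>2) \<le> 1 * exp ((q + e) * (excess t u)\<^sup>2)" using e by (simp add: mult_right_mono)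
    also have "\<dots> \<le> (1 + 1 / e) * (C * exp (s * u\<^sup>2))" by (rule mult_mono) (use e Cs t in auto)
    finally show "exp (q * (excess t u)\<^sup>2) \<le> (1 + 1 / e) * C * exp (s * u\<^sup>2)" by (simp only: mult.assoc)
    have "excess t u * exp (q * (excess t u)\<^sup>2) \<le> ((1 + 1 / e) * exp (e * (excess t u)\<^sup>2)) * exp (q * (excess t u)\<^sup>2)"
      using abs_le_exp_square[OF e(1), of "excess t u"] excess_nonneg[of t u] by (intro mult_right_mono) auto
    also have "\<dots> = (1 + 1 / e) * exp ((q + e) * (excess t u)\<^sup>2)" by (simp only: mult.assoc mult_exp_exp) (simp add: algebra_simps)
    also have "\<dots> \<le> (1 + 1 / e) * (C * exp (s * u\<^sup>2))" using e Cs t by (intro mult_left_mono) auto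
    finally show "excess t u * exp (q * (excess t u)\<^sup>2) \<le> (1 + 1 / e) * C * exp (s * u\<^sup>2)" by (simp only: mult.assoc)
  qed (use e Cs in auto)
qed

lemma excess_exp_int:
  assumes "0 \<le> q" "q < 1/2"
  shows "integrable std_gauss (\<lambda>u. exp (q * (excess t u)\<^sup>2))" "integrable std_gauss (\<lambda>u. excess t u * exp (q * (excess t u)\<^sup>2))"
    "integrable std_gauss (\<lambda>u. u * exp (q * (excess t u)\<^sup>2))"
proof -
  obtain C s where Cs: "0 \<le> C" "s < 1/2" "\<And>t' u. \<bar>t'\<bar> \<le> \<bar>t\<bar> \<Longrightarrow> exp (q * (excess t' u)\<^sup>2) \<le> C * exp (s * u\<^sup>2)"
    "\<And>t' u. \<bar>t'\<bar> \<le> \<bar>t\<bar> \<Longrightarrow> excess t' u * exp (q * (excess t' u)\<^sup>2) \<le> C * exp (s * u\<^sup>2)"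
    using excess_exp_growth[OF assms, of "\<bar>t\<bar>"] by blast
  show "integrable std_gauss (\<lambda>u. exp (q * (excess t u)\<^sup>2))"
    by (rule integrable_std_gauss_bound[of _ C s]) (use Cs in auto)
  show "integrable std_gauss (\<lambda>u. excess t u * exp (q * (excess t u)\<^sup>2))"
    by (rule integrable_std_gauss_bound[of _ C s]) (use Cs excess_nonneg in \<open>auto simp: abs_mult\<close>)
  show "integrable std_gauss (\<lambda>u. u * exp (q * (excess t u)\<^sup>2))"
    by (rule integrable_std_gauss_times[of _ C s]) (use Cs in auto)
qed

lemma excess_int: "integrable std_gauss (excess t)"
  using excess_exp_int(2)[of 0 t] by simp

lemma excess_sq_growth: "(excess t u)\<^sup>2 \<le> 4 * exp (1/4 * (excess t u)\<^sup>2)"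
proof -
  have "1/4 * (excess t u)\<^sup>2 \<le> exp (1/4 * (excess t u)\<^sup>2)"
    using exp_ge_add_one_self[of "1/4 * (excess t u)\<^sup>2"] by linarith
  then show ?thesis by simp
qed

lemma excess_sq_int: "integrable std_gauss (\<lambda>u. (excess t u)\<^sup>2)"
proof (rule Bochner_Integration.integrable_bound)
  show "integrable std_gauss (\<lambda>u. 4 * exp (1/4 * (excess t u)\<^sup>2))" using excess_exp_int(1)[of "1/4" t] by simp
  show "AE u in std_gauss. norm ((excess t u)\<^sup>2) \<le> norm (4 * exp (1/4 * (excess t u)\<^sup>2))" using excess_sq_growth by simp
qed measurable

lemma std_gauss_mean: "integrable std_gauss (\<lambda>u. u)" "(\<integral>u. u \<partial>std_gauss) = 0"
  using integrable_std_normal_moment[of 1] integral_std_normal_moment_odd[of 0]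
  by (auto simp: integrable_std_gauss_iff integral_std_gauss)

text \<open>Stein's identity for \<open>exp (q * (excess t u)\<^sup>2)\<close>, combined with the fact that this weight is \<open>1\<close> where the
  negative part of \<open>u - t\<close> is nonzero.\<close>

lemma tilted_mean_le:
  assumes "0 \<le> q" "q < 1/2"
  shows "(1 - 2 * q) * (\<integral>u. excess t u * exp (q * (excess t u)\<^sup>2) \<partial>std_gauss) \<le> (\<integral>u. excess t u \<partial>std_gauss) * (\<integral>u. exp (q * (excess t u)\<^sup>2) \<partial>std_gauss)"
proof -
  define E where "E u = exp (q * (excess t u)\<^sup>2)" for u
  note ints = excess_exp_int[OF assms, of t, folded E_def]
  define n where "n u = max 0 (t - u)" for u
  have n_int: "integrable std_gauss n"
  proof -
    have "n = (\<lambda>u. excess t u + t - u)" by (auto simp: n_def excess_def)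
    then show ?thesis using excess_int std_gauss_mean by simp
  qed
  have nE: "n u * E u = n u" for u by (cases "u \<le> t") (auto simp: n_def E_def excess_def)
  have dec: "u = excess t u - n u + t" for u by (auto simp: n_def excess_def)
  have stein: "(\<integral>u. u * E u \<partial>std_gauss) = (\<integral>u. 2 * q * (excess t u * E u) \<partial>std_gauss)"
  proof -
    obtain C s where Cs: "0 \<le> C" "s < 1/2" "\<And>t' u. \<bar>t'\<bar> \<le> \<bar>t\<bar> \<Longrightarrow> exp (q * (excess t' u)\<^sup>2) \<le> C * exp (s * u\<^sup>2)"
      "\<And>t' u. \<bar>t'\<bar> \<le> \<bar>t\<bar> \<Longrightarrow> excess t' u * exp (q * (excess t' u)\<^sup>2) \<le> C * exp (s * u\<^sup>2)"
      using excess_exp_growth[OF assms, of "\<bar>t\<bar>"] by blast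
    show ?thesis
    proof (rule stein_identity[of _ _ C s])
      show "(E has_real_derivative 2 * q * (excess t u * E u)) (at u)" for u
        unfolding E_def using DERIV_fun_exp[OF DERIV_cmult[OF excess_sq_deriv_u[of t u], of q]]
        by (simp add: mult_ac)
      show "isCont (\<lambda>u. 2 * q * (excess t u * E u)) u" for u
        unfolding E_def excess_def by (intro continuous_intros)
      show "\<bar>E u\<bar> \<le> C * exp (s * u\<^sup>2)" for u using Cs(3)[of t u] by (simp add: E_def)
      have "(2 * q) * (excess t u * E u) \<le> 1 * (C * exp (s * u\<^sup>2))" for u
        unfolding E_def by (rule mult_mono[OF _ Cs(4)]) (use assms excess_nonneg[of t u] in auto)
      then show "\<bar>2 * q * (excess t u * E u)\<bar> \<le> C * exp (s * u\<^sup>2)" for u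
        using assms excess_nonneg[of t u] by (simp add: E_def abs_mult mult.assoc)
    qed fact
  qed
  define Ep where "Ep = (\<integral>u. excess t u \<partial>std_gauss)"
  define En where "En = (\<integral>u. n u \<partial>std_gauss)"
  define EE where "EE = (\<integral>u. E u \<partial>std_gauss)"
  define EpE where "EpE = (\<integral>u. excess t u * E u \<partial>std_gauss)"
  have "u * E u = excess t u * E u - n u + t * E u" for u
  proof -
    have "u * E u = (excess t u - n u + t) * E u" using dec[of u] by simp
    also have "\<dots> = excess t u * E u - n u * E u + t * E u" by (simp only: ring_distribs)
    finally show ?thesis by (simp only: nE)
  qed
  then have 1: "EpE - En + t * EE = 2 * q * EpE"
    using stein ints n_int by (simp add: EpE_def En_def EE_def)
  have "(\<integral>u. excess t u - n u + t \<partial>std_gauss) = (\<integral>u. u \<partial>std_gauss)" by (simp only: dec[symmetric])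
  then have 2: "Ep - En + t = 0" using excess_int n_int std_gauss_mean(2) by (simp add: Ep_def En_def measure_std_gauss_UNIV)
  have 3: "0 \<le> En" unfolding En_def by (intro Bochner_Integration.integral_nonneg) (simp add: n_def)
  have 4: "1 \<le> EE"
  proof -
    have "(\<integral>u. 1 \<partial>std_gauss) \<le> EE" unfolding EE_def
      by (rule integral_mono) (use ints assms in \<open>auto simp: E_def[abs_def]\<close>)
    then show ?thesis by (simp add: measure_std_gauss_UNIV)
  qed
  have "(1 - 2 * q) * EpE = En - t * EE" using 1 by (simp add: algebra_simps)
  \<comment> \<open>Eliminating \<open>t\<close> through the mean of the decomposition of
    \<open>u\<close> isolates the term \<open>En * (EE - 1)\<close>, which is nonnegative because
    the weight is at least 1.\<close>
  also have "\<dots> = Ep * EE - En * (EE - 1)"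
  proof -
    have t: "t = En - Ep" using 2 by simp
    show ?thesis unfolding t by (simp add: algebra_simps)
  qed
  also have "\<dots> \<le> Ep * EE" using 3 4 by simp
  finally show ?thesis by (simp add: EpE_def Ep_def EE_def E_def)
qed

lemma excess_at_top:
  assumes "q < 1/2" "0 \<le> q"
  shows "((\<lambda>t. \<integral>u. exp (q * (excess t u)\<^sup>2) \<partial>std_gauss) \<longlongrightarrow> 1) at_top"
    and "((\<lambda>t. \<integral>u. (excess t u)\<^sup>2 \<partial>std_gauss) \<longlongrightarrow> 0) at_top"
proof -
  have ev: "\<forall>\<^sub>F t in at_top. excess t u = 0" for u
    using eventually_ge_at_top[of u] by eventually_elim (simp add: excess_def)
  have le: "excess t u \<le> excess 0 u" if "0 \<le> t" for t u using that by (simp add: excess_def)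
  have "((\<lambda>t. \<integral>u. exp (q * (excess t u)\<^sup>2) \<partial>std_gauss) \<longlongrightarrow> (\<integral>u. 1 \<partial>std_gauss)) at_top"
  proof (rule integral_dominated_convergence_at_top[where w = "\<lambda>u. exp (q * (excess 0 u)\<^sup>2)"])
    show "AE u in std_gauss. ((\<lambda>t. exp (q * (excess t u)\<^sup>2)) \<longlongrightarrow> 1) at_top"
      by (intro AE_I2 tendsto_eventually) (use ev in \<open>auto elim: eventually_mono\<close>)
    show "\<forall>\<^sub>F t in at_top. AE u in std_gauss. norm (exp (q * (excess t u)\<^sup>2)) \<le> exp (q * (excess 0 u)\<^sup>2)"
      using eventually_ge_at_top[of 0]
      by eventually_elim (auto intro!: AE_I2 mult_left_mono power_mono le excess_nonneg assms)
  qed (use excess_exp_int assms in auto)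
  then show "((\<lambda>t. \<integral>u. exp (q * (excess t u)\<^sup>2) \<partial>std_gauss) \<longlongrightarrow> 1) at_top"
    by (simp add: measure_std_gauss_UNIV)
  have "((\<lambda>t. \<integral>u. (excess t u)\<^sup>2 \<partial>std_gauss) \<longlongrightarrow> (\<integral>u. 0 \<partial>std_gauss)) at_top"
  proof (rule integral_dominated_convergence_at_top[where w = "\<lambda>u. (excess 0 u)\<^sup>2"])
    show "AE u in std_gauss. ((\<lambda>t. (excess t u)\<^sup>2) \<longlongrightarrow> 0) at_top"
      by (intro AE_I2 tendsto_eventually) (use ev in \<open>auto elim: eventually_mono\<close>)
    show "\<forall>\<^sub>F t in at_top. AE u in std_gauss. norm ((excess t u)\<^sup>2) \<le> (excess 0 u)\<^sup>2"
      using eventually_ge_at_top[of 0]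
      by eventually_elim (auto intro!: AE_I2 power_mono le excess_nonneg)
  qed (use excess_sq_int in auto)
  then show "((\<lambda>t. \<integral>u. (excess t u)\<^sup>2 \<partial>std_gauss) \<longlongrightarrow> 0) at_top" by simp
qed

text \<open>The difference of the two logarithms is monotone in \<open>t\<close> by \<open>tilted_mean_le\<close> and vanishes at infinity.\<close>

theorem excess_mgf:
  assumes q: "0 \<le> q" "q < 1/2"
  shows "(\<integral>u. exp (q * (excess t u)\<^sup>2) \<partial>std_gauss) \<le> exp (q / (1 - 2 * q) * (\<integral>u. (excess t u)\<^sup>2 \<partial>std_gauss))"
proof -
  define G where "G t = (\<integral>u. exp (q * (excess t u)\<^sup>2) \<partial>std_gauss)" for t
  define M where "M t = (\<integral>u. (excess t u)\<^sup>2 \<partial>std_gauss)" for t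
  define k where "k = q / (1 - 2 * q)"
  have G_ge: "1 \<le> G t" for t
  proof -
    have "(\<integral>u. 1 \<partial>std_gauss) \<le> G t" unfolding G_def
      by (rule integral_mono) (use excess_exp_int(1)[OF q, of t] q in auto)
    then show ?thesis by (simp add: measure_std_gauss_UNIV)
  qed
  have dG: "(G has_real_derivative (\<integral>u. - 2 * q * (excess t u * exp (q * (excess t u)\<^sup>2)) \<partial>std_gauss)) (at t)" for t
  proof -
    obtain C s where Cs: "0 \<le> C" "s < 1/2"
      "\<And>t' u. \<bar>t'\<bar> \<le> \<bar>t\<bar> + 1 \<Longrightarrow> exp (q * (excess t' u)\<^sup>2) \<le> C * exp (s * u\<^sup>2)"
      "\<And>t' u. \<bar>t'\<bar> \<le> \<bar>t\<bar> + 1 \<Longrightarrow> excess t' u * exp (q * (excess t' u)\<^sup>2) \<le> C * exp (s * u\<^sup>2)"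
      using excess_exp_growth[OF q, of "\<bar>t\<bar> + 1"] by blast
    show ?thesis unfolding G_def
    proof (rule has_real_derivative_integral[where r = 1 and w = "\<lambda>u. C * exp (s * u\<^sup>2)"])
      fix x u assume "x \<in> ball t 1"
      then have x: "\<bar>x\<bar> \<le> \<bar>t\<bar> + 1" by (auto simp: dist_real_def)
      show "integrable std_gauss (\<lambda>u. exp (q * (excess x u)\<^sup>2))" by (rule excess_exp_int[OF q])
      show "((\<lambda>t. exp (q * (excess t u)\<^sup>2)) has_real_derivative - 2 * q * (excess x u * exp (q * (excess x u)\<^sup>2))) (at x)"
        using DERIV_fun_exp[OF DERIV_cmult[OF excess_sq_deriv_t[of u x], of q]] by (simp add: mult_ac)
      have "(2 * q) * (excess x u * exp (q * (excess x u)\<^sup>2)) \<le> 1 * (C * exp (s * u\<^sup>2))"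
        by (rule mult_mono[OF _ Cs(4)[OF x]]) (use q excess_nonneg[of x u] in auto)
      then show "\<bar>- 2 * q * (excess x u * exp (q * (excess x u)\<^sup>2))\<bar> \<le> C * exp (s * u\<^sup>2)"
        using q excess_nonneg[of x u] by (simp add: abs_mult mult.assoc)
    next
      show "integrable std_gauss (\<lambda>u. C * exp (s * u\<^sup>2))" using integrable_std_gauss_exp_square[OF Cs(2)] by simp
    qed auto
  qed
  have dM: "(M has_real_derivative (\<integral>u. - 2 * excess t u \<partial>std_gauss)) (at t)" for t
    unfolding M_def
  proof (rule has_real_derivative_integral[where r = 1 and w = "\<lambda>u. 2 * (\<bar>u\<bar> + \<bar>t\<bar> + 1)"])
    fix x u assume "x \<in> ball t 1"
    then have x: "\<bar>x\<bar> \<le> \<bar>t\<bar> + 1" by (auto simp: dist_real_def)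
    show "integrable std_gauss (\<lambda>u. (excess x u)\<^sup>2)" by (rule excess_sq_int)
    show "((\<lambda>t. (excess t u)\<^sup>2) has_real_derivative - 2 * excess x u) (at x)" by (rule excess_sq_deriv_t)
    show "\<bar>- 2 * excess x u\<bar> \<le> 2 * (\<bar>u\<bar> + \<bar>t\<bar> + 1)" using x by (simp add: excess_def) (auto simp: max_def)
  next
    show "integrable std_gauss (\<lambda>u. 2 * (\<bar>u\<bar> + \<bar>t\<bar> + 1))" using std_gauss_mean by auto
  qed auto
  define H where "H t = k * M t - ln (G t)" for t
  have H_mono: "H y \<le> H x" if "x \<le> y" for x y
  proof (rule DERIV_nonpos_imp_nonincreasing[OF that])
    fix t
    let ?Ep = "\<integral>u. excess t u \<partial>std_gauss" and ?EpE = "\<integral>u. excess t u * exp (q * (excess t u)\<^sup>2) \<partial>std_gauss"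
    have G: "0 < G t" using G_ge[of t] by linarith
    have dG': "(G has_real_derivative - (2 * q * ?EpE)) (at t)"
      using dG[of t] by simp
    have dM': "(M has_real_derivative - (2 * ?Ep)) (at t)"
      using dM[of t] by simp
    have "(H has_real_derivative k * (- (2 * ?Ep)) - 1 / G t * - (2 * q * ?EpE)) (at t)"
      unfolding H_def
      by (intro DERIV_diff DERIV_cmult[OF dM'] DERIV_chain2[OF DERIV_ln_divide[OF G] dG'])
    moreover have "k * (- (2 * ?Ep)) - 1 / G t * - (2 * q * ?EpE) \<le> 0"
    proof -
      have "(1 - 2 * q) * ?EpE \<le> ?Ep * G t" unfolding G_def by (rule tilted_mean_le[OF q])
      then have "?EpE \<le> ?Ep * G t / (1 - 2 * q)" using q by (simp add: pos_le_divide_eq mult.commute)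
      then have "?EpE / G t \<le> ?Ep / (1 - 2 * q)" using G by (simp add: pos_divide_le_eq)
      then have "2 * q * (?EpE / G t) \<le> 2 * q * (?Ep / (1 - 2 * q))" using q by (intro mult_left_mono) auto
      then show ?thesis by (simp add: k_def mult_ac)
    qed
    ultimately show "\<exists>y. (H has_real_derivative y) (at t) \<and> y \<le> 0" by blast
  qed
  have "(H \<longlongrightarrow> k * 0 - ln 1) at_top"
    unfolding H_def G_def M_def
    by (intro tendsto_diff tendsto_mult tendsto_const tendsto_ln excess_at_top(1)[OF q(2,1)] excess_at_top(2)[OF q(2,1)]) simp
  then have "0 \<le> H t"
    by (intro tendsto_upperbound[of H _ at_top]) (auto intro: eventually_mono[OF eventually_ge_at_top[of t]] H_mono)
  then have "ln (G t) \<le> k * M t" by (simp add: H_def)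
  then have "exp (ln (G t)) \<le> exp (k * M t)" by simp
  moreover have "exp (ln (G t)) = G t" using G_ge[of t] by (intro exp_ln) linarith
  ultimately show ?thesis by (simp only: G_def M_def k_def)
qed

text \<open>For a squared standard normal variable, of mean 1, the logarithm of the moment
  generating function is \<open>- ln (1 - 2 * q) / 2\<close>, which is at most
  \<open>q / (1 - 2 * q)\<close>. The class asks for the same estimate scaled by the mean; in this
  form the bounds multiply over independent coordinates and only the sum of the means
  remains.\<close>

definition sub_chi_sq :: "(real \<Rightarrow> real) \<Rightarrow> bool" where
  "sub_chi_sq z \<longleftrightarrow> z \<in> borel_measurable borel \<and> (\<forall>u. 0 \<le> z u) \<and> integrable std_gauss z \<and>
     (\<forall>q. 0 \<le> q \<and> q < 1/2 \<longrightarrow> integrable std_gauss (\<lambda>u. exp (q * z u)) \<and>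
        (\<integral>u. exp (q * z u) \<partial>std_gauss) \<le> exp (q / (1 - 2 * q) * (\<integral>u. z u \<partial>std_gauss)))"

lemma sub_chi_sqD:
  assumes "sub_chi_sq z"
  shows "z \<in> borel_measurable borel" "0 \<le> z u" "integrable std_gauss z"
    "0 \<le> q \<Longrightarrow> q < 1/2 \<Longrightarrow> integrable std_gauss (\<lambda>u. exp (q * z u))"
    "0 \<le> q \<Longrightarrow> q < 1/2 \<Longrightarrow> (\<integral>u. exp (q * z u) \<partial>std_gauss) \<le> exp (q / (1 - 2 * q) * (\<integral>u. z u \<partial>std_gauss))"
  using assms by (auto simp: sub_chi_sq_def)

lemma sub_chi_sq_excess: "sub_chi_sq (\<lambda>u. (excess t u)\<^sup>2)"
  unfolding sub_chi_sq_def using excess_sq_int excess_exp_int(1) excess_mgf by auto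

lemma std_normal_density_minus: "std_normal_density (- x) = std_normal_density x"
  by (simp add: std_normal_density_def)

lemma integral_std_gauss_reflect:
  assumes [measurable]: "f \<in> borel_measurable borel"
  shows "(\<integral>u. f (- u) \<partial>std_gauss) = (\<integral>u. f u \<partial>std_gauss)" "integrable std_gauss f \<Longrightarrow> integrable std_gauss (\<lambda>u. f (- u) :: real)"
proof -
  let ?g = "\<lambda>x. std_normal_density x * f x"
  have "(\<integral>x. ?g x \<partial>lborel) = (\<integral>x. ?g (- x) \<partial>lborel)"
    using lborel_integral_real_affine[of "-1" ?g 0] by simp
  then show "(\<integral>u. f (- u) \<partial>std_gauss) = (\<integral>u. f u \<partial>std_gauss)"
    by (simp add: integral_std_gauss std_normal_density_minus)
  show "integrable std_gauss (\<lambda>u. f (- u))" if "integrable std_gauss f"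
    using lborel_integrable_real_affine[of ?g "-1" 0] that
    by (simp add: integrable_std_gauss_iff std_normal_density_minus)
qed

lemma sub_chi_sq_reflect:
  assumes "sub_chi_sq z"
  shows "sub_chi_sq (\<lambda>u. z (- u))"
proof -
  note z = sub_chi_sqD[OF assms]
  note [measurable] = z(1)
  show ?thesis
    unfolding sub_chi_sq_def
  proof (intro conjI allI impI)
    fix q :: real assume q: "0 \<le> q \<and> q < 1/2"
    show "integrable std_gauss (\<lambda>u. exp (q * z (- u)))"
      using integral_std_gauss_reflect(2)[of "\<lambda>u. exp (q * z u)"] z(4) q by simp
    show "(\<integral>u. exp (q * z (- u)) \<partial>std_gauss) \<le> exp (q / (1 - 2 * q) * (\<integral>u. z (- u) \<partial>std_gauss))"
      using integral_std_gauss_reflect(1)[of "\<lambda>u. exp (q * z u)"] integral_std_gauss_reflect(1)[of z] z(5) q by simp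
  qed (use z integral_std_gauss_reflect(2)[of z] in auto)
qed

text \<open>Where one summand vanishes, \<open>exp (q * (y u + z u))\<close> equals
  \<open>exp (q * y u) + exp (q * z u) - 1\<close>. With means \<open>Y\<close> and
  \<open>Z\<close>, both at least 1, the result follows from \<open>Y + Z - 1 \<le> Y * Z\<close>.
  This assembles two-sided distances from one-sided excesses.\<close>

lemma sub_chi_sq_add:
  assumes "sub_chi_sq y" "sub_chi_sq z" and disj: "\<And>u. y u = 0 \<or> z u = 0"
  shows "sub_chi_sq (\<lambda>u. y u + z u)"
proof -
  note y = sub_chi_sqD[OF assms(1)] and z = sub_chi_sqD[OF assms(2)]
  note [measurable] = y(1) z(1)
  show ?thesis
    unfolding sub_chi_sq_def
  proof (intro conjI allI impI)
    fix q :: real assume q: "0 \<le> q \<and> q < 1/2"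
    have e: "exp (q * (y u + z u)) = exp (q * y u) + exp (q * z u) - 1" for u
      using disj[of u] by auto
    show "integrable std_gauss (\<lambda>u. exp (q * (y u + z u)))"
      unfolding e using y(4) z(4) q by auto
    define Y where "Y = (\<integral>u. exp (q * y u) \<partial>std_gauss)"
    define Z where "Z = (\<integral>u. exp (q * z u) \<partial>std_gauss)"
    have "(\<integral>u. 1 \<partial>std_gauss) \<le> Y" "(\<integral>u. 1 \<partial>std_gauss) \<le> Z" unfolding Y_def Z_def
      by (intro integral_mono; use y(2,4) z(2,4) q in simp)+
    then have "1 \<le> Y" "1 \<le> Z" by simp_all
    then have "0 \<le> (Y - 1) * (Z - 1)" by simp
    then have "Y + Z - 1 \<le> Y * Z" by (simp add: algebra_simps)
    also have "\<dots> \<le> exp (q / (1 - 2 * q) * (\<integral>u. y u \<partial>std_gauss)) * exp (q / (1 - 2 * q) * (\<integral>u. z u \<partial>std_gauss))"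
      unfolding Y_def Z_def using q by (intro mult_mono y(5) z(5) Bochner_Integration.integral_nonneg) auto
    also have "\<dots> = exp (q / (1 - 2 * q) * (\<integral>u. y u + z u \<partial>std_gauss))"
      using y(3) z(3) by (simp add: mult_exp_exp distrib_left)
    finally show "(\<integral>u. exp (q * (y u + z u)) \<partial>std_gauss) \<le> exp (q / (1 - 2 * q) * (\<integral>u. y u + z u \<partial>std_gauss))"
      unfolding e Y_def Z_def using y(4)[of q] z(4)[of q] q by simp
  qed (use y z in auto)
qed

text \<open>The square root is replaced by its tangent at \<open>r\<^sup>2\<close> with \<open>r = l + sqrt M\<close>, the optimal choice.\<close>

theorem sqrt_sum_mgf:
  fixes z :: "'i \<Rightarrow> real \<Rightarrow> real"
  assumes I: "finite I" and z: "\<And>i. i \<in> I \<Longrightarrow> sub_chi_sq (z i)"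
    and M: "0 < M" "(\<Sum>i\<in>I. \<integral>u. z i u \<partial>std_gauss) \<le> M" and l: "0 < l"
  shows "integrable (gauss I) (\<lambda>a. exp (l * sqrt (\<Sum>i\<in>I. z i (a i))))" (is ?int)
    and "(\<integral>a. exp (l * sqrt (\<Sum>i\<in>I. z i (a i))) \<partial>gauss I) \<le> exp (l * sqrt M + l\<^sup>2 / 2)" (is ?le)
proof -
  note zD = sub_chi_sqD[OF z]
  have [measurable]: "(\<lambda>a. z i (a i)) \<in> borel_measurable (gauss I)" if "i \<in> I" for i
    using zD(1)[OF that] that by measurable
  define r where "r = l + sqrt M"
  define q where "q = l / (2 * r)"
  have r: "l < r" "0 < r" using l M by (auto simp: r_def add_pos_pos)
  have q: "0 \<le> q" "q < 1/2" using l r by (auto simp: q_def field_simps)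
  have S0: "0 \<le> (\<Sum>i\<in>I. z i (a i))" for a using zD(2) by (intro sum_nonneg) auto
  have pt: "exp (l * sqrt (\<Sum>i\<in>I. z i (a i))) \<le> exp (l * r / 2) * (\<Prod>i\<in>I. exp (q * z i (a i)))" for a
  proof -
    let ?S = "\<Sum>i\<in>I. z i (a i)"
    have "0 \<le> (sqrt ?S - r)\<^sup>2" by simp
    then have "2 * r * sqrt ?S \<le> r\<^sup>2 + ?S" using S0[of a] by (simp add: power2_diff mult_ac add.commute)
    then have "(l / (2 * r)) * (2 * r * sqrt ?S) \<le> (l / (2 * r)) * (r\<^sup>2 + ?S)"
      using l r by (intro mult_left_mono) auto
    moreover have "(l / (2 * r)) * (2 * r * sqrt ?S) = l * sqrt ?S" using r by simp
    moreover have "(l / (2 * r)) * (r\<^sup>2 + ?S) = l * r / 2 + q * ?S"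
      using r by (simp add: q_def distrib_left power2_eq_square)
    ultimately have "l * sqrt ?S \<le> l * r / 2 + q * ?S" by simp
    then have "exp (l * sqrt ?S) \<le> exp (l * r / 2) * exp (q * ?S)" by (simp add: mult_exp_exp)
    then show ?thesis using I by (simp add: exp_sum sum_distrib_left)
  qed
  have pint: "integrable (gauss I) (\<lambda>a. \<Prod>i\<in>I. exp (q * z i (a i)))"
    by (rule std_gauss_prod.product_integrable_prod[OF I]) (use zD(4) q in auto)
  show int: ?int
  proof (rule Bochner_Integration.integrable_bound)
    show "integrable (gauss I) (\<lambda>a. exp (l * r / 2) * (\<Prod>i\<in>I. exp (q * z i (a i))))" using pint by simp
    show "AE a in gauss I. norm (exp (l * sqrt (\<Sum>i\<in>I. z i (a i)))) \<le> norm (exp (l * r / 2) * (\<Prod>i\<in>I. exp (q * z i (a i))))"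
      by (rule AE_I2) (use pt in \<open>auto simp: abs_mult abs_prod\<close>)
  qed measurable
  have "(\<integral>a. exp (l * sqrt (\<Sum>i\<in>I. z i (a i))) \<partial>gauss I) \<le> (\<integral>a. exp (l * r / 2) * (\<Prod>i\<in>I. exp (q * z i (a i))) \<partial>gauss I)"
    by (rule integral_mono[OF int]) (use pint pt in auto)
  also have "\<dots> = exp (l * r / 2) * (\<Prod>i\<in>I. \<integral>u. exp (q * z i u) \<partial>std_gauss)"
    using std_gauss_prod.product_integral_prod[OF I, of "\<lambda>i u. exp (q * z i u)"] zD(4) q by simp
  also have "\<dots> \<le> exp (l * r / 2) * (\<Prod>i\<in>I. exp (q / (1 - 2 * q) * (\<integral>u. z i u \<partial>std_gauss)))"
    using zD(5) q by (intro mult_left_mono prod_mono) (auto intro: Bochner_Integration.integral_nonneg)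
  also have "\<dots> = exp (l * r / 2) * exp (q / (1 - 2 * q) * (\<Sum>i\<in>I. \<integral>u. z i u \<partial>std_gauss))"
    using I by (simp add: exp_sum sum_distrib_left)
  also have "\<dots> \<le> exp (l * r / 2) * exp (q / (1 - 2 * q) * M)"
  proof -
    have "q / (1 - 2 * q) * (\<Sum>i\<in>I. \<integral>u. z i u \<partial>std_gauss) \<le> q / (1 - 2 * q) * M"
      using q by (intro mult_left_mono M divide_nonneg_nonneg) auto
    then show ?thesis by simp
  qed
  also have "\<dots> = exp (l * sqrt M + l\<^sup>2 / 2)"
  proof -
    \<comment> \<open>With this value \<open>q / (1 - 2 * q) * M\<close> becomes
      \<open>l * sqrt M / 2\<close>; the other half of \<open>l * sqrt M\<close>, together with
      \<open>l\<^sup>2 / 2\<close>, comes from the prefactor \<open>exp (l * r / 2)\<close>.\<close>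
    have "1 - 2 * q = sqrt M / r" using r by (simp add: q_def r_def field_simps)
    then have "q / (1 - 2 * q) = l / (2 * sqrt M)" using r M by (simp add: q_def)
    then have "q / (1 - 2 * q) * M = l / 2 * (M / sqrt M)" by simp
    also have "M / sqrt M = sqrt M" using M by (simp add: real_div_sqrt)
    finally have "q / (1 - 2 * q) * M = l / 2 * sqrt M" .
    then show ?thesis by (simp only: mult_exp_exp) (simp add: r_def algebra_simps power2_eq_square add_divide_distrib)
  qed
  finally show ?le .
qed

section \<open>Exponential moment of a normal variable and independence of disjoint blocks\<close>

lemma integral_exp_std_gauss: "integrable std_gauss (\<lambda>u. exp (l * u))" "(\<integral>u. exp (l * u) \<partial>std_gauss) = exp (l\<^sup>2 / 2)"
proof -
  have e: "std_normal_density x * exp (l * x) = exp (l\<^sup>2 / 2) * normal_density l 1 x" for x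
  proof -
    have "l * x - x\<^sup>2 / 2 = l\<^sup>2 / 2 - (x - l)\<^sup>2 / 2"
      by (simp add: power2_diff field_simps)
    then show ?thesis by (simp add: std_normal_density_def normal_density_def mult_exp_exp)
  qed
  show "integrable std_gauss (\<lambda>u. exp (l * u))" by (simp add: integrable_std_gauss_iff e)
  show "(\<integral>u. exp (l * u) \<partial>std_gauss) = exp (l\<^sup>2 / 2)" by (simp add: integral_std_gauss e)
qed

text \<open>The two functions take arrays on the whole index type and are constrained by
  \<open>f_dep\<close> and \<open>g_dep\<close> to look at their own block only; the same function
  can thus be integrated over products with different index sets.\<close>

lemma gauss_integral_indep:
  fixes f g :: "('i \<Rightarrow> real) \<Rightarrow> real"
  assumes I: "finite I" and J: "finite J" and disj: "I \<inter> J = {}"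
    and f: "integrable (gauss I) f" and g: "integrable (gauss J) g"
    and f_dep: "\<And>a b. (\<And>i. i \<in> I \<Longrightarrow> a i = b i) \<Longrightarrow> f a = f b"
    and g_dep: "\<And>a b. (\<And>i. i \<in> J \<Longrightarrow> a i = b i) \<Longrightarrow> g a = g b"
  shows "integrable (gauss (I \<union> J)) (\<lambda>a. f a * g a)"
    and "(\<integral>a. f a * g a \<partial>gauss (I \<union> J)) = (\<integral>a. f a \<partial>gauss I) * (\<integral>a. g a \<partial>gauss J)"
proof -
  interpret PI: prob_space "gauss I" by (rule prob_space_gauss)
  interpret PJ: prob_space "gauss J" by (rule prob_space_gauss)
  interpret P: pair_sigma_finite "gauss I" "gauss J" ..
  have m: "f (merge I J (x, y)) = f x" "g (merge I J (x, y)) = g y" for x y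
    using disj by (auto intro!: f_dep g_dep simp: merge_def)
  have fm [measurable]: "f \<in> borel_measurable (gauss I)" and gm [measurable]: "g \<in> borel_measurable (gauss J)"
    using f g by auto
  have fm': "(\<lambda>a. f a) \<in> borel_measurable (gauss (I \<union> J))"
  proof -
    have "(\<lambda>a. f (restrict a I)) \<in> borel_measurable (gauss (I \<union> J))"
      by (rule measurable_compose[OF measurable_restrict_subset fm]) auto
    also have "(\<lambda>a. f (restrict a I)) = f" by (auto intro!: ext f_dep)
    finally show ?thesis .
  qed
  have gm': "(\<lambda>a. g a) \<in> borel_measurable (gauss (I \<union> J))"
  proof -
    have "(\<lambda>a. g (restrict a J)) \<in> borel_measurable (gauss (I \<union> J))"
      by (rule measurable_compose[OF measurable_restrict_subset gm]) auto
    also have "(\<lambda>a. g (restrict a J)) = g" by (auto intro!: ext g_dep)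
    finally show ?thesis .
  qed
  have "integrable (gauss I \<Otimes>\<^sub>M gauss J) (\<lambda>p. f (fst p) * g (snd p))"
    using f g by (intro P.Fubini_integrable) (auto simp: abs_mult)
  then have "integrable (gauss I \<Otimes>\<^sub>M gauss J) (\<lambda>p. f (merge I J p) * g (merge I J p))"
  proof -
    have "(\<lambda>p. f (merge I J p) * g (merge I J p)) = (\<lambda>p. f (fst p) * g (snd p))"
      using m by (auto simp: fun_eq_iff)
    with \<open>integrable (gauss I \<Otimes>\<^sub>M gauss J) (\<lambda>p. f (fst p) * g (snd p))\<close> show ?thesis by simp
  qed
  then have "integrable (distr (gauss I \<Otimes>\<^sub>M gauss J) (gauss (I \<union> J)) (merge I J)) (\<lambda>a. f a * g a)"
    using fm' gm' by (subst integrable_distr_eq) auto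
  then show int: "integrable (gauss (I \<union> J)) (\<lambda>a. f a * g a)"
    using std_gauss_prod.distr_merge[OF disj I J] by simp
  have "(\<integral>a. f a * g a \<partial>gauss (I \<union> J)) = (\<integral>x. (\<integral>y. f x * g y \<partial>gauss J) \<partial>gauss I)"
    using std_gauss_prod.product_integral_fold[OF disj I J int] by (simp add: m)
  then show "(\<integral>a. f a * g a \<partial>gauss (I \<union> J)) = (\<integral>a. f a \<partial>gauss I) * (\<integral>a. g a \<partial>gauss J)" by simp
qed

section \<open>Kernels of Gaussian matrices\<close>

text \<open>Round every coordinate down to a multiple of \<open>r\<close> and keep one point of
  \<open>U\<close> per nonempty cell. Choosing representatives inside \<open>U\<close> matters: the
  points of the net have to be unit vectors satisfying the bound on the support function.\<close>

lemma finite_net: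
  fixes U :: "(nat \<Rightarrow> real) set"
  assumes U: "\<And>h j. h \<in> U \<Longrightarrow> j \<in> {1..N} \<Longrightarrow> \<bar>h j\<bar> \<le> 1" and r: "0 < r"
  obtains T where "finite T" "T \<subseteq> U" "\<And>h. h \<in> U \<Longrightarrow> \<exists>g\<in>T. \<forall>j\<in>{1..N}. \<bar>h j - g j\<bar> \<le> r"
proof -
  define cell where "cell h = restrict (\<lambda>j. \<lfloor>h j / r\<rfloor>) {1..N}" for h :: "nat \<Rightarrow> real"
  have "cell ` U \<subseteq> (\<Pi>\<^sub>E j\<in>{1..N}. {\<lfloor>- 1 / r\<rfloor>..\<lfloor>1 / r\<rfloor>})"
  proof (rule image_subsetI)
    fix h assume h: "h \<in> U"
    have "- 1 / r \<le> h j / r \<and> h j / r \<le> 1 / r" if "j \<in> {1..N}" for j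
    proof -
      have "- 1 \<le> h j" "h j \<le> 1" using U[OF h that] by auto
      then show ?thesis using r by (intro conjI divide_right_mono) auto
    qed
    then show "cell h \<in> (\<Pi>\<^sub>E j\<in>{1..N}. {\<lfloor>- 1 / r\<rfloor>..\<lfloor>1 / r\<rfloor>})"
      by (auto simp: cell_def intro!: floor_mono)
  qed
  then have fin: "finite (cell ` U)"
    by (rule finite_subset) (intro finite_PiE; simp)
  show ?thesis
  proof (rule that[of "inv_into U cell ` cell ` U"])
    show "inv_into U cell ` cell ` U \<subseteq> U" by (auto intro: inv_into_into)
    fix h assume h: "h \<in> U"
    define g where "g = inv_into U cell (cell h)"
    have "cell g = cell h" unfolding g_def using h by (intro f_inv_into_f[of "cell h" cell U]) auto
    then have fl: "\<lfloor>g j / r\<rfloor> = \<lfloor>h j / r\<rfloor>" if "j \<in> {1..N}" for j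
    proof -
      have "cell g j = cell h j" using \<open>cell g = cell h\<close> by (simp only:)
      then show ?thesis using that by (simp add: cell_def)
    qed
    have "\<bar>h j / r - g j / r\<bar> < 1" if "j \<in> {1..N}" for j
      using floor_correct[of "h j / r"] floor_correct[of "g j / r"] fl[OF that] by linarith
    then have "\<bar>h j - g j\<bar> \<le> r" if "j \<in> {1..N}" for j
      using that r by (simp add: diff_divide_distrib[symmetric] abs_divide pos_divide_less_eq less_imp_le)
    moreover have "g \<in> inv_into U cell ` cell ` U" unfolding g_def using h by auto
    ultimately show "\<exists>g\<in>inv_into U cell ` cell ` U. \<forall>j\<in>{1..N}. \<bar>h j - g j\<bar> \<le> r" by blast
  qed (use fin in auto)
qed

lemma exp_powr_ratio: "0 < al \<Longrightarrow> exp (al * x) powr (l / al) = exp (l * x)" for al l x :: real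
  by (simp add: powr_def)

text \<open>On \<open>A\<close> the matrix side of \<open>gordon_comparison\<close> is at least
  \<open>exp (- l * b)\<close> times the exponential of the independent scalar, whose mean is
  \<open>exp (l\<^sup>2 / 2)\<close>. On the decoupled side the bound by \<open>z\<close> eliminates
  the points of \<open>T\<close>, and the column and the row become independent factors, estimated
  by \<open>chi_laplace\<close> and \<open>sqrt_sum_mgf\<close>.\<close>

lemma small_image_prob_net:
  fixes T :: "(nat \<Rightarrow> real) set" and z :: "nat \<Rightarrow> real \<Rightarrow> real"
  assumes T: "finite T" "T \<noteq> {}" "\<And>h. h \<in> T \<Longrightarrow> (\<Sum>j=1..N. (h j)\<^sup>2) = 1"
    and z: "\<And>j. j \<in> {1..N} \<Longrightarrow> sub_chi_sq (z j)" "\<And>h g. h \<in> T \<Longrightarrow> (\<Sum>j=1..N. h j * g j) \<le> sqrt (\<Sum>j=1..N. z j (g j))"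
    and M: "0 < M" "(\<Sum>j=1..N. \<integral>u. z j u \<partial>std_gauss) \<le> M"
    and m: "1 \<le> m" and l: "0 < l" and al: "l \<le> al" and d: "0 < d"
    and A: "A \<in> sets (gauss ({1..m} \<times> {1..N}))"
    and AB: "\<And>a. a \<in> A \<Longrightarrow> \<exists>h\<in>T. sqrt (d\<^sup>2 + (\<Sum>i=1..m. (\<Sum>j=1..N. h j * a (i, j))\<^sup>2)) \<le> b"
  shows "exp (l\<^sup>2 / 2) * (measure (gauss ({1..m} \<times> {1..N})) A * exp (- l * b))
    \<le> real (card T) powr (l / al) * (exp (- l * sqrt (real m - 1) + l\<^sup>2 / 4) * exp (l * sqrt M + l\<^sup>2 / 2))"
proof -
  interpret soft_min m N T al l d
    by unfold_locales (use T l al d in auto)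
  \<comment> \<open>Blocks of the array: \<open>GG\<close> is the matrix, \<open>RR\<close> the
    column and \<open>CC\<close> the row of the decoupled field, \<open>Oz\<close> the compensating
    scalar.\<close>
  define GG where "GG = {1..m} \<times> {1..N}"
  define RR where "RR = {1..m} \<times> {0::nat}"
  define CC where "CC = {0::nat} \<times> {1..N}"
  define Oz where "Oz = {(0::nat, 0::nat)}"
  define II where "II = {0..m} \<times> {0..N}"
  note defs = GG_def RR_def CC_def Oz_def II_def
  have fin: "finite GG" "finite RR" "finite CC" "finite Oz" "finite II" by (auto simp: defs)
  have disj: "Oz \<inter> GG = {}" "RR \<inter> CC = {}" "(Oz \<union> GG) \<inter> (RR \<union> CC) = {}" "(RR \<union> CC) \<inter> (Oz \<union> GG) = {}"
    by (auto simp: defs)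
  have sc: "(\<Sum>i\<in>CC. f i) = (\<Sum>j=1..N. f (0, j))" for f :: "nat \<times> nat \<Rightarrow> real"
    by (rule sum.reindex_bij_witness[of _ "\<lambda>j. (0, j)" snd]) (auto simp: CC_def)
  have sr: "(\<Sum>i\<in>RR. f i) = (\<Sum>i=1..m. f (i, 0))" for f :: "nat \<times> nat \<Rightarrow> real"
    by (rule sum.reindex_bij_witness[of _ "\<lambda>i. (i, 0)" fst]) (auto simp: RR_def)
  have card_RR: "card RR = m" by (simp add: RR_def card_cartesian_product)
  note A' = A[folded GG_def]
  have al0: "0 < al" using l al by linarith
  have I1: "II = (Oz \<union> GG) \<union> (RR \<union> CC)" by (auto simp: defs)
  have I2: "II = (RR \<union> CC) \<union> (Oz \<union> GG)" by (auto simp: defs)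
  interpret PG: prob_space "gauss GG" by (rule prob_space_gauss)
  interpret Prc: prob_space "gauss (RR \<union> CC)" by (rule prob_space_gauss)
  interpret PoG: prob_space "gauss (Oz \<union> GG)" by (rule prob_space_gauss)
  let ?X = "\<lambda>a. (\<Sum>h\<in>T. exp (- al * (sqrt (d\<^sup>2 + (\<Sum>i=1..m. (\<Sum>j=1..N. h j * a (i, j))\<^sup>2)) - a (0, 0)))) powr (l / al)"
  let ?Y = "\<lambda>a. (\<Sum>h\<in>T. exp (- al * (sqrt (d\<^sup>2 + (\<Sum>i=1..m. (a (i, 0))\<^sup>2)) - (\<Sum>j=1..N. h j * a (0, j))))) powr (l / al)"
  define Nh where "Nh h a = sqrt (d\<^sup>2 + (\<Sum>i=1..m. (\<Sum>j=1..N. h j * a (i, j))\<^sup>2))" for h a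
  have Nh0: "0 \<le> Nh h a" for h a unfolding Nh_def by (intro real_sqrt_ge_zero add_nonneg_nonneg sum_nonneg) auto
  define ph where "ph a = (\<Sum>h\<in>T. exp (- al * Nh h a)) powr (l / al)" for a
  have X_eq: "?X a = exp (l * a (0, 0)) * ph a" for a
  proof -
    have "(\<Sum>h\<in>T. exp (- al * (Nh h a - a (0, 0)))) = exp (al * a (0, 0)) * (\<Sum>h\<in>T. exp (- al * Nh h a))"
      unfolding sum_distrib_left mult_exp_exp by (simp add: algebra_simps)
    then show ?thesis
      unfolding Nh_def[symmetric] ph_def by (simp only: powr_mult exp_powr_ratio[OF al0])
  qed
  have ph_le: "ph a \<le> real (card T) powr (l / al)" "0 \<le> ph a" for a
  proof -
    have "(\<Sum>h\<in>T. exp (- al * Nh h a)) \<le> (\<Sum>h\<in>T. 1)"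
      using al0 Nh0 by (intro sum_mono) auto
    then show "ph a \<le> real (card T) powr (l / al)"
      unfolding ph_def using l al0 by (intro powr_mono2) (auto intro: sum_nonneg)
  qed (simp add: ph_def)
  have meas_e: "(\<lambda>a. a e) \<in> borel_measurable (gauss II)" if "e \<in> II" for e
    using that by measurable
  have X_meas: "?X \<in> borel_measurable (gauss II)"
  proof -
    have [measurable]: "(\<lambda>a. a (i, j)) \<in> borel_measurable (gauss II)" if "i \<in> {1..m}" "j \<in> {1..N}" for i j
      using that by (intro meas_e) (auto simp: II_def)
    have [measurable]: "(\<lambda>a. a (0, 0)) \<in> borel_measurable (gauss II)"
      by (intro meas_e) (auto simp: II_def)
    show ?thesis by measurable
  qed
  have X_int: "integrable (gauss II) ?X"
  proof (rule integrable_gauss_bound[OF _ X_meas])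
    fix a :: "nat \<times> nat \<Rightarrow> real"
    have "a (0, 0) \<le> (\<Sum>i\<in>II. \<bar>a i\<bar>)"
      using member_le_sum[of "(0,0)" II "\<lambda>i. \<bar>a i\<bar>"] fin by (force simp: II_def)
    then have "exp (l * a (0, 0)) * ph a \<le> exp (l * (\<Sum>i\<in>II. \<bar>a i\<bar>)) * real (card T) powr (l / al)"
      using l ph_le by (intro mult_mono) auto
    then show "\<bar>?X a\<bar> \<le> real (card T) powr (l / al) * exp (l * (\<Sum>i\<in>II. \<bar>a i\<bar>))"
      unfolding X_eq using ph_le(2)[of a] by (simp add: mult.commute abs_mult)
  qed (rule fin)
  define f0 where "f0 a = exp (l * a (0, 0))" for a :: "nat \<times> nat \<Rightarrow> real"
  \<comment> \<open>Elements of \<open>A\<close> take the default value outside \<open>GG\<close>,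
    whereas the integration runs over arrays on the larger index set \<open>II\<close>; hence the
    restriction.\<close>
  define f1 where "f1 a = indicator A (restrict a GG) * exp (- l * b)" for a :: "nat \<times> nat \<Rightarrow> real"
  have f0: "integrable (gauss Oz) f0" "(\<integral>a. f0 a \<partial>gauss Oz) = exp (l\<^sup>2 / 2)"
  proof -
    show "integrable (gauss Oz) f0"
    proof (rule integrable_gauss_bound[of _ _ 1 l])
      show "f0 \<in> borel_measurable (gauss Oz)"
        unfolding f0_def Oz_def by measurable
      show "\<bar>f0 a\<bar> \<le> 1 * exp (l * (\<Sum>i\<in>Oz. \<bar>a i\<bar>))" for a using l by (simp add: f0_def Oz_def)
    qed (rule fin)
    show "(\<integral>a. f0 a \<partial>gauss Oz) = exp (l\<^sup>2 / 2)"
      using std_gauss_prod.product_integral_singleton[of "\<lambda>u. exp (l * u)" "(0, 0)"] integral_exp_std_gauss(2)[of l]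
      by (simp add: f0_def Oz_def)
  qed
  have f1: "integrable (gauss GG) f1" "(\<integral>a. f1 a \<partial>gauss GG) = measure (gauss GG) A * exp (- l * b)"
  proof -
    have e: "f1 a = indicator A a * exp (- l * b)" if "a \<in> space (gauss GG)" for a
      using that by (simp add: f1_def space_PiM PiE_def extensional_restrict)
    show "integrable (gauss GG) f1"
    proof (subst Bochner_Integration.integrable_cong[OF refl e])
      show "integrable (gauss GG) (\<lambda>a. indicator A a * exp (- l * b))"
        by (intro integrable_mult_left integrable_real_indicator A') (simp add: PG.emeasure_finite less_top[symmetric])
    qed
    show "(\<integral>a. f1 a \<partial>gauss GG) = measure (gauss GG) A * exp (- l * b)"
      using A' by (subst Bochner_Integration.integral_cong[OF refl e]) (auto simp: sets.Int_space_eq2)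
  qed
  have f01: "integrable (gauss (Oz \<union> GG)) (\<lambda>a. f0 a * f1 a)"
     "(\<integral>a. f0 a * f1 a \<partial>gauss (Oz \<union> GG)) = exp (l\<^sup>2 / 2) * (measure (gauss GG) A * exp (- l * b))"
  proof -
    have dep: "f0 a = f0 a'" if "\<And>i. i \<in> Oz \<Longrightarrow> a i = a' i" for a a' using that by (simp add: f0_def Oz_def)
    have dep1: "f1 a = f1 a'" if "\<And>i. i \<in> GG \<Longrightarrow> a i = a' i" for a a'
      using restrict_cong[of GG GG a a'] that by (simp add: f1_def simp_implies_def)
    show "integrable (gauss (Oz \<union> GG)) (\<lambda>a. f0 a * f1 a)"
      by (rule gauss_integral_indep(1)[OF fin(4,1) disj(1) f0(1) f1(1) dep dep1])
    show "(\<integral>a. f0 a * f1 a \<partial>gauss (Oz \<union> GG)) = exp (l\<^sup>2 / 2) * (measure (gauss GG) A * exp (- l * b))"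
      unfolding f0(2)[symmetric] f1(2)[symmetric]
      by (rule gauss_integral_indep(2)[OF fin(4,1) disj(1) f0(1) f1(1) dep dep1])
  qed
  have lower: "(\<integral>a. f0 a * f1 a \<partial>gauss II) = exp (l\<^sup>2 / 2) * (measure (gauss GG) A * exp (- l * b))"
  proof -
    have dep: "f0 a * f1 a = f0 a' * f1 a'" if "\<And>i. i \<in> Oz \<union> GG \<Longrightarrow> a i = a' i" for a a'
      using restrict_cong[of GG GG a a'] that by (simp add: f0_def f1_def Oz_def simp_implies_def)
    have "(\<integral>a. (f0 a * f1 a) * 1 \<partial>gauss ((Oz \<union> GG) \<union> (RR \<union> CC)))
        = (\<integral>a. f0 a * f1 a \<partial>gauss (Oz \<union> GG)) * (\<integral>a. 1 \<partial>gauss (RR \<union> CC))"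
      by (rule gauss_integral_indep(2)[OF _ _ disj(3) f01(1) Prc.integrable_const dep]) (use fin in auto)
    then show ?thesis unfolding I1 by (simp add: f01(2) Prc.prob_space)
  qed
  have "(\<integral>a. f0 a * f1 a \<partial>gauss II) \<le> (\<integral>a. ?X a \<partial>gauss II)"
  proof (rule integral_mono'[OF X_int])
    fix a :: "nat \<times> nat \<Rightarrow> real"
    have "f1 a \<le> ph a"
    proof (cases "restrict a GG \<in> A")
      case True
      then obtain h where h: "h \<in> T" "sqrt (d\<^sup>2 + (\<Sum>i=1..m. (\<Sum>j=1..N. h j * restrict a GG (i, j))\<^sup>2)) \<le> b"
        using AB[of "restrict a GG"] by blast
      have "sqrt (d\<^sup>2 + (\<Sum>i=1..m. (\<Sum>j=1..N. h j * restrict a GG (i, j))\<^sup>2)) = Nh h a"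
        unfolding Nh_def by (intro arg_cong[where f = sqrt] arg_cong2[where f = "(+)"] sum.cong refl arg_cong[where f = "\<lambda>x. x\<^sup>2"]) (auto simp: GG_def)
      then have Nb: "Nh h a \<le> b" using h by simp
      have "exp (al * - b) \<le> exp (- al * Nh h a)" using Nb al0 by simp
      also have "\<dots> \<le> (\<Sum>h\<in>T. exp (- al * Nh h a))"
        using h T by (intro member_le_sum) auto
      finally have "exp (al * - b) powr (l / al) \<le> ph a"
        unfolding ph_def using l al0 by (intro powr_mono2) auto
      then have "exp (l * - b) \<le> ph a" unfolding exp_powr_ratio[OF al0] .
      then show ?thesis using True by (simp add: f1_def)
    qed (simp add: f1_def ph_le(2))
    then show "f0 a * f1 a \<le> ?X a" unfolding X_eq by (simp add: f0_def)
  qed simp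
  also have "\<dots> \<le> (\<integral>a. ?Y a \<partial>gauss II)" unfolding II_def by (rule gordon_comparison)
  finally have XY: "(\<integral>a. f0 a * f1 a \<partial>gauss II) \<le> (\<integral>a. ?Y a \<partial>gauss II)" .
  have Y1: "(\<integral>a. ?Y a \<partial>gauss II) \<le> (\<integral>a. real (card T) powr (l / al) * (exp (- l * sqrt (d\<^sup>2 + (\<Sum>i\<in>RR. (a i)\<^sup>2))) * exp (l * sqrt (\<Sum>i\<in>CC. z (snd i) (a i)))) \<partial>gauss II)"
    and Y2: "(\<integral>a. real (card T) powr (l / al) * (exp (- l * sqrt (d\<^sup>2 + (\<Sum>i\<in>RR. (a i)\<^sup>2))) * exp (l * sqrt (\<Sum>i\<in>CC. z (snd i) (a i)))) \<partial>gauss II)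
      \<le> real (card T) powr (l / al) * (exp (- l * sqrt (real m - 1) + l\<^sup>2 / 4) * exp (l * sqrt M + l\<^sup>2 / 2))"
  proof -
    interpret chi: smooth_chi RR d by unfold_locales (use d m fin card_RR in auto)
    define g0 where "g0 a = exp (- l * sqrt (d\<^sup>2 + (\<Sum>i\<in>RR. (a i)\<^sup>2)))" for a :: "nat \<times> nat \<Rightarrow> real"
    define g1 where "g1 a = exp (l * sqrt (\<Sum>i\<in>CC. z (snd i) (a i)))" for a :: "nat \<times> nat \<Rightarrow> real"
    have g0: "integrable (gauss RR) g0" "(\<integral>a. g0 a \<partial>gauss RR) \<le> exp (- l * sqrt (real m - 1) + l\<^sup>2 / 4)"
      using chi.e_int[of l] chi.chi_laplace[of l] l
      by (auto simp: chi.e_def[abs_def] chi.N_def[abs_def] g0_def[abs_def] card_RR)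
    have g1: "integrable (gauss CC) g1" "(\<integral>a. g1 a \<partial>gauss CC) \<le> exp (l * sqrt M + l\<^sup>2 / 2)"
    proof -
      have zi: "sub_chi_sq (z (snd i))" if "i \<in> CC" for i using z(1)[of "snd i"] that by (auto simp: CC_def)
      have sM: "(\<Sum>i\<in>CC. \<integral>u. z (snd i) u \<partial>std_gauss) \<le> M" using M(2) by (simp add: sc)
      show "integrable (gauss CC) g1" "(\<integral>a. g1 a \<partial>gauss CC) \<le> exp (l * sqrt M + l\<^sup>2 / 2)"
        unfolding g1_def by (rule sqrt_sum_mgf[OF fin(3) zi M(1) sM l]; assumption)+
    qed
    have dep0: "g0 a = g0 a'" if "\<And>i. i \<in> RR \<Longrightarrow> a i = a' i" for a a'
      unfolding g0_def using that by (metis (no_types, lifting) sum.cong)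
    have dep1: "g1 a = g1 a'" if "\<And>i. i \<in> CC \<Longrightarrow> a i = a' i" for a a'
      unfolding g1_def using that by (metis (no_types, lifting) sum.cong)
    have g01: "integrable (gauss (RR \<union> CC)) (\<lambda>a. g0 a * g1 a)"
      by (rule gauss_integral_indep(1)[OF fin(2,3) disj(2) g0(1) g1(1) dep0 dep1])
    have g01_eq: "(\<integral>a. g0 a * g1 a \<partial>gauss (RR \<union> CC)) = (\<integral>a. g0 a \<partial>gauss RR) * (\<integral>a. g1 a \<partial>gauss CC)"
      by (rule gauss_integral_indep(2)[OF fin(2,3) disj(2) g0(1) g1(1) dep0 dep1])
    have dep: "g0 a * g1 a = g0 a' * g1 a'" if "\<And>i. i \<in> RR \<union> CC \<Longrightarrow> a i = a' i" for a a'
      using dep0[of a a'] dep1[of a a'] that by (metis UnI1 UnI2)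
    have g: "integrable (gauss II) (\<lambda>a. g0 a * g1 a)"
      "(\<integral>a. g0 a * g1 a \<partial>gauss II) = (\<integral>a. g0 a \<partial>gauss RR) * (\<integral>a. g1 a \<partial>gauss CC)"
    proof -
      have 1: "integrable (gauss ((RR \<union> CC) \<union> (Oz \<union> GG))) (\<lambda>a. (g0 a * g1 a) * 1)"
        by (rule gauss_integral_indep(1)[OF _ _ disj(4) g01 PoG.integrable_const dep]) (use fin in auto)
      have 2: "(\<integral>a. (g0 a * g1 a) * 1 \<partial>gauss ((RR \<union> CC) \<union> (Oz \<union> GG))) = (\<integral>a. g0 a * g1 a \<partial>gauss (RR \<union> CC)) * (\<integral>a. 1 \<partial>gauss (Oz \<union> GG))"
        by (rule gauss_integral_indep(2)[OF _ _ disj(4) g01 PoG.integrable_const dep]) (use fin in auto)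
      show "integrable (gauss II) (\<lambda>a. g0 a * g1 a)" using 1 unfolding I2 by simp
      show "(\<integral>a. g0 a * g1 a \<partial>gauss II) = (\<integral>a. g0 a \<partial>gauss RR) * (\<integral>a. g1 a \<partial>gauss CC)"
        using 2 unfolding I2 by (simp add: g01_eq PoG.prob_space)
    qed
    show "(\<integral>a. ?Y a \<partial>gauss II) \<le> (\<integral>a. real (card T) powr (l / al) * (exp (- l * sqrt (d\<^sup>2 + (\<Sum>i\<in>RR. (a i)\<^sup>2))) * exp (l * sqrt (\<Sum>i\<in>CC. z (snd i) (a i)))) \<partial>gauss II)"
      unfolding g0_def[symmetric] g1_def[symmetric]
    proof (rule integral_mono')
      show "integrable (gauss II) (\<lambda>a. real (card T) powr (l / al) * (g0 a * g1 a))" using g(1) by simp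
      fix a :: "nat \<times> nat \<Rightarrow> real"
      let ?n = "sqrt (d\<^sup>2 + (\<Sum>i=1..m. (a (i, 0))\<^sup>2))" and ?w = "sqrt (\<Sum>j=1..N. z j (a (0, j)))"
      \<comment> \<open>The bound no longer involves \<open>h\<close>, so summing over
        \<open>T\<close> costs just the factor \<open>card T\<close>, reduced by the outer power to
        \<open>real (card T) powr (l / al)\<close>.\<close>
      have "exp (- al * (?n - (\<Sum>j=1..N. h j * a (0, j)))) \<le> exp (al * (?w - ?n))" if "h \<in> T" for h
      proof -
        have "(\<Sum>j=1..N. h j * a (0, j)) \<le> ?w" using z(2)[OF that, of "\<lambda>j. a (0, j)"] .
        then have "al * ((\<Sum>j=1..N. h j * a (0, j)) - ?n) \<le> al * (?w - ?n)" using al0 by (intro mult_left_mono) auto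
        then show ?thesis by (simp add: algebra_simps)
      qed
      then have "(\<Sum>h\<in>T. exp (- al * (?n - (\<Sum>j=1..N. h j * a (0, j))))) \<le> real (card T) * exp (al * (?w - ?n))"
        by (rule sum_bounded_above)
      then have "?Y a \<le> (real (card T) * exp (al * (?w - ?n))) powr (l / al)"
        using l al0 by (intro powr_mono2) (auto intro: sum_nonneg)
      also have "\<dots> = real (card T) powr (l / al) * exp (l * (?w - ?n))"
        by (simp only: powr_mult exp_powr_ratio[OF al0])
      also have "exp (l * (?w - ?n)) = g0 a * g1 a"
        by (simp add: g0_def g1_def sr sc mult_exp_exp right_diff_distrib)
      finally show "?Y a \<le> real (card T) powr (l / al) * (g0 a * g1 a)" .
      show "0 \<le> real (card T) powr (l / al) * (g0 a * g1 a)" by (simp add: g0_def g1_def)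
    qed
    show "(\<integral>a. real (card T) powr (l / al) * (exp (- l * sqrt (d\<^sup>2 + (\<Sum>i\<in>RR. (a i)\<^sup>2))) * exp (l * sqrt (\<Sum>i\<in>CC. z (snd i) (a i)))) \<partial>gauss II)
      \<le> real (card T) powr (l / al) * (exp (- l * sqrt (real m - 1) + l\<^sup>2 / 4) * exp (l * sqrt M + l\<^sup>2 / 2))"
      unfolding g0_def[symmetric] g1_def[symmetric]
      using g0(2) g1(2) by (simp add: g(2)) (intro mult_left_mono mult_mono; simp add: g0_def g1_def)
  qed
  show ?thesis using XY Y1 Y2 unfolding lower GG_def by linarith
qed

lemma sum_block: "(\<Sum>e\<in>{1..m} \<times> {1..N}. f e) = (\<Sum>i=1..m. \<Sum>j=1..N. f (i, j))" for f :: "nat \<times> nat \<Rightarrow> real"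
  by (simp add: sum.cartesian_product)

lemma sum_row_diff_le:
  fixes a :: "nat \<times> nat \<Rightarrow> real"
  assumes "\<And>j. j \<in> {1..N} \<Longrightarrow> \<bar>h j - g j\<bar> \<le> d"
  shows "(\<Sum>i=1..m. \<bar>(\<Sum>j=1..N. h j * a (i, j)) - (\<Sum>j=1..N. g j * a (i, j))\<bar>) \<le> d * (\<Sum>e\<in>{1..m} \<times> {1..N}. \<bar>a e\<bar>)"
proof -
  have "\<bar>(\<Sum>j=1..N. h j * a (i, j)) - (\<Sum>j=1..N. g j * a (i, j))\<bar> \<le> (\<Sum>j=1..N. d * \<bar>a (i, j)\<bar>)" for i
  proof -
    have "\<bar>(\<Sum>j=1..N. h j * a (i, j)) - (\<Sum>j=1..N. g j * a (i, j))\<bar> = \<bar>\<Sum>j=1..N. (h j - g j) * a (i, j)\<bar>"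
      by (simp add: sum_subtractf left_diff_distrib)
    also have "\<dots> \<le> (\<Sum>j=1..N. \<bar>(h j - g j) * a (i, j)\<bar>)" by (rule sum_abs)
    also have "\<dots> \<le> (\<Sum>j=1..N. d * \<bar>a (i, j)\<bar>)"
      unfolding abs_mult by (intro sum_mono mult_right_mono assms) auto
    finally show ?thesis .
  qed
  then show ?thesis unfolding sum_block sum_distrib_left by (rule sum_mono)
qed

text \<open>On arrays of l1 norm at most \<open>k\<close>, a kernel vector in \<open>U\<close>
  yields a point of a \<open>d\<close>-net whose image has l1 norm at most \<open>d * k\<close>;
  smoothing adds another \<open>d\<close>. The limits are taken in a fixed order: \<open>al\<close>
  to infinity for a given net, which removes its cardinality, then \<open>d\<close> to 0, then
  \<open>k\<close> to infinity.\<close>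

theorem kernel_prob_le:
  fixes U :: "(nat \<Rightarrow> real) set" and z :: "nat \<Rightarrow> real \<Rightarrow> real"
  assumes U: "\<And>h. h \<in> U \<Longrightarrow> (\<Sum>j=1..N. (h j)\<^sup>2) = 1"
    and z: "\<And>j. j \<in> {1..N} \<Longrightarrow> sub_chi_sq (z j)" "\<And>h g. h \<in> U \<Longrightarrow> (\<Sum>j=1..N. h j * g j) \<le> sqrt (\<Sum>j=1..N. z j (g j))"
    and M: "0 < M" "(\<Sum>j=1..N. \<integral>u. z j u \<partial>std_gauss) \<le> M"
    and m: "1 \<le> m" and l: "0 < l"
    and A: "A \<in> sets (gauss ({1..m} \<times> {1..N}))"
    and ker: "\<And>a. a \<in> A \<Longrightarrow> \<exists>h\<in>U. \<forall>i\<in>{1..m}. (\<Sum>j=1..N. h j * a (i, j)) = 0"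
  shows "measure (gauss ({1..m} \<times> {1..N})) A \<le> exp (- l * (sqrt (real m - 1) - sqrt M) + l\<^sup>2 / 4)"
proof -
  define G where "G = {1..m} \<times> {1..N}"
  define P where "P = gauss G"
  have finG: "finite G" by (simp add: G_def)
  interpret prob_space P unfolding P_def by (rule prob_space_gauss)
  define X where "X = exp (- l * sqrt (real m - 1) + l\<^sup>2 / 4) * exp (l * sqrt M + l\<^sup>2 / 2)"
  have AP: "A \<in> sets P" using A by (simp add: P_def G_def)
  define AR where "AR k = A \<inter> {a \<in> space P. (\<Sum>e\<in>G. \<bar>a e\<bar>) \<le> real k}" for k :: nat
  have AR: "AR k \<in> sets P" for k
  proof -
    have "{a \<in> space P. (\<Sum>e\<in>G. \<bar>a e\<bar>) \<le> real k} \<in> sets P" unfolding P_def by measurable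
    then show ?thesis unfolding AR_def using AP by blast
  qed
  have step: "exp (l\<^sup>2 / 2) * (measure P (AR k) * exp (- l * (d + d * real k))) \<le> X" if d: "0 < d" for d k
  proof (cases "U = {}")
    \<comment> \<open>A soft minimum needs a nonempty net, so the empty \<open>U\<close> is split
      off; there the event itself is empty.\<close>
    case True
    then have "AR k = {}" using ker by (auto simp: AR_def)
    then show ?thesis by (simp add: X_def)
  next
    case False
    obtain T where T: "finite T" "T \<subseteq> U" "\<And>h. h \<in> U \<Longrightarrow> \<exists>g\<in>T. \<forall>j\<in>{1..N}. \<bar>h j - g j\<bar> \<le> d"
      using finite_net[of U N d] unit_vector_coord[OF U] d by metis
    have Tne: "T \<noteq> {}" using T(3) False by blast
    have bnd: "exp (l\<^sup>2 / 2) * (measure P (AR k) * exp (- l * (d + d * real k))) \<le> real (card T) powr (l / al) * X"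
      if al: "l \<le> al" for al
      unfolding X_def P_def G_def
    proof (rule small_image_prob_net[OF T(1) Tne _ z(1) _ M m l al d])
      show "(\<Sum>j=1..N. (h j)\<^sup>2) = 1" if "h \<in> T" for h using U T(2) that by blast
      show "(\<Sum>j=1..N. h j * g j) \<le> sqrt (\<Sum>j=1..N. z j (g j))" if "h \<in> T" for h g using z(2) T(2) that by blast
      show "AR k \<in> sets (gauss ({1..m} \<times> {1..N}))" using AR by (simp add: P_def G_def)
      fix a assume a: "a \<in> AR k"
      then obtain h where h: "h \<in> U" "\<And>i. i \<in> {1..m} \<Longrightarrow> (\<Sum>j=1..N. h j * a (i, j)) = 0"
        using ker[of a] a unfolding AR_def by blast
      obtain g where g: "g \<in> T" "\<And>j. j \<in> {1..N} \<Longrightarrow> \<bar>h j - g j\<bar> \<le> d" using T(3)[OF h(1)] by blast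
      let ?x = "\<lambda>i. \<Sum>j=1..N. g j * a (i, j)"
      have "(\<Sum>i=1..m. \<bar>?x i\<bar>) = (\<Sum>i=1..m. \<bar>(\<Sum>j=1..N. h j * a (i, j)) - ?x i\<bar>)"
      proof (rule sum.cong[OF refl])
        fix i assume "i \<in> {1..m}"
        then show "\<bar>?x i\<bar> = \<bar>(\<Sum>j=1..N. h j * a (i, j)) - ?x i\<bar>" using h(2)[of i] by simp
      qed
      also have "\<dots> \<le> d * (\<Sum>e\<in>{1..m} \<times> {1..N}. \<bar>a e\<bar>)" by (rule sum_row_diff_le[OF g(2)])
      also have "\<dots> \<le> d * real k" using a d by (intro mult_left_mono) (auto simp: AR_def G_def)
      finally have sx: "(\<Sum>i=1..m. \<bar>?x i\<bar>) \<le> d * real k" .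
      have "sqrt (d\<^sup>2 + (\<Sum>i=1..m. (?x i)\<^sup>2)) \<le> sqrt (d\<^sup>2) + sqrt (\<Sum>i=1..m. (?x i)\<^sup>2)"
        by (rule sqrt_add_le_add_sqrt) (auto intro: sum_nonneg)
      also have "sqrt (\<Sum>i=1..m. (?x i)\<^sup>2) \<le> (\<Sum>i=1..m. \<bar>?x i\<bar>)"
        using L2_set_le_sum_abs[of ?x "{1..m}"] by (simp add: L2_set_def)
      finally have "sqrt (d\<^sup>2 + (\<Sum>i=1..m. (?x i)\<^sup>2)) \<le> d + d * real k" using sx d by simp
      then show "\<exists>h\<in>T. sqrt (d\<^sup>2 + (\<Sum>i=1..m. (\<Sum>j=1..N. h j * a (i, j))\<^sup>2)) \<le> d + d * real k"
        using g(1) by blast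
    qed
    have "((\<lambda>al. real (card T) powr (l / al) * X) \<longlongrightarrow> real (card T) powr 0 * X) at_top"
    proof (intro tendsto_mult tendsto_powr tendsto_const)
      show "((\<lambda>al. l / al) \<longlongrightarrow> 0) at_top"
        by (rule tendsto_divide_0[OF tendsto_const]) (simp add: filterlim_at_top_imp_at_infinity filterlim_ident)
      show "real (card T) \<noteq> 0" using T(1) Tne by simp
    qed
    then have "((\<lambda>al. real (card T) powr (l / al) * X) \<longlongrightarrow> X) at_top" using T(1) Tne by simp
    then show ?thesis
    proof (rule tendsto_lowerbound)
      show "\<forall>\<^sub>F al in at_top. exp (l\<^sup>2 / 2) * (measure P (AR k) * exp (- l * (d + d * real k))) \<le> real (card T) powr (l / al) * X"
        using eventually_ge_at_top[of l] by eventually_elim (rule bnd)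
    qed simp
  qed
  have step2: "exp (l\<^sup>2 / 2) * measure P (AR k) \<le> X" for k
  proof -
    have "((\<lambda>d. exp (l\<^sup>2 / 2) * (measure P (AR k) * exp (- l * (d + d * real k)))) \<longlongrightarrow>
      exp (l\<^sup>2 / 2) * (measure P (AR k) * exp (- l * (0 + 0 * real k)))) (at_right 0)"
      by (intro tendsto_intros)
    then have "((\<lambda>d. exp (l\<^sup>2 / 2) * (measure P (AR k) * exp (- l * (d + d * real k)))) \<longlongrightarrow>
      exp (l\<^sup>2 / 2) * measure P (AR k)) (at_right 0)" by simp
    then show ?thesis
    proof (rule tendsto_upperbound)
      show "\<forall>\<^sub>F d in at_right 0. exp (l\<^sup>2 / 2) * (measure P (AR k) * exp (- l * (d + d * real k))) \<le> X"
        using eventually_at_right_less[of 0] by eventually_elim (rule step)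
    qed simp
  qed
  have "(\<lambda>k. measure P (AR k)) \<longlonglongrightarrow> measure P (\<Union>k. AR k)"
  proof (rule finite_Lim_measure_incseq)
    show "range AR \<subseteq> sets P" using AR by auto
    show "incseq AR" by (force simp: incseq_def AR_def)
  qed
  also have "(\<Union>k. AR k) = A"
  proof -
    have "\<exists>k. (\<Sum>e\<in>G. \<bar>a e\<bar>) \<le> real k" for a :: "nat \<times> nat \<Rightarrow> real" by (rule real_arch_simple)
    then show ?thesis using sets.sets_into_space[OF AP] by (auto simp: AR_def)
  qed
  finally have "(\<lambda>k. exp (l\<^sup>2 / 2) * measure P (AR k)) \<longlonglongrightarrow> exp (l\<^sup>2 / 2) * measure P A"
    by (intro tendsto_intros)
  then have "exp (l\<^sup>2 / 2) * measure P A \<le> X"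
    by (rule LIMSEQ_le_const2) (use step2 in auto)
  then have "measure P A \<le> X / exp (l\<^sup>2 / 2)" by (simp add: pos_le_divide_eq mult.commute)
  \<comment> \<open>The factor \<open>exp (l\<^sup>2 / 2)\<close> of the scalar cancels the one from
    \<open>sqrt_sum_mgf\<close>; what remains of the quadratic terms is the contribution of the
    norm.\<close>
  also have "\<dots> = exp (- l * (sqrt (real m - 1) - sqrt M) + l\<^sup>2 / 4)"
    unfolding X_def mult_exp_exp exp_diff[symmetric] by (simp add: algebra_simps)
  finally show ?thesis by (simp add: P_def G_def)
qed

text \<open>The event is a union over an uncountable set. Compactness makes the size
  \<open>q\<close> of the image attain its minimum on \<open>U\<close>, so the kernel meets
  \<open>U\<close> exactly when \<open>q\<close> becomes arbitrarily small on a countable dense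
  subset.\<close>

lemma kernel_event_measurable:
  fixes U :: "(nat \<Rightarrow> real) set" and m N :: nat
  assumes U: "\<And>h. h \<in> U \<Longrightarrow> (\<Sum>j=1..N. (h j)\<^sup>2) = 1" and comp: "compact U"
  shows "{a \<in> space (gauss ({1..m} \<times> {1..N})). \<exists>h\<in>U. \<forall>i\<in>{1..m}. (\<Sum>j=1..N. h j * a (i, j)) = 0}
    \<in> sets (gauss ({1..m} \<times> {1..N}))"
proof -
  let ?P = "gauss ({1..m} \<times> {1..N})"
  define q where "q h a = (\<Sum>i=1..m. \<bar>\<Sum>j=1..N. h j * a (i, j)\<bar>)" for h :: "nat \<Rightarrow> real" and a :: "nat \<times> nat \<Rightarrow> real"
  have q0: "0 \<le> q h a" for h a by (simp add: q_def sum_nonneg)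
  have "\<exists>T. finite T \<and> T \<subseteq> U \<and> (\<forall>h\<in>U. \<exists>g\<in>T. \<forall>j\<in>{1..N}. \<bar>h j - g j\<bar> \<le> 1 / real (Suc n))" for n
  proof -
    obtain T where "finite T" "T \<subseteq> U" "\<And>h. h \<in> U \<Longrightarrow> \<exists>g\<in>T. \<forall>j\<in>{1..N}. \<bar>h j - g j\<bar> \<le> 1 / real (Suc n)"
      by (rule finite_net[of U N "1 / real (Suc n)"]) (use unit_vector_coord[OF U] in auto)
    then show ?thesis by auto
  qed
  then obtain T where T: "\<And>n. finite (T n)" "\<And>n. T n \<subseteq> U"
    "\<And>n h. h \<in> U \<Longrightarrow> \<exists>g\<in>T n. \<forall>j\<in>{1..N}. \<bar>h j - g j\<bar> \<le> 1 / real (Suc n)" by metis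
  define D where "D = (\<Union>n. T n)"
  have D: "countable D" "D \<subseteq> U" using T by (auto simp: D_def intro: countable_finite)
  have eq: "(\<exists>h\<in>U. \<forall>i\<in>{1..m}. (\<Sum>j=1..N. h j * a (i, j)) = 0) \<longleftrightarrow> (\<forall>k. \<exists>h\<in>D. q h a < 1 / real (Suc k))" for a
  proof
    assume "\<exists>h\<in>U. \<forall>i\<in>{1..m}. (\<Sum>j=1..N. h j * a (i, j)) = 0"
    then obtain h where h: "h \<in> U" "\<And>i. i \<in> {1..m} \<Longrightarrow> (\<Sum>j=1..N. h j * a (i, j)) = 0" by blast
    let ?S = "\<Sum>e\<in>{1..m} \<times> {1..N}. \<bar>a e\<bar>"
    show "\<forall>k. \<exists>h\<in>D. q h a < 1 / real (Suc k)"
    proof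
      fix k
      \<comment> \<open>A net of mesh \<open>1 / Suc n\<close> moves the image by at most
        \<open>?S / Suc n\<close>, which is below \<open>1 / Suc k\<close> for this
        \<open>n\<close>.\<close>
      obtain n :: nat where n: "?S * real (Suc k) < real n" using reals_Archimedean2 by blast
      obtain g where g: "g \<in> T n" "\<And>j. j \<in> {1..N} \<Longrightarrow> \<bar>h j - g j\<bar> \<le> 1 / real (Suc n)"
        using T(3)[OF h(1)] by blast
      have "q g a = (\<Sum>i=1..m. \<bar>(\<Sum>j=1..N. h j * a (i, j)) - (\<Sum>j=1..N. g j * a (i, j))\<bar>)"
        unfolding q_def
      proof (rule sum.cong[OF refl])
        fix i assume "i \<in> {1..m}"
        then show "\<bar>\<Sum>j=1..N. g j * a (i, j)\<bar> = \<bar>(\<Sum>j=1..N. h j * a (i, j)) - (\<Sum>j=1..N. g j * a (i, j))\<bar>"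
          using h(2)[of i] by simp
      qed
      also have "\<dots> \<le> 1 / real (Suc n) * ?S" by (rule sum_row_diff_le[OF g(2)])
      also have "\<dots> < 1 / real (Suc k)"
      proof -
        have "?S * real (Suc k) < real (Suc n)" using n by simp
        then have "?S < real (Suc n) / real (Suc k)" by (subst pos_less_divide_eq) auto
        then have "?S / real (Suc n) < 1 / real (Suc k)" by (subst pos_divide_less_eq) (auto simp del: of_nat_Suc)
        then show ?thesis by (simp del: of_nat_Suc)
      qed
      finally show "\<exists>h\<in>D. q h a < 1 / real (Suc k)" using g(1) by (auto simp: D_def)
    qed
  next
    assume ev: "\<forall>k. \<exists>h\<in>D. q h a < 1 / real (Suc k)"
    then have "U \<noteq> {}" using D by blast
    moreover have "continuous_on U (\<lambda>h. q h a)"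
      unfolding q_def by (intro continuous_intros continuous_on_product_coordinates[THEN continuous_on_subset]) auto
    ultimately obtain h where h: "h \<in> U" "\<And>g. g \<in> U \<Longrightarrow> q h a \<le> q g a"
      using continuous_attains_inf[OF comp] by blast
    have lt: "q h a < 1 / real (Suc k)" for k
      using ev D(2) h(2) by (meson le_less_trans subsetD)
    have "q h a \<le> 0"
    proof (rule ccontr)
      assume "\<not> q h a \<le> 0"
      then obtain k where "1 / real (Suc k) < q h a" using nat_approx_posE[of "q h a"] by auto
      then show False using lt[of k] by linarith
    qed
    then have "q h a = 0" using q0[of h a] by linarith
    then have "\<forall>i\<in>{1..m}. (\<Sum>j=1..N. h j * a (i, j)) = 0"
      unfolding q_def by (subst (asm) sum_nonneg_eq_0_iff) auto
    then show "\<exists>h\<in>U. \<forall>i\<in>{1..m}. (\<Sum>j=1..N. h j * a (i, j)) = 0" using h(1) by blast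
  qed
  have qm: "(\<lambda>a. q h a) \<in> borel_measurable ?P" for h
  proof -
    have [measurable]: "(\<lambda>a. a (i, j)) \<in> borel_measurable ?P" if "i \<in> {1..m}" "j \<in> {1..N}" for i j
      using that measurable_component_singleton[of "(i, j)" "{1..m} \<times> {1..N}" "\<lambda>_. std_gauss"] by simp
    show ?thesis unfolding q_def by measurable
  qed
  have "{a \<in> space ?P. \<forall>k. \<exists>h\<in>D. q h a < 1 / real (Suc k)} \<in> sets ?P"
    by (intro sets.sets_Collect_countable_All sets.sets_Collect_countable_Ex' D(1)
      borel_measurable_less qm borel_measurable_const)
  then show ?thesis unfolding eq .
qed

section \<open>The descent cone of the box-constrained l1 problem\<close>

text \<open>The sum in the third condition is the one-sided directional derivative of the l1 norm at
  \<open>x\<close>. Directions vanish outside \<open>{1..N}\<close> so that the set is compact in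
  the product topology on all functions.\<close>

definition box_l1_dirs :: "nat \<Rightarrow> real \<Rightarrow> real \<Rightarrow> (nat \<Rightarrow> real) \<Rightarrow> (nat \<Rightarrow> real) set" where
  "box_l1_dirs N lo hi x = {h. (\<forall>j. j \<notin> {1..N} \<longrightarrow> h j = 0)
     \<and> (\<forall>j\<in>{1..N}. (x j = lo \<longrightarrow> 0 \<le> h j) \<and> (x j = hi \<longrightarrow> h j \<le> 0))
     \<and> (\<Sum>j=1..N. of_bool (x j = 0) * \<bar>h j\<bar> + sgn (x j) * h j) \<le> 0
     \<and> (\<Sum>j=1..N. (h j)\<^sup>2) = 1}"

lemma box_l1_dirs_unit: "h \<in> box_l1_dirs N lo hi x \<Longrightarrow> (\<Sum>j=1..N. (h j)\<^sup>2) = 1"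
  by (simp add: box_l1_dirs_def)

text \<open>By Tychonoff's theorem: a closed subset of a product of compact sets, with factor
  \<open>{0}\<close> outside \<open>{1..N}\<close>.\<close>

lemma compact_box_l1_dirs: "compact (box_l1_dirs N lo hi x)"
proof -
  define S where "S = (\<Pi>\<^sub>E j\<in>UNIV. if j \<in> {1..N} then {-1..1::real} else {0})"
  have "compactin (product_topology (\<lambda>_. euclidean) UNIV) S"
    unfolding S_def by (subst compactin_PiE) auto
  then have "compact S" by (simp add: euclidean_product_topology)
  moreover have "closed {h. (\<forall>j. j \<in> {1..N} \<and> x j = lo \<longrightarrow> 0 \<le> h j) \<and> (\<forall>j. j \<in> {1..N} \<and> x j = hi \<longrightarrow> h j \<le> 0)
     \<and> (\<Sum>j=1..N. of_bool (x j = 0) * \<bar>h j\<bar> + sgn (x j) * h j) \<le> 0 \<and> (\<Sum>j=1..N. (h j)\<^sup>2) = 1}" (is "closed ?C")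
    by (intro closed_Collect_conj closed_Collect_all closed_Collect_imp closed_Collect_le closed_Collect_eq
      open_Collect_const continuous_intros continuous_on_product_coordinates)
  ultimately have "compact (S \<inter> ?C)" by (rule compact_Int_closed)
  also have "S \<inter> ?C = box_l1_dirs N lo hi x"
  proof (intro equalityI subsetI)
    fix h assume h: "h \<in> box_l1_dirs N lo hi x"
    have "h \<in> S" unfolding S_def
    proof (rule PiE_I)
      fix j
      show "h j \<in> (if j \<in> {1..N} then {-1..1} else {0})"
        using h unit_vector_coord[OF box_l1_dirs_unit[OF h], of j] by (auto simp: box_l1_dirs_def abs_le_iff)
    qed auto
    then show "h \<in> S \<inter> ?C" using h by (auto simp: box_l1_dirs_def)
  next
    fix h assume h: "h \<in> S \<inter> ?C"
    then have "h j = 0" if "j \<notin> {1..N}" for j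
      using that PiE_mem[of h UNIV "\<lambda>j. if j \<in> {1..N} then {-1..1::real} else {0}" j] unfolding S_def by auto
    then show "h \<in> box_l1_dirs N lo hi x" using h by (auto simp: box_l1_dirs_def)
  qed
  finally show ?thesis .
qed

text \<open>For \<open>x\<close> a coordinate of the solution: the squared distance of \<open>u\<close> to the set \<open>t * \<partial>\<bar>x\<bar>\<close>, enlarged by the
  normal cone of the box \<open>[lo, hi]\<close> at \<open>x\<close>.\<close>

definition dual_dist_sq :: "real \<Rightarrow> real \<Rightarrow> real \<Rightarrow> real \<Rightarrow> real \<Rightarrow> real" where
  "dual_dist_sq lo hi t x u = (if x = 0 then (max 0 (\<bar>u\<bar> - t))\<^sup>2
     else if x = lo then (excess (- t) u)\<^sup>2 else if x = hi then (excess (- t) (- u))\<^sup>2 else (u - t * sgn x)\<^sup>2)"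

text \<open>Weak duality: \<open>t\<close> is a Lagrange multiplier for the descent condition, and
  subtracting \<open>t\<close> times a nonpositive derivative can only increase the left-hand side.
  Each coordinate is then at most \<open>\<bar>h j\<bar>\<close> times a distance, with the sign of
  \<open>h j\<close> giving one-sided distances at the ends of the box; Cauchy-Schwarz with a unit
  vector finishes. Every \<open>t \<ge> 0\<close> is admissible, whence the infimum in the
  theorem.\<close>

lemma box_l1_dirs_dual:
  assumes h: "h \<in> box_l1_dirs N lo hi x" and t: "0 \<le> t" and lh: "lo < 0" "0 < hi"
  shows "(\<Sum>j=1..N. h j * g j) \<le> sqrt (\<Sum>j=1..N. dual_dist_sq lo hi t (x j) (g j))"
proof -
  define w where "w j = sqrt (dual_dist_sq lo hi t (x j) (g j))" for j
  have dd0: "0 \<le> dual_dist_sq lo hi t y u" for y u by (simp add: dual_dist_sq_def)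
  have "(\<Sum>j=1..N. h j * g j) \<le> (\<Sum>j=1..N. h j * g j) - t * (\<Sum>j=1..N. of_bool (x j = 0) * \<bar>h j\<bar> + sgn (x j) * h j)"
    using h t by (simp add: box_l1_dirs_def mult_nonneg_nonpos)
  also have "\<dots> = (\<Sum>j=1..N. h j * g j - t * (of_bool (x j = 0) * \<bar>h j\<bar> + sgn (x j) * h j))"
    by (simp only: sum_distrib_left sum_subtractf)
  also have "\<dots> \<le> (\<Sum>j=1..N. \<bar>h j\<bar> * \<bar>w j\<bar>)"
  proof (rule sum_mono)
    fix j assume j: "j \<in> {1..N}"
    consider "x j = 0" | "x j = lo" | "x j = hi" | "x j \<noteq> 0" "x j \<noteq> lo" "x j \<noteq> hi" by blast
    then show "h j * g j - t * (of_bool (x j = 0) * \<bar>h j\<bar> + sgn (x j) * h j) \<le> \<bar>h j\<bar> * \<bar>w j\<bar>"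
    proof cases
      case 1
      have "h j * g j \<le> \<bar>h j\<bar> * \<bar>g j\<bar>" using abs_ge_self[of "h j * g j"] by (simp add: abs_mult)
      then have "h j * g j - t * \<bar>h j\<bar> \<le> \<bar>h j\<bar> * (\<bar>g j\<bar> - t)" by (simp add: algebra_simps)
      also have "\<dots> \<le> \<bar>h j\<bar> * max 0 (\<bar>g j\<bar> - t)" by (intro mult_left_mono) auto
      finally show ?thesis using 1 by (simp add: w_def dual_dist_sq_def)
    next
      case 2
      have hj: "0 \<le> h j" using h j 2 by (auto simp: box_l1_dirs_def)
      have "h j * (g j + t) \<le> h j * max 0 (g j + t)" using hj by (intro mult_left_mono) auto
      then show ?thesis using 2 lh hj by (simp add: w_def dual_dist_sq_def excess_def algebra_simps)
    next
      case 3
      have hj: "h j \<le> 0" using h j 3 by (auto simp: box_l1_dirs_def)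
      have "- h j * (t - g j) \<le> - h j * max 0 (t - g j)" using hj by (intro mult_left_mono) auto
      then show ?thesis using 3 lh hj by (simp add: w_def dual_dist_sq_def excess_def algebra_simps)
    next
      case 4
      have "h j * (g j - t * sgn (x j)) \<le> \<bar>h j\<bar> * \<bar>g j - t * sgn (x j)\<bar>"
        using abs_ge_self[of "h j * (g j - t * sgn (x j))"] by (simp add: abs_mult)
      then show ?thesis using 4 by (simp add: w_def dual_dist_sq_def algebra_simps)
    qed
  qed
  also have "\<dots> \<le> L2_set h {1..N} * L2_set w {1..N}" by (rule L2_set_mult_ineq)
  also have "L2_set h {1..N} = 1" using box_l1_dirs_unit[OF h] by (simp add: L2_set_def)
  also have "L2_set w {1..N} = sqrt (\<Sum>j=1..N. dual_dist_sq lo hi t (x j) (g j))"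
    unfolding L2_set_def w_def by (simp add: dd0)
  finally show ?thesis by simp
qed

text \<open>Each case is a squared one-sided excess, up to reflection, or the sum of two such
  squares that are never nonzero together.\<close>

lemma sub_chi_sq_dual_dist:
  assumes "0 \<le> t"
  shows "sub_chi_sq (dual_dist_sq lo hi t x)"
proof -
  have refl: "sub_chi_sq (\<lambda>u. (excess s (- u))\<^sup>2)" for s
    using sub_chi_sq_reflect[OF sub_chi_sq_excess[of s]] .
  have 1: "sub_chi_sq (\<lambda>u. (max 0 (\<bar>u\<bar> - t))\<^sup>2)"
  proof -
    have "(max 0 (\<bar>u\<bar> - t))\<^sup>2 = (excess t u)\<^sup>2 + (excess t (- u))\<^sup>2" for u
      using assms by (cases "0 \<le> u") (auto simp: excess_def max_def)
    moreover have "(excess t u)\<^sup>2 = 0 \<or> (excess t (- u))\<^sup>2 = 0" for u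
      using assms by (auto simp: excess_def max_def)
    ultimately show ?thesis using sub_chi_sq_add[OF sub_chi_sq_excess refl] by presburger
  qed
  have 2: "sub_chi_sq (\<lambda>u. (u - c)\<^sup>2)" for c
  proof -
    have "(u - c)\<^sup>2 = (excess c u)\<^sup>2 + (excess (- c) (- u))\<^sup>2" for u
      by (auto simp: excess_def max_def power2_commute)
    moreover have "(excess c u)\<^sup>2 = 0 \<or> (excess (- c) (- u))\<^sup>2 = 0" for u
      by (auto simp: excess_def max_def)
    ultimately show ?thesis using sub_chi_sq_add[OF sub_chi_sq_excess refl] by presburger
  qed
  show ?thesis
    unfolding dual_dist_sq_def[abs_def]
    by (cases "x = 0"; cases "x = lo"; cases "x = hi") (simp_all add: 1 2 refl sub_chi_sq_excess)
qed

text \<open>A competitor \<open>y\<close> gives the normalised direction \<open>y - x\<close>, by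
  convexity of the absolute value. The converse rests on integrality: coordinates of a unit vector
  are at most 1 in modulus, while a coordinate of \<open>x\<close> off a bound is at distance at
  least 1 from it and a nonzero coordinate at distance at least 1 from 0. Hence the full step
  \<open>x + h\<close> stays in the box and the l1 norm is linear along it.\<close>

lemma unique_box_l1_solution_iff:
  fixes x :: "nat \<Rightarrow> real" and a :: "nat \<times> nat \<Rightarrow> real"
  assumes m: "1 \<le> m" and L: "0 < L1" "0 < L2"
    and x: "\<And>j. j \<in> {1..N} \<Longrightarrow> \<exists>k::int. x j = of_int k \<and> - int L1 \<le> k \<and> k \<le> int L2"
  shows "unique_box_l1_solution m N (gauss_matrix m a) (\<lambda>i. \<Sum>j\<in>{1..N}. gauss_matrix m a i j * x j) (- real L1) (real L2) x
    \<longleftrightarrow> \<not> (\<exists>h\<in>box_l1_dirs N (- real L1) (real L2) x. \<forall>i\<in>{1..m}. (\<Sum>j=1..N. h j * a (i, j)) = 0)"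
    (is "?U \<longleftrightarrow> \<not> ?D")
proof -
  have gm: "(\<Sum>j=1..N. gauss_matrix m a i j * y j) = (\<Sum>j=1..N. y j * a (i, j)) / sqrt (real m)" for i y
    by (simp add: gauss_matrix_def sum_divide_distrib mult.commute)
  have sm: "sqrt (real m) \<noteq> 0" using m by simp
  define b where "b i = (\<Sum>j\<in>{1..N}. gauss_matrix m a i j * x j)" for i
  have feas: "feasible m N (gauss_matrix m a) b (- real L1) (real L2) y \<longleftrightarrow>
      (\<forall>j\<in>{1..N}. - real L1 \<le> y j \<and> y j \<le> real L2) \<and> (\<forall>i\<in>{1..m}. (\<Sum>j=1..N. (y j - x j) * a (i, j)) = 0)" for y
    unfolding feasible_def b_def gm using sm by (simp add: left_diff_distrib sum_subtractf)
  have xb: "- real L1 \<le> x j \<and> x j \<le> real L2" if j: "j \<in> {1..N}" for j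
  proof -
    obtain k :: int where "x j = of_int k" "- int L1 \<le> k" "k \<le> int L2" using x[OF j] by auto
    then show ?thesis by linarith
  qed
  have "?D" if nU: "\<not> ?U"
  proof -
    have "feasible m N (gauss_matrix m a) b (- real L1) (real L2) x"
      unfolding feas using xb by simp
    then obtain y j0 where y: "feasible m N (gauss_matrix m a) b (- real L1) (real L2) y" "j0 \<in> {1..N}" "y j0 \<noteq> x j0"
      "l1norm N y \<le> l1norm N x"
      using nU unfolding unique_box_l1_solution_def b_def[symmetric] by (auto simp: not_less)
    define s where "s = sqrt (\<Sum>j=1..N. (y j - x j)\<^sup>2)"
    have "0 < (\<Sum>j=1..N. (y j - x j)\<^sup>2)"
      by (rule sum_pos2[OF _ y(2)]) (use y(3) in auto)
    then have s: "0 < s" "s\<^sup>2 = (\<Sum>j=1..N. (y j - x j)\<^sup>2)" by (auto simp: s_def)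
    define h where "h j = (if j \<in> {1..N} then (y j - x j) / s else 0)" for j
    have hj: "h j = (y j - x j) / s" if "j \<in> {1..N}" for j using that by (simp add: h_def)
    have "h \<in> box_l1_dirs N (- real L1) (real L2) x"
      unfolding box_l1_dirs_def
    proof (intro CollectI conjI ballI allI impI)
      fix j assume j: "j \<in> {1..N}"
      have yj: "- real L1 \<le> y j" "y j \<le> real L2" using y(1) j unfolding feas by auto
      show "0 \<le> h j" if "x j = - real L1" unfolding hj[OF j] using yj s that by (intro divide_nonneg_pos) auto
      show "h j \<le> 0" if "x j = real L2" unfolding hj[OF j] using yj s that by (intro divide_nonpos_pos) auto
    next
      have "(\<Sum>j=1..N. of_bool (x j = 0) * \<bar>h j\<bar> + sgn (x j) * h j)
          \<le> (\<Sum>j=1..N. (\<bar>y j\<bar> - \<bar>x j\<bar>) / s)"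
      proof (rule sum_mono)
        fix j assume j: "j \<in> {1..N}"
        have "of_bool (x j = 0) * \<bar>y j - x j\<bar> + sgn (x j) * (y j - x j) \<le> \<bar>y j\<bar> - \<bar>x j\<bar>"
          by (cases "x j" "0::real" rule: linorder_cases) (auto simp: sgn_if)
        then have "(of_bool (x j = 0) * \<bar>y j - x j\<bar> + sgn (x j) * (y j - x j)) / s \<le> (\<bar>y j\<bar> - \<bar>x j\<bar>) / s"
          using s by (intro divide_right_mono) auto
        then show "of_bool (x j = 0) * \<bar>h j\<bar> + sgn (x j) * h j \<le> (\<bar>y j\<bar> - \<bar>x j\<bar>) / s"
          unfolding hj[OF j] using s by (simp add: add_divide_distrib abs_divide)
      qed
      also have "\<dots> = (l1norm N y - l1norm N x) / s"
        by (simp add: l1norm_def sum_divide_distrib[symmetric] sum_subtractf)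
      also have "\<dots> \<le> 0" using y(4) s by (simp add: divide_le_0_iff)
      finally show "(\<Sum>j=1..N. of_bool (x j = 0) * \<bar>h j\<bar> + sgn (x j) * h j) \<le> 0" .
      have "(\<Sum>j=1..N. (h j)\<^sup>2) = (\<Sum>j=1..N. (y j - x j)\<^sup>2 / s\<^sup>2)"
        by (intro sum.cong refl) (simp only: hj power_divide)
      then show "(\<Sum>j=1..N. (h j)\<^sup>2) = 1" using s zero_less_power[OF s(1), of 2] by (simp add: sum_divide_distrib[symmetric])
    qed (auto simp: h_def)
    moreover have "\<forall>i\<in>{1..m}. (\<Sum>j=1..N. h j * a (i, j)) = 0"
    proof
      fix i assume i: "i \<in> {1..m}"
      have "(\<Sum>j=1..N. h j * a (i, j)) = (\<Sum>j=1..N. (y j - x j) * a (i, j) / s)"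
        by (intro sum.cong refl) (simp add: hj)
      then show "(\<Sum>j=1..N. h j * a (i, j)) = 0"
        using y(1) i unfolding feas by (simp add: sum_divide_distrib[symmetric])
    qed
    ultimately show ?D by blast
  qed
  moreover have "\<not> ?U" if D: ?D
  proof -
    obtain h where h: "h \<in> box_l1_dirs N (- real L1) (real L2) x" and ker: "\<forall>i\<in>{1..m}. (\<Sum>j=1..N. h j * a (i, j)) = 0"
      using D by blast
    define y where "y j = x j + h j" for j
    have h1: "\<bar>h j\<bar> \<le> 1" if "j \<in> {1..N}" for j
      by (rule unit_vector_coord[OF box_l1_dirs_unit[OF h] that])
    have "- real L1 \<le> y j \<and> y j \<le> real L2" if j: "j \<in> {1..N}" for j
    proof -
      obtain k :: int where k: "x j = of_int k" "- int L1 \<le> k" "k \<le> int L2" using x[OF j] by auto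
      have lo: "x j = - real L1 \<Longrightarrow> 0 \<le> h j" and hi: "x j = real L2 \<Longrightarrow> h j \<le> 0"
        using h j by (auto simp: box_l1_dirs_def)
      have "k = - int L1 \<or> - int L1 + 1 \<le> k" "k = int L2 \<or> k \<le> int L2 - 1" using k by auto
      then have "x j = - real L1 \<or> - real L1 + 1 \<le> x j" "x j = real L2 \<or> x j \<le> real L2 - 1"
        using k(1) by linarith+
      moreover have "1 \<le> real L1" "1 \<le> real L2" using L by auto
      ultimately show ?thesis using lo hi h1[OF j] unfolding y_def by (auto simp: abs_le_iff)
    qed
    then have fy: "feasible m N (gauss_matrix m a) b (- real L1) (real L2) y"
      unfolding feas using ker by (simp add: y_def)
    have "l1norm N y = (\<Sum>j=1..N. \<bar>x j\<bar> + (of_bool (x j = 0) * \<bar>h j\<bar> + sgn (x j) * h j))"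
      unfolding l1norm_def
    proof (rule sum.cong[OF refl])
      fix j assume j: "j \<in> {1..N}"
      obtain k :: int where k: "x j = of_int k" using x[OF j] by auto
      consider "k = 0" | "1 \<le> k" | "k \<le> -1" by linarith
      then show "\<bar>y j\<bar> = \<bar>x j\<bar> + (of_bool (x j = 0) * \<bar>h j\<bar> + sgn (x j) * h j)"
      proof cases
        case 2
        then have "1 \<le> x j" using k by simp
        then show ?thesis using h1[OF j] by (auto simp: y_def abs_le_iff)
      next
        case 3
        then have "x j \<le> -1" using k by linarith
        then show ?thesis using h1[OF j] by (auto simp: y_def abs_le_iff)
      qed (simp add: y_def k)
    qed
    also have "\<dots> = l1norm N x + (\<Sum>j=1..N. of_bool (x j = 0) * \<bar>h j\<bar> + sgn (x j) * h j)"
      by (simp add: l1norm_def sum.distrib)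
    also have "\<dots> \<le> l1norm N x" using h by (simp add: box_l1_dirs_def)
    finally have le: "l1norm N y \<le> l1norm N x" .
    have "\<exists>j\<in>{1..N}. y j \<noteq> x j"
    proof (rule ccontr)
      assume "\<not> (\<exists>j\<in>{1..N}. y j \<noteq> x j)"
      then have "(\<Sum>j=1..N. (h j)\<^sup>2) = 0" by (intro sum.neutral) (auto simp: y_def)
      then show False using box_l1_dirs_unit[OF h] by simp
    qed
    then show "\<not> ?U" using fy le unfolding unique_box_l1_solution_def b_def[symmetric] by fastforce
  qed
  ultimately show ?thesis by blast
qed

section \<open>Square Gaussian matrices are almost surely nonsingular\<close>

definition multi_affine :: "'i set \<Rightarrow> (('i \<Rightarrow> real) \<Rightarrow> real) \<Rightarrow> bool" where
  "multi_affine I f \<longleftrightarrow> (\<forall>a. \<forall>e\<in>I. \<forall>x. f (a(e := x)) = f (a(e := 0)) + x * (f (a(e := 1)) - f (a(e := 0))))"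

lemma AE_std_gauss_affine_nonzero:
  assumes "u \<noteq> 0 \<or> v \<noteq> (0::real)"
  shows "AE x in std_gauss. u + x * v \<noteq> 0"
proof (cases "v = 0")
  case False
  have "AE x in lborel. 0 < ennreal (std_normal_density x) \<longrightarrow> x \<noteq> - u / v"
    using AE_lborel_singleton[of "- u / v"] by eventually_elim simp
  then have "AE x in std_gauss. x \<noteq> - u / v" unfolding std_gauss_def by (subst AE_density) auto
  then show ?thesis
  proof (rule eventually_mono)
    show "u + x * v \<noteq> 0" if "x \<noteq> - u / v" for x
    proof
      assume "u + x * v = 0"
      then have "x * v = - u" by simp
      have "x = x * v / v" using False by simp
      also have "\<dots> = - u / v" by (simp only: \<open>x * v = - u\<close>)
      finally have "x = - u / v" .
      then show False using that by simp
    qed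
  qed
qed (use assms in simp)

text \<open>Induction on the coordinates: fixing one of them at 0 or at 1 leaves multi-affine
  functions, at least one of which is not identically zero. Almost surely, then, the function is a
  nonzero affine function of that coordinate and has at most one root, a null set; Fubini
  concludes.\<close>

lemma AE_multi_affine_nonzero:
  fixes f :: "('i \<Rightarrow> real) \<Rightarrow> real"
  assumes "finite I" "f \<in> borel_measurable (gauss I)" "multi_affine I f"
    and "\<And>a b. (\<And>i. i \<in> I \<Longrightarrow> a i = b i) \<Longrightarrow> f a = f b" and "\<exists>a. f a \<noteq> 0"
  shows "AE a in gauss I. f a \<noteq> 0"
  using assms
proof (induction I arbitrary: f rule: finite_induct)
  case empty
  have "f a \<noteq> 0" for a using empty(4) empty(3)[of a] by force
  then show ?case by simp
next
  case (insert e I)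
  note [measurable] = insert.prems(1)
  define g where "g c a = f (a(e := c))" for c a
  have upd: "(\<lambda>a. a(e := c)) \<in> gauss I \<rightarrow>\<^sub>M gauss (insert e I)" for c
    by (rule measurable_fun_upd[where J = I]) (auto simp: space_std_gauss)
  have g_nz: "AE a in gauss I. g c a \<noteq> 0" if nz: "\<exists>a. g c a \<noteq> 0" for c
  proof (rule insert.IH)
    show "g c \<in> borel_measurable (gauss I)"
      unfolding g_def by (rule measurable_compose[OF upd insert.prems(1)])
    show "multi_affine I (g c)"
      unfolding multi_affine_def
    proof (intro allI ballI)
      fix a i x assume i: "i \<in> I"
      then have "i \<noteq> e" using insert.hyps by auto
      then have tw: "(a(i := y))(e := c) = (a(e := c))(i := y)" for y by (simp add: fun_upd_twist)
      show "g c (a(i := x)) = g c (a(i := 0)) + x * (g c (a(i := 1)) - g c (a(i := 0)))"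
        using insert.prems(2) i unfolding multi_affine_def g_def tw by blast
    qed
    show "g c a = g c b" if "\<And>i. i \<in> I \<Longrightarrow> a i = b i" for a b
      unfolding g_def by (rule insert.prems(3)) (use that in auto)
  qed fact
  have fg: "f (a(e := x)) = g 0 a + x * (g 1 a - g 0 a)" for a x
    using insert.prems(2) unfolding multi_affine_def g_def by blast
  have "AE a in gauss I. g 0 a \<noteq> 0 \<or> g 1 a \<noteq> 0"
  proof -
    obtain a where a: "f a \<noteq> 0" using insert.prems(4) by blast
    have "f a = g 0 a + a e * (g 1 a - g 0 a)" using fg[of a "a e"] by simp
    then have "g 0 a \<noteq> 0 \<or> g 1 a \<noteq> 0" using a by auto
    then show ?thesis
    proof
      assume "g 0 a \<noteq> 0"
      then have "AE a in gauss I. g 0 a \<noteq> 0" by (intro g_nz) blast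
      then show ?thesis by (rule eventually_mono) simp
    next
      assume "g 1 a \<noteq> 0"
      then have "AE a in gauss I. g 1 a \<noteq> 0" by (intro g_nz) blast
      then show ?thesis by (rule eventually_mono) simp
    qed
  qed
  then have ae: "AE a in gauss I. AE x in std_gauss. f (a(e := x)) \<noteq> 0"
    unfolding fg by eventually_elim (rule AE_std_gauss_affine_nonzero, auto)
  let ?B = "{a \<in> space (gauss (insert e I)). \<not> f a \<noteq> 0}"
  have B: "?B \<in> sets (gauss (insert e I))" by measurable
  have "(\<integral>\<^sup>+ a. indicator ?B a \<partial>gauss (insert e I)) = (\<integral>\<^sup>+ a. (\<integral>\<^sup>+ x. indicator ?B (a(e := x)) \<partial>std_gauss) \<partial>gauss I)"
    using B insert.hyps by (intro std_gauss_prod.product_nn_integral_insert) auto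
  also have "\<dots> = (\<integral>\<^sup>+ a. 0 \<partial>gauss I)"
  proof (rule nn_integral_cong_AE)
    show "AE a in gauss I. (\<integral>\<^sup>+ x. indicator ?B (a(e := x)) \<partial>std_gauss) = 0"
      using ae
    proof eventually_elim
      case (elim a)
      have "(\<integral>\<^sup>+ x. indicator ?B (a(e := x)) \<partial>std_gauss) = (\<integral>\<^sup>+ x. 0 \<partial>std_gauss)"
        by (rule nn_integral_cong_AE) (use elim in \<open>auto elim!: eventually_mono simp: indicator_def\<close>)
      then show ?case by simp
    qed
  qed
  finally have "(\<integral>\<^sup>+ a. indicator ?B a \<partial>gauss (insert e I)) = 0" by simp
  then show ?case
    by (subst AE_iff_measurable[OF B refl]) (simp only: nn_integral_indicator[OF B])
qed

text \<open>Leibniz formula for the determinant of the first \<open>N\<close> rows. The shifts by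
  \<open>Suc\<close> translate between the array, indexed from 1, and matrices, indexed from
  0.\<close>

definition det_rows :: "nat \<Rightarrow> (nat \<times> nat \<Rightarrow> real) \<Rightarrow> real" where
  "det_rows N a = (\<Sum>p | p permutes {0..<N}. signof p * (\<Prod>i = 0..<N. a (Suc i, Suc (p i))))"

lemma det_rows_eq: "det_rows N a = Determinant.det (mat N N (\<lambda>(i, j). a (Suc i, Suc j)))"
  unfolding det_rows_def
  by (subst det_def'[of _ N]) (auto intro!: sum.cong prod.cong simp: permutes_in_image)

lemma multi_affine_det_rows: "multi_affine I (det_rows N)"
  unfolding multi_affine_def
proof (intro allI ballI)
  fix a :: "nat \<times> nat \<Rightarrow> real" and e x
  define P where "P y p = (\<Prod>i = 0..<N. (a(e := y)) (Suc i, Suc (p i)))" for y p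
  have lin: "P x p = P 0 p + x * (P 1 p - P 0 p)" for p
  proof (cases "\<exists>k<N. e = (Suc k, Suc (p k))")
    case True
    then obtain k where k: "k < N" "e = (Suc k, Suc (p k))" by blast
    have "P y p = y * (\<Prod>i \<in> {0..<N} - {k}. a (Suc i, Suc (p i)))" for y
      unfolding P_def using k by (subst prod.remove[of _ k]) (auto intro!: prod.cong)
    then show ?thesis by simp
  next
    case False
    then have "P y p = (\<Prod>i = 0..<N. a (Suc i, Suc (p i)))" for y
      unfolding P_def by (intro prod.cong) auto
    then show ?thesis by simp
  qed
  have d: "det_rows N (a(e := y)) = (\<Sum>p | p permutes {0..<N}. signof p * P y p)" for y
    by (simp add: det_rows_def P_def)
  have "det_rows N (a(e := x)) = (\<Sum>p | p permutes {0..<N}. signof p * P 0 p + x * (signof p * P 1 p - signof p * P 0 p))"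
    unfolding d by (subst lin) (simp add: algebra_simps)
  then show "det_rows N (a(e := x)) = det_rows N (a(e := 0)) + x * (det_rows N (a(e := 1)) - det_rows N (a(e := 0)))"
    unfolding d by (simp only: sum.distrib sum_distrib_left[symmetric] sum_subtractf)
qed

text \<open>Already the first \<open>N\<close> rows form an almost surely nonsingular square matrix,
  because its determinant is a nonzero multi-affine function of the entries.\<close>

theorem AE_gauss_kernel_trivial:
  fixes m N :: nat
  assumes "N \<le> m"
  shows "AE a in gauss ({1..m} \<times> {1..N}). \<forall>h. (\<forall>i\<in>{1..m}. (\<Sum>j=1..N. h j * a (i, j)) = 0) \<longrightarrow> (\<forall>j\<in>{1..N}. h j = 0)"
proof -
  let ?I = "{1..m} \<times> {1..N}"
  have idx: "(Suc i, Suc (p i)) \<in> ?I" if "p permutes {0..<N}" "i < N" for p i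
    using permutes_in_image[OF that(1), of i] that(2) assms by auto
  have "AE a in gauss ?I. det_rows N a \<noteq> 0"
  proof (rule AE_multi_affine_nonzero)
    show "finite ?I" by simp
    show "det_rows N \<in> borel_measurable (gauss ?I)"
      unfolding det_rows_def
    proof (intro borel_measurable_sum borel_measurable_times borel_measurable_const borel_measurable_prod)
      fix p i assume "p \<in> {p. p permutes {0..<N}}" "i \<in> {0..<N}"
      then have "(Suc i, Suc (p i)) \<in> ?I" using idx by auto
      then show "(\<lambda>a. a (Suc i, Suc (p i))) \<in> borel_measurable (gauss ?I)"
        using measurable_component_singleton[of "(Suc i, Suc (p i))" ?I "\<lambda>_. std_gauss"] by simp
    qed
    show "multi_affine ?I (det_rows N)" by (rule multi_affine_det_rows)
    show "det_rows N a = det_rows N b" if ab: "\<And>i. i \<in> ?I \<Longrightarrow> a i = b i" for a b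
      unfolding det_rows_def
    proof (intro sum.cong refl arg_cong2[where f = "(*)"] prod.cong)
      fix p i assume "p \<in> {p. p permutes {0..<N}}" "i \<in> {0..<N}"
      then show "a (Suc i, Suc (p i)) = b (Suc i, Suc (p i))" using idx by (intro ab) auto
    qed
    \<comment> \<open>The identity array witnesses that the determinant is not the zero
      function.\<close>
    have "mat N N (\<lambda>(i, j). (\<lambda>(i, j). if i = j then 1 else 0) (Suc i, Suc j)) = (1\<^sub>m N :: real mat)"
      by (rule eq_matI) auto
    then have "det_rows N (\<lambda>(i, j). if i = j then 1 else 0) = 1" unfolding det_rows_eq by simp
    then show "\<exists>a. det_rows N a \<noteq> 0" by (intro exI[of _ "\<lambda>(i, j). if i = j then 1 else 0"]) simp
  qed
  then show ?thesis
  proof eventually_elim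
    case (elim a)
    show ?case
    proof (intro allI impI ballI)
      fix h :: "nat \<Rightarrow> real" and j assume h: "\<forall>i\<in>{1..m}. (\<Sum>j=1..N. h j * a (i, j)) = 0" and j: "j \<in> {1..N}"
      let ?A = "mat N N (\<lambda>(i, j). a (Suc i, Suc j))" and ?v = "Matrix.vec N (\<lambda>j. h (Suc j))"
      have "?A *\<^sub>v ?v = 0\<^sub>v N"
      proof (rule eq_vecI)
        fix i assume "i < dim_vec (0\<^sub>v N :: real Matrix.vec)"
        then have i: "i < N" by simp
        have "vec_index (?A *\<^sub>v ?v) i = (\<Sum>j = 0..<N. h (Suc j) * a (Suc i, Suc j))"
          using i by (simp add: scalar_prod_def mult.commute)
        also have "\<dots> = (\<Sum>j=1..N. h j * a (Suc i, j))"
          by (rule sum.reindex_bij_witness[of _ "\<lambda>j. j - 1" Suc]) auto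
        also have "\<dots> = 0" using h i assms by auto
        finally show "vec_index (?A *\<^sub>v ?v) i = vec_index (0\<^sub>v N) i" using i by simp
      qed simp
      moreover have "Determinant.det ?A \<noteq> 0" using elim by (simp add: det_rows_eq)
      moreover have "?A \<in> carrier_mat N N" "?v \<in> carrier_vec N" by auto
      ultimately have v0: "?v = 0\<^sub>v N"
        using det_0_iff_vec_prod_zero_field[of ?A N] by blast
      have j': "j - 1 < N" "Suc (j - 1) = j" using j by auto
      have "h j = vec_index ?v (j - 1)" using index_vec[OF j'(1), of "\<lambda>j. h (Suc j)"] j'(2) by simp
      also have "\<dots> = 0" unfolding v0 by (rule index_zero_vec(1)[OF j'(1)])
      finally show "h j = 0" .
    qed
  qed
qed

section \<open>The failure probability\<close>

text \<open>Translates the integrals of the hypothesis into Gaussian means. The second one is the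
  mirror image of the first, so both ends of the box contribute the same integral.\<close>

lemma set_integral_excess:
  "(LINT u:{-t..}|lborel. (u + t)\<^sup>2 * phi u) = (\<integral>u. (excess (- t) u)\<^sup>2 \<partial>std_gauss)"
  "(LINT u:{..t}|lborel. (u - t)\<^sup>2 * phi u) = (\<integral>u. (excess (- t) u)\<^sup>2 \<partial>std_gauss)"
  "(LINT u:{t..}|lborel. (u - t)\<^sup>2 * phi u) = (\<integral>u. (excess t u)\<^sup>2 \<partial>std_gauss)"
proof -
  have r: "(LINT u:{s..}|lborel. (u - s)\<^sup>2 * phi u) = (\<integral>u. (excess s u)\<^sup>2 \<partial>std_gauss)" for s
    unfolding set_lebesgue_integral_def
    by (subst integral_std_gauss) (auto intro!: Bochner_Integration.integral_cong simp: excess_def phi_def indicator_def max_def)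
  show "(LINT u:{-t..}|lborel. (u + t)\<^sup>2 * phi u) = (\<integral>u. (excess (- t) u)\<^sup>2 \<partial>std_gauss)"
    using r[of "- t"] by simp
  show "(LINT u:{t..}|lborel. (u - t)\<^sup>2 * phi u) = (\<integral>u. (excess t u)\<^sup>2 \<partial>std_gauss)" by (rule r)
  have "(LINT u:{..t}|lborel. (u - t)\<^sup>2 * phi u) = (\<integral>u. (excess (- t) (- u))\<^sup>2 \<partial>std_gauss)"
    unfolding set_lebesgue_integral_def
    by (subst integral_std_gauss)
       (auto intro!: Bochner_Integration.integral_cong simp: excess_def phi_def indicator_def max_def power2_commute)
  also have "\<dots> = (\<integral>u. (excess (- t) u)\<^sup>2 \<partial>std_gauss)"
    using integral_std_gauss_reflect(1)[of "\<lambda>u. (excess (- t) u)\<^sup>2"] by simp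
  finally show "(LINT u:{..t}|lborel. (u - t)\<^sup>2 * phi u) = (\<integral>u. (excess (- t) u)\<^sup>2 \<partial>std_gauss)" .
qed

lemma std_gauss_square_shift: "(\<integral>u. (u - c)\<^sup>2 \<partial>std_gauss) = 1 + c\<^sup>2"
proof -
  have i2: "integrable std_gauss (\<lambda>u. u\<^sup>2)" "(\<integral>u. u\<^sup>2 \<partial>std_gauss) = 1"
    using integrable_std_normal_moment[of 2] integral_std_normal_moment_even[of 1]
    by (auto simp: integrable_std_gauss_iff integral_std_gauss)
  have "(\<integral>u. (u - c)\<^sup>2 \<partial>std_gauss) = (\<integral>u. u\<^sup>2 - 2 * c * u + c\<^sup>2 \<partial>std_gauss)"
    by (simp add: power2_diff algebra_simps)
  also have "\<dots> = 1 + c\<^sup>2" using i2 std_gauss_mean by simp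
  finally show ?thesis .
qed

text \<open>These means are the weights of the single coordinates in the quantity that the theorem
  minimises over \<open>\<tau>\<close>.\<close>

lemma integral_dual_dist_sq:
  assumes "0 \<le> t"
  shows "(\<integral>u. dual_dist_sq lo hi t x u \<partial>std_gauss) =
    (if x = 0 then 2 * (\<integral>u. (excess t u)\<^sup>2 \<partial>std_gauss)
     else if x = lo \<or> x = hi then (\<integral>u. (excess (- t) u)\<^sup>2 \<partial>std_gauss) else 1 + t\<^sup>2)"
proof -
  have refl: "(\<integral>u. (excess s (- u))\<^sup>2 \<partial>std_gauss) = (\<integral>u. (excess s u)\<^sup>2 \<partial>std_gauss)"
    "integrable std_gauss (\<lambda>u. (excess s (- u))\<^sup>2)" for s
    using integral_std_gauss_reflect[of "\<lambda>u. (excess s u)\<^sup>2"] excess_sq_int[of s] by auto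
  have "(max 0 (\<bar>u\<bar> - t))\<^sup>2 = (excess t u)\<^sup>2 + (excess t (- u))\<^sup>2" for u
    using assms by (cases "0 \<le> u") (auto simp: excess_def max_def)
  then have 0: "(\<integral>u. (max 0 (\<bar>u\<bar> - t))\<^sup>2 \<partial>std_gauss) = 2 * (\<integral>u. (excess t u)\<^sup>2 \<partial>std_gauss)"
    using excess_sq_int refl by simp
  have s: "x \<noteq> 0 \<Longrightarrow> (t * sgn x)\<^sup>2 = t\<^sup>2" by (simp add: sgn_if)
  show ?thesis
    unfolding dual_dist_sq_def
    by (cases "x = 0"; cases "x = lo"; cases "x = hi") (simp_all add: 0 refl std_gauss_square_shift s)
qed

text \<open>Multiplying \<open>t\<close> by the conjugate sum of roots gives \<open>T - 2\<close>,
  one unit each from \<open>m - 1\<close> and from the slack in \<open>M\<close>. The sum is at most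
  \<open>2 * sqrt N\<close>, so \<open>t\<^sup>2\<close> is at least
  \<open>(T - 2)\<^sup>2 / (4 * N)\<close>, and \<open>T\<^sup>2 = 8 * L * N\<close> together with
  \<open>T \<le> N\<close> makes this at least \<open>2 * L - 1\<close>.\<close>

lemma failure_exponent_bound:
  fixes m N :: nat and L T M t :: real
  assumes L: "1 \<le> L" and T: "T = sqrt (8 * L * real N)" and mN: "m < N" "T \<le> real m"
    and M: "M = real m - T + 1"
    and t: "t = sqrt (real m - 1) - sqrt M"
    and M0: "0 < M"
  shows "0 < t" "exp (- t\<^sup>2) \<le> exp (1 - 2 * L)"
proof -
  have T0: "0 \<le> T" using L T by simp
  have T2: "T\<^sup>2 = 8 * L * real N" using L T by simp
  have TN: "T \<le> real N" using mN by simp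
  have N0: "0 < real N" using mN by simp
  \<comment> \<open>From \<open>T \<le> N\<close> one gets \<open>8 * L \<le> N\<close> and then
    \<open>T \<ge> 8\<close>. This makes \<open>T - 2\<close> and \<open>m - 1\<close> nonnegative,
    so that squares and roots may be taken, and it yields \<open>M \<le> N\<close>.\<close>
  have "8 * L * real N \<le> real N * real N"
    using mult_mono[OF TN TN] T0 T2 by (simp add: power2_eq_square)
  then have "8 * L \<le> real N" using N0 by simp
  then have N8: "8 \<le> real N" using L by simp
  have "8 * 1 * 8 \<le> 8 * L * real N" using L N8 by (intro mult_mono) auto
  then have "8\<^sup>2 \<le> T\<^sup>2" using T2 by simp
  then have T8: "8 \<le> T" using T0 by (rule power2_le_imp_le)
  have a: "0 \<le> real m - 1" using T8 mN by simp
  let ?s = "sqrt (real m - 1) + sqrt M"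
  have ts: "t * ?s = T - 2"
  proof -
    have "t * ?s = (sqrt (real m - 1))\<^sup>2 - (sqrt M)\<^sup>2" unfolding t by (simp add: power2_eq_square algebra_simps)
    then show ?thesis using a M0 M by simp
  qed
  have s: "0 < ?s" "?s \<le> 2 * sqrt (real N)"
  proof -
    show "0 < ?s" using a M0 by (simp add: add_nonneg_pos)
    have "sqrt (real m - 1) \<le> sqrt (real N)" "sqrt M \<le> sqrt (real N)" using mN M T8 by auto
    then show "?s \<le> 2 * sqrt (real N)" by linarith
  qed
  have "0 < t * ?s" using ts T8 by simp
  then show t0: "0 < t" by (rule zero_less_mult_pos2[OF _ s(1)])
  have "T - 2 \<le> t * (2 * sqrt (real N))" using ts mult_left_mono[OF s(2), of t] t0 by simp
  then have "(T - 2)\<^sup>2 \<le> (t * (2 * sqrt (real N)))\<^sup>2" using T8 by (intro power_mono) auto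
  also have "\<dots> = t\<^sup>2 * (4 * real N)" by (simp add: power_mult_distrib)
  finally have "T\<^sup>2 - 4 * T + 4 \<le> t\<^sup>2 * (4 * real N)" by (simp add: power2_diff)
  then have "(2 * L - 1) * (4 * real N) \<le> t\<^sup>2 * (4 * real N)" using T2 TN by (simp add: algebra_simps)
  then have "2 * L - 1 \<le> t\<^sup>2" using N0 by simp
  then show "exp (- t\<^sup>2) \<le> exp (1 - 2 * L)" by simp
qed

theorem theorem4p9:
  fixes \<epsilon> :: real and L1 L2 m N :: nat and K :: "int \<Rightarrow> nat set"
  assumes eps: "\<epsilon> > 0"
    and L1: "L1 > 0" and L2: "L2 > 0"
    and disj: "\<forall>i\<in>{-int L1..int L2}. \<forall>j\<in>{-int L1..int L2}. i \<noteq> j \<longrightarrow> K i \<inter> K j = {}"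
    and cover: "(\<Union>i\<in>{-int L1..int L2}. K i) = {1..N}"
    and bound: "real m \<ge>
      (INF \<tau>\<in>{0::real..}.
          real (card ((\<Union>i\<in>{-int L1..int L2} - {0}. K i) - (K (- int L1) \<union> K (int L2)))) * (1 + \<tau>\<^sup>2)
        + real (card (K (- int L1))) * (LINT u:{-\<tau>..}|lborel. (u + \<tau>)\<^sup>2 * phi u)
        + real (card (K (int L2))) * (LINT u:{..\<tau>}|lborel. (u - \<tau>)\<^sup>2 * phi u)
        + 2 * real (card (K 0)) * (LINT u:{\<tau>..}|lborel. (u - \<tau>)\<^sup>2 * phi u))
      + sqrt (8 * ln (4 / \<epsilon>) * real N)"
  shows "measure (gaussian_entries m N)
           {a \<in> space (gaussian_entries m N).
              (let x0 = (\<lambda>j. \<Sum>i\<in>{-int L1..int L2}. real_of_int i * indicator (K i) j);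
                   A = gauss_matrix m a;
                   b = (\<lambda>i. \<Sum>j\<in>{1..N}. A i j * x0 j)
               in unique_box_l1_solution m N A b (- real L1) (real L2) x0)}
         > 1 - \<epsilon>"
proof -
  define P where "P = gauss ({1..m} \<times> {1..N})"
  have P: "gaussian_entries m N = P" by (simp add: gaussian_entries_def P_def std_gauss_def)
  interpret prob_space P unfolding P_def by (rule prob_space_gauss)
  define x where "x j = (\<Sum>i\<in>{-int L1..int L2}. real_of_int i * indicator (K i) j)" for j
  let ?lo = "- real L1" and ?hi = "real L2"
  define Ev where "Ev = {a \<in> space P. unique_box_l1_solution m N (gauss_matrix m a)
    (\<lambda>i. \<Sum>j\<in>{1..N}. gauss_matrix m a i j * x j) ?lo ?hi x}"
  have goal: "prob Ev > 1 - \<epsilon>"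
  proof -
    \<comment> \<open>For \<open>\<epsilon> > 1\<close> the claimed lower bound is negative, and for
      \<open>N = 0\<close> no competitor differs in a coordinate. In the remaining case
      \<open>ln (4 / \<epsilon>) \<ge> 1\<close> and the square root in the hypothesis is
      positive.\<close>
    consider "\<epsilon> > 1" | "N = 0" | "\<epsilon> \<le> 1" "1 \<le> N" by linarith
    then show ?thesis
    proof cases
      case 1
      then show ?thesis using measure_nonneg[of P Ev] by linarith
    next
      case 2
      then have "Ev = space P"
        by (auto simp: Ev_def unique_box_l1_solution_def feasible_def)
      then show ?thesis using eps by (simp add: prob_space)
    next
      case 3
      define L where "L = ln (4 / \<epsilon>)"
      define T where "T = sqrt (8 * L * real N)"
      have L: "1 \<le> L"
      proof -
        have "exp 1 \<le> (3::real)" by (rule exp_le)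
        also have "\<dots> \<le> 4 / \<epsilon>" using 3 eps by (simp add: pos_le_divide_eq)
        finally show ?thesis unfolding L_def using eps by (subst ln_ge_iff) auto
      qed
      have T0: "0 < T" using L 3 by (simp add: T_def)
      define f where "f t = real (card ((\<Union>i\<in>{-int L1..int L2} - {0}. K i) - (K (- int L1) \<union> K (int L2)))) * (1 + t\<^sup>2)
        + real (card (K (- int L1))) * (\<integral>u. (excess (- t) u)\<^sup>2 \<partial>std_gauss)
        + real (card (K (int L2))) * (\<integral>u. (excess (- t) u)\<^sup>2 \<partial>std_gauss)
        + 2 * real (card (K 0)) * (\<integral>u. (excess t u)\<^sup>2 \<partial>std_gauss)" for t
      have f0: "0 \<le> f t" for t
        unfolding f_def by (intro add_nonneg_nonneg mult_nonneg_nonneg Bochner_Integration.integral_nonneg) auto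
      have bnd: "(INF t\<in>{0..}. f t) + T \<le> real m"
        using bound unfolding set_integral_excess f_def T_def L_def .
      \<comment> \<open>Nonnegativity of the minimised quantity yields \<open>m \<ge> T > 0\<close>,
        so there is at least one row and division by \<open>sqrt m\<close> is legitimate.\<close>
      have "0 \<le> (INF t\<in>{0..}. f t)" using f0 by (intro cINF_greatest) auto
      then have m: "1 \<le> m" and Tm: "T \<le> real m" using bnd T0 by auto
      have xK: "x j = of_int i" if "i \<in> {-int L1..int L2}" "j \<in> K i" for i j
      proof -
        have "x j = (\<Sum>k\<in>{-int L1..int L2}. if k = i then of_int i else 0)"
          unfolding x_def
        proof (rule sum.cong[OF refl])
          fix k assume k: "k \<in> {-int L1..int L2}"
          have "j \<notin> K k" if "k \<noteq> i" using disj k \<open>i \<in> _\<close> \<open>j \<in> K i\<close> that by blast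
          then show "real_of_int k * indicator (K k) j = (if k = i then of_int i else 0)"
            using \<open>j \<in> K i\<close> by auto
        qed
        then show ?thesis using that by simp
      qed
      have xint: "\<exists>k::int. x j = of_int k \<and> - int L1 \<le> k \<and> k \<le> int L2" if "j \<in> {1..N}" for j
      proof -
        have "j \<in> (\<Union>i\<in>{-int L1..int L2}. K i)" using that cover by simp
        then obtain i where "i \<in> {-int L1..int L2}" "j \<in> K i" by blast
        then show ?thesis using xK by auto
      qed
      define U where "U = box_l1_dirs N ?lo ?hi x"
      define Fail where "Fail = {a \<in> space P. \<exists>h\<in>U. \<forall>i\<in>{1..m}. (\<Sum>j=1..N. h j * a (i, j)) = 0}"
      have Fail: "Fail \<in> events"
        unfolding Fail_def P_def U_def by (rule kernel_event_measurable[OF box_l1_dirs_unit compact_box_l1_dirs])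
      have "Ev = space P - Fail"
        unfolding Ev_def Fail_def U_def using unique_box_l1_solution_iff[OF m L1 L2 xint] by auto
      then have Ev: "prob Ev = 1 - prob Fail" using prob_compl[OF Fail] by simp
      have "prob Fail < \<epsilon>"
      proof (cases "N \<le> m")
        case True
        have "AE a in P. a \<notin> Fail"
          using AE_gauss_kernel_trivial[OF True] unfolding P_def
        proof (rule eventually_mono)
          fix a :: "nat \<times> nat \<Rightarrow> real" assume ker: "\<forall>h. (\<forall>i\<in>{1..m}. (\<Sum>j=1..N. h j * a (i, j)) = 0) \<longrightarrow> (\<forall>j\<in>{1..N}. h j = 0)"
          show "a \<notin> Fail"
          proof
            assume "a \<in> Fail"
            then obtain h where h: "h \<in> U" "\<forall>i\<in>{1..m}. (\<Sum>j=1..N. h j * a (i, j)) = 0" by (auto simp: Fail_def)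
            then have "(\<Sum>j=1..N. (h j)\<^sup>2) = 0" using ker by (intro sum.neutral) auto
            then show False using box_l1_dirs_unit h(1) by (simp add: U_def)
          qed
        qed
        then have "prob Fail = 0" using Fail by (simp add: prob_eq_0)
        then show ?thesis using eps by simp
      next
        case False
        then have mN: "m < N" by simp
        \<comment> \<open>The hypothesis bounds only the infimum by \<open>m - T\<close>, and the
          infimum need not be attained. The extra 1 provides a \<open>t\<close> with
          \<open>f t < M\<close> and makes \<open>M\<close> strictly positive.\<close>
        define M where "M = real m - T + 1"
        have "(INF t\<in>{0..}. f t) < M" using bnd by (simp add: M_def)
        moreover have "bdd_below (f ` {0..})" using f0 by (intro bdd_belowI2[where m = 0]) auto
        ultimately obtain t where t: "0 \<le> t" "f t < M" by (subst (asm) cINF_less_iff) auto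
        have M0: "0 < M" using f0[of t] t by linarith
        have K_sub: "K i \<subseteq> {1..N}" if "i \<in> {-int L1..int L2}" for i using cover that by auto
        have fin: "finite (K i)" if "i \<in> {-int L1..int L2}" for i using K_sub[OF that] finite_subset by auto
        \<comment> \<open>The coordinates where \<open>x\<close> is nonzero and strictly inside the
          box; together with the two end blocks and the zero block they partition
          \<open>{1..N}\<close>.\<close>
        define Kh where "Kh = (\<Union>i\<in>{-int L1..int L2} - {0}. K i) - (K (- int L1) \<union> K (int L2))"
        define V where "V j = (\<integral>u. dual_dist_sq ?lo ?hi t (x j) u \<partial>std_gauss)" for j
        have in_lo: "- int L1 \<in> {-int L1..int L2}" and in_hi: "int L2 \<in> {-int L1..int L2}" and in_0: "0 \<in> {-int L1..int L2}"
          by auto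
        have Kd: "K (- int L1) \<inter> K (int L2) = {}" "K (- int L1) \<inter> K 0 = {}" "K (int L2) \<inter> K 0 = {}"
          using disj[rule_format, OF in_lo in_hi] disj[rule_format, OF in_lo in_0] disj[rule_format, OF in_hi in_0] L1 L2
          by simp_all
        have Kh_eq: "{1..N} = Kh \<union> (K (- int L1) \<union> (K (int L2) \<union> K 0))"
        proof -
          have "(\<Union>i\<in>{-int L1..int L2}. K i) = (\<Union>i\<in>{-int L1..int L2} - {0}. K i) \<union> K 0" using in_0 by blast
          then have "{1..N} = (\<Union>i\<in>{-int L1..int L2} - {0}. K i) \<union> K 0" unfolding cover .
          moreover have "X = (A - (B \<union> C)) \<union> (B \<union> (C \<union> Z))" if "X = A \<union> Z" "B \<subseteq> X" "C \<subseteq> X" for X A B C Z :: "nat set"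
            using that by blast
          ultimately show ?thesis unfolding Kh_def using K_sub[OF in_lo] K_sub[OF in_hi] by simp
        qed
        have Kh0: "Kh \<inter> K 0 = {}" using disj in_0 unfolding Kh_def by blast
        have Kh_lo: "Kh \<inter> K (- int L1) = {}" and Kh_hi: "Kh \<inter> K (int L2) = {}" unfolding Kh_def by blast+
        have Kh_fin: "finite Kh" unfolding Kh_def using fin by auto
        have "(\<Sum>j=1..N. V j) = (\<Sum>j\<in>Kh. V j) + ((\<Sum>j\<in>K (- int L1). V j) + ((\<Sum>j\<in>K (int L2). V j) + (\<Sum>j\<in>K 0. V j)))"
          unfolding Kh_eq using fin[OF in_lo] fin[OF in_hi] fin[OF in_0] Kh_fin Kd Kh0
          by (simp add: sum.union_disjoint Int_Un_distrib Kh_lo Kh_hi)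
        also have "(\<Sum>j\<in>Kh. V j) = (\<Sum>j\<in>Kh. 1 + t\<^sup>2)"
        proof (rule sum.cong[OF refl])
          fix j assume j: "j \<in> Kh"
          then obtain i where i: "i \<in> {-int L1..int L2}" "i \<noteq> 0" "j \<in> K i" unfolding Kh_def by blast
          then have ine: "i \<noteq> - int L1" "i \<noteq> int L2" using j by (auto simp: Kh_def)
          have "real_of_int i \<noteq> real_of_int (- int L1)" "real_of_int i \<noteq> real_of_int (int L2)"
            using ine by (simp_all only: of_int_eq_iff not_False_eq_True)
          then have "x j \<noteq> 0" "x j \<noteq> ?lo" "x j \<noteq> ?hi"
            using xK[OF i(1,3)] i(2) by simp_all
          then show "V j = 1 + t\<^sup>2" unfolding V_def by (subst integral_dual_dist_sq[OF t(1)]) simp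
        qed
        also have "(\<Sum>j\<in>K (- int L1). V j) = (\<Sum>j\<in>K (- int L1). \<integral>u. (excess (- t) u)\<^sup>2 \<partial>std_gauss)"
          unfolding V_def using xK[OF in_lo] L1 by (intro sum.cong refl, subst integral_dual_dist_sq[OF t(1)]) auto
        also have "(\<Sum>j\<in>K (int L2). V j) = (\<Sum>j\<in>K (int L2). \<integral>u. (excess (- t) u)\<^sup>2 \<partial>std_gauss)"
          unfolding V_def using xK[OF in_hi] L2 by (intro sum.cong refl, subst integral_dual_dist_sq[OF t(1)]) auto
        also have "(\<Sum>j\<in>K 0. V j) = (\<Sum>j\<in>K 0. 2 * (\<integral>u. (excess t u)\<^sup>2 \<partial>std_gauss))"
          unfolding V_def using xK[OF in_0] by (intro sum.cong refl, subst integral_dual_dist_sq[OF t(1)]) auto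
        finally have V: "(\<Sum>j=1..N. V j) = f t" unfolding f_def Kh_def[symmetric] by simp
        define d where "d = sqrt (real m - 1) - sqrt M"
        have d: "0 < d" "exp (- d\<^sup>2) \<le> exp (1 - 2 * L)"
          using failure_exponent_bound[OF L T_def mN Tm M_def d_def M0] by auto
        \<comment> \<open>The value \<open>l = 2 * d\<close> minimises
          \<open>- l * d + l\<^sup>2 / 4\<close>, with minimum \<open>- d\<^sup>2\<close>.\<close>
        have "prob Fail \<le> exp (- (2 * d) * (sqrt (real m - 1) - sqrt M) + (2 * d)\<^sup>2 / 4)"
          unfolding P_def
        proof (rule kernel_prob_le[where z = "\<lambda>j. dual_dist_sq ?lo ?hi t (x j)" and U = U])
          show "(\<Sum>j=1..N. (h j)\<^sup>2) = 1" if "h \<in> U" for h using that box_l1_dirs_unit by (simp add: U_def)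
          show "sub_chi_sq (dual_dist_sq ?lo ?hi t (x j))" for j by (rule sub_chi_sq_dual_dist[OF t(1)])
          show "(\<Sum>j=1..N. h j * g j) \<le> sqrt (\<Sum>j=1..N. dual_dist_sq ?lo ?hi t (x j) (g j))" if "h \<in> U" for h g
            using that unfolding U_def by (rule box_l1_dirs_dual) (use t L1 L2 in auto)
          show "(\<Sum>j=1..N. \<integral>u. dual_dist_sq ?lo ?hi t (x j) u \<partial>std_gauss) \<le> M" using V t(2) by (simp add: V_def)
          show "Fail \<in> sets (gauss ({1..m} \<times> {1..N}))" using Fail by (simp add: P_def)
        qed (use M0 m d in \<open>auto simp: Fail_def\<close>)
        also have "\<dots> = exp (- d\<^sup>2)" unfolding d_def[symmetric] by (simp add: power2_eq_square)
        also have "\<dots> \<le> exp (1 - 2 * L)" by (rule d(2))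
        \<comment> \<open>By \<open>L \<ge> 1\<close>; this is where the additive loss of 1 in the
          exponent is absorbed.\<close>
        also have "\<dots> \<le> exp (- L)" using L by simp
        also have "\<dots> = \<epsilon> / 4" unfolding L_def exp_minus using eps by simp
        also have "\<dots> < \<epsilon>" using eps by simp
        finally show ?thesis .
      qed
      then show ?thesis using Ev by simp
    qed
  qed
  have "{a \<in> space P. (let x0 = (\<lambda>j. \<Sum>i\<in>{-int L1..int L2}. real_of_int i * indicator (K i) j);
                   A = gauss_matrix m a;
                   b = (\<lambda>i. \<Sum>j\<in>{1..N}. A i j * x0 j)
               in unique_box_l1_solution m N A b (- real L1) (real L2) x0)} = Ev"
    unfolding Ev_def Let_def x_def[abs_def] ..
  then show ?thesis unfolding P using goal by simp
qed

end
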